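(* Let $\mathfrak{p}$ be a prime ideal in a commutative noetherian ring $R$ and let $M$ be an $R$-module. If $\operatorname{Ext}^{n}_{R_{\mathfrak{p}}}(k(\mathfrak{p}),M_{\mathfrak{p}})=0$ for some integer $n \geqslant \dim R_{\mathfrak{p}}$, then $\operatorname{Ext}^i_{R_{\mathfrak{p}}}(k(\mathfrak{p}),M_{\mathfrak{p}}) = 0$ for all $i \geqslant n$.
   Context: For a prime ideal $\mathfrak{p}$ of $R$, $k(\mathfrak{p}) := R_{\mathfrak{p}}/\mathfrak{p}R_{\mathfrak{p}}$ denotes the residue field at $\mathfrak{p}$. $\dim$ denotes Krull dimension. The module $M$ is not assumed finitely generated. *)

theory Defs
  imports "HOL-Algebra.Algebra" "HOL-Library.Extended_Nat"
begin

text \<open>Supremum of the lengths \<open>n\<close> of strictly increasing chains \<open>P 0 \<subset> \<dots> \<subset> P n\<close> of prime ideals.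
  As \<open>enat\<close> has no negative elements, the zero ring gets dimension \<open>0\<close>.\<close>

definition krull_dim :: "('a, 'r) ring_scheme \<Rightarrow> enat" where
  "krull_dim R = Sup {enat n | n.
     \<exists>P :: nat \<Rightarrow> 'a set. (\<forall>i\<le>n. primeideal (P i) R) \<and> (\<forall>i<n. P i \<subset> P (Suc i))}"

text \<open>The ring \<open>B\<close> regarded as a module over the domain of a ring homomorphism \<open>\<phi>\<close> into \<open>B\<close>.\<close>

definition module_via :: "('c \<Rightarrow> 'a) \<Rightarrow> ('a, 'r) ring_scheme \<Rightarrow> ('c, 'a) module" where
  "module_via \<phi> B =
     \<lparr>carrier = carrier B, monoid.mult = monoid.mult B, one = one B, ring.zero = ring.zero B,
      ring.add = ring.add B, smult = (\<lambda>a b. \<phi> a \<otimes>\<^bsub>B\<^esub> b)\<rparr>"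

text \<open>Equality of fractions \<open>m/s = m'/s'\<close> with numerators in \<open>M\<close> and denominators in the
  multiplicative set \<open>S\<close>: some \<open>u \<in> S\<close> satisfies \<open>u(s'm) = u(sm')\<close>.\<close>

definition fraction_rel ::
    "'a set \<Rightarrow> ('a, 'b, 'm) module_scheme \<Rightarrow> (('b \<times> 'a) \<times> ('b \<times> 'a)) set" where
  "fraction_rel S M = {((m, s), (m', s')).
     m \<in> carrier M \<and> s \<in> S \<and> m' \<in> carrier M \<and> s' \<in> S \<and>
     (\<exists>u\<in>S. u \<odot>\<^bsub>M\<^esub> (s' \<odot>\<^bsub>M\<^esub> m) = u \<odot>\<^bsub>M\<^esub> (s \<odot>\<^bsub>M\<^esub> m'))}"

definition fraction :: "'a set \<Rightarrow> ('a, 'b, 'm) module_scheme \<Rightarrow> 'b \<Rightarrow> 'a \<Rightarrow> ('b \<times> 'a) set" where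
  "fraction S M m s = fraction_rel S M `` {(m, s)}"

abbreviation ring_fraction :: "'a set \<Rightarrow> ('a, 'r) ring_scheme \<Rightarrow> 'a \<Rightarrow> 'a \<Rightarrow> ('a \<times> 'a) set" where
  "ring_fraction S R \<equiv> fraction S (module_via id R)"

text \<open>The operations on classes are unions over all representatives; by independence of the
  representatives all members of such a union coincide.\<close>

definition localize_ring :: "('a, 'r) ring_scheme \<Rightarrow> 'a set \<Rightarrow> ('a \<times> 'a) set ring" where
  "localize_ring R S =
     \<lparr>carrier = (carrier R \<times> S) // fraction_rel S (module_via id R),
      monoid.mult = (\<lambda>A B. \<Union>(a, s)\<in>A. \<Union>(b, t)\<in>B.
               ring_fraction S R (a \<otimes>\<^bsub>R\<^esub> b) (s \<otimes>\<^bsub>R\<^esub> t)),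
      one = ring_fraction S R \<one>\<^bsub>R\<^esub> \<one>\<^bsub>R\<^esub>,
      ring.zero = ring_fraction S R \<zero>\<^bsub>R\<^esub> \<one>\<^bsub>R\<^esub>,
      ring.add = (\<lambda>A B. \<Union>(a, s)\<in>A. \<Union>(b, t)\<in>B.
               ring_fraction S R (t \<otimes>\<^bsub>R\<^esub> a \<oplus>\<^bsub>R\<^esub> s \<otimes>\<^bsub>R\<^esub> b) (s \<otimes>\<^bsub>R\<^esub> t))\<rparr>"

text \<open>A \<open>module\<close> record inherits the fields \<open>mult\<close> and \<open>one\<close> of rings, which carry no meaning
  for modules.\<close>

definition localize_module ::
    "('a, 'r) ring_scheme \<Rightarrow> 'a set \<Rightarrow> ('a, 'b, 'm) module_scheme
       \<Rightarrow> (('a \<times> 'a) set, ('b \<times> 'a) set) module" where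
  "localize_module R S M =
     \<lparr>carrier = (carrier M \<times> S) // fraction_rel S M,
      monoid.mult = undefined, one = undefined,
      ring.zero = fraction S M \<zero>\<^bsub>M\<^esub> \<one>\<^bsub>R\<^esub>,
      ring.add = (\<lambda>A B. \<Union>(m, s)\<in>A. \<Union>(m', t)\<in>B.
               fraction S M (t \<odot>\<^bsub>M\<^esub> m \<oplus>\<^bsub>M\<^esub> s \<odot>\<^bsub>M\<^esub> m') (s \<otimes>\<^bsub>R\<^esub> t)),
      smult = (\<lambda>A B. \<Union>(a, s)\<in>A. \<Union>(m, t)\<in>B.
               fraction S M (a \<odot>\<^bsub>M\<^esub> m) (s \<otimes>\<^bsub>R\<^esub> t))\<rparr>"

definition ring_at_prime :: "('a, 'r) ring_scheme \<Rightarrow> 'a set \<Rightarrow> ('a \<times> 'a) set ring" where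
  "ring_at_prime R p = localize_ring R (carrier R - p)"

definition module_at_prime ::
    "('a, 'r) ring_scheme \<Rightarrow> 'a set \<Rightarrow> ('a, 'b, 'm) module_scheme
       \<Rightarrow> (('a \<times> 'a) set, ('b \<times> 'a) set) module" where
  "module_at_prime R p M = localize_module R (carrier R - p) M"

definition extended_prime :: "('a, 'r) ring_scheme \<Rightarrow> 'a set \<Rightarrow> ('a \<times> 'a) set set" where
  "extended_prime R p =
     genideal (ring_at_prime R p) ((\<lambda>a. ring_fraction (carrier R - p) R a \<one>\<^bsub>R\<^esub>) ` p)"

definition residue_field :: "('a, 'r) ring_scheme \<Rightarrow> 'a set \<Rightarrow> ('a \<times> 'a) set set ring" where
  "residue_field R p = ring_at_prime R p Quot extended_prime R p"

definition residue_module ::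
    "('a, 'r) ring_scheme \<Rightarrow> 'a set \<Rightarrow> (('a \<times> 'a) set, ('a \<times> 'a) set set) module" where
  "residue_module R p =
     module_via (\<lambda>x. extended_prime R p +>\<^bsub>ring_at_prime R p\<^esub> x) (residue_field R p)"

definition linear_maps ::
    "('a, 'r) ring_scheme \<Rightarrow> ('a, 'b, 'm) module_scheme \<Rightarrow> ('a, 'c, 'n) module_scheme
       \<Rightarrow> ('b \<Rightarrow> 'c) set" where
  "linear_maps R N M = {f \<in> carrier N \<rightarrow>\<^sub>E carrier M.
     (\<forall>x\<in>carrier N. \<forall>y\<in>carrier N. f (x \<oplus>\<^bsub>N\<^esub> y) = f x \<oplus>\<^bsub>M\<^esub> f y) \<and>
     (\<forall>a\<in>carrier R. \<forall>x\<in>carrier N. f (a \<odot>\<^bsub>N\<^esub> x) = a \<odot>\<^bsub>M\<^esub> f x)}"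

definition free_module :: "('a, 'r) ring_scheme \<Rightarrow> 'i set \<Rightarrow> ('a, 'i \<Rightarrow> 'a) module" where
  "free_module R I =
     \<lparr>carrier = {v. (\<forall>i\<in>I. v i \<in> carrier R) \<and> (\<forall>i. i \<notin> I \<longrightarrow> v i = \<zero>\<^bsub>R\<^esub>) \<and>
                    finite {i. v i \<noteq> \<zero>\<^bsub>R\<^esub>}},
      monoid.mult = undefined, one = undefined,
      ring.zero = (\<lambda>_. \<zero>\<^bsub>R\<^esub>),
      ring.add = (\<lambda>v w i. v i \<oplus>\<^bsub>R\<^esub> w i),
      smult = (\<lambda>a v i. a \<otimes>\<^bsub>R\<^esub> v i)\<rparr>"

text \<open>Every \<open>R\<close>-module \<open>N\<close> has the free resolution
  \<open>\<dots> \<rightarrow> F 2 \<rightarrow> F 1 \<rightarrow> F 0 \<rightarrow> N \<rightarrow> 0\<close> in which \<open>F 0\<close> is free on the elements of \<open>N\<close> and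
  \<open>F (k + 1)\<close> is free on a generating set of the kernel of the map leaving \<open>F k\<close>.  So that all
  \<open>F k\<close> live in one type, the basis elements are taken from the following datatype: \<open>Gen x\<close>
  is the basis element of \<open>F 0\<close> lying over \<open>x \<in> N\<close>, and \<open>Syz [(e\<^sub>1, a\<^sub>1), \<dots>, (e\<^sub>m, a\<^sub>m)]\<close> is a basis
  element of \<open>F (k + 1)\<close> whose image in \<open>F k\<close> is the cycle \<open>a\<^sub>1e\<^sub>1 + \<dots> + a\<^sub>me\<^sub>m\<close>.  All expressions
  of all cycles occur, so that the basis depends on no choices.\<close>

datatype ('a, 'b) basis_elem = Gen 'b | Syz "(('a, 'b) basis_elem \<times> 'a) list"

primrec lin_comb :: "('a, 'r) ring_scheme \<Rightarrow> ('i \<times> 'a) list \<Rightarrow> 'i \<Rightarrow> 'a" where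
  "lin_comb R [] = (\<lambda>_. \<zero>\<^bsub>R\<^esub>)"
| "lin_comb R (ea # xs) =
     (\<lambda>i. (if i = fst ea then snd ea else \<zero>\<^bsub>R\<^esub>) \<oplus>\<^bsub>R\<^esub> lin_comb R xs i)"

primrec gen_value :: "('a, 'b) basis_elem \<Rightarrow> 'b" where
  "gen_value (Gen x) = x"

primrec syz_value ::
    "('a, 'r) ring_scheme \<Rightarrow> ('a, 'b) basis_elem \<Rightarrow> ('a, 'b) basis_elem \<Rightarrow> 'a" where
  "syz_value R (Syz xs) = lin_comb R xs"

text \<open>The linear extensions of \<open>gen_value\<close> and \<open>syz_value\<close>.\<close>

definition augmentation ::
    "('a, 'r) ring_scheme \<Rightarrow> ('a, 'b, 'm) module_scheme \<Rightarrow> (('a, 'b) basis_elem \<Rightarrow> 'a) \<Rightarrow> 'b" where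
  "augmentation R N v = (\<Oplus>\<^bsub>N\<^esub> e\<in>{e. v e \<noteq> \<zero>\<^bsub>R\<^esub>}. v e \<odot>\<^bsub>N\<^esub> gen_value e)"

definition differential ::
    "('a, 'r) ring_scheme \<Rightarrow> (('a, 'b) basis_elem \<Rightarrow> 'a) \<Rightarrow> ('a, 'b) basis_elem \<Rightarrow> 'a" where
  "differential R v = (\<lambda>i. \<Oplus>\<^bsub>R\<^esub> e\<in>{e. v e \<noteq> \<zero>\<^bsub>R\<^esub>}. v e \<otimes>\<^bsub>R\<^esub> syz_value R e i)"

text \<open>\<open>is_cycle R N k v\<close>: the element \<open>v\<close> of \<open>F k\<close> is killed by the map leaving \<open>F k\<close>.\<close>

definition is_cycle ::
    "('a, 'r) ring_scheme \<Rightarrow> ('a, 'b, 'm) module_scheme \<Rightarrow> nat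
       \<Rightarrow> (('a, 'b) basis_elem \<Rightarrow> 'a) \<Rightarrow> bool" where
  "is_cycle R N k v \<longleftrightarrow>
     (if k = 0 then augmentation R N v = \<zero>\<^bsub>N\<^esub> else differential R v = (\<lambda>_. \<zero>\<^bsub>R\<^esub>))"

primrec res_basis ::
    "('a, 'r) ring_scheme \<Rightarrow> ('a, 'b, 'm) module_scheme \<Rightarrow> nat \<Rightarrow> ('a, 'b) basis_elem set" where
  "res_basis R N 0 = Gen ` carrier N"
| "res_basis R N (Suc k) =
     {Syz xs | xs. set xs \<subseteq> res_basis R N k \<times> carrier R \<and> is_cycle R N k (lin_comb R xs)}"

definition std_res ::
    "('a, 'r) ring_scheme \<Rightarrow> ('a, 'b, 'm) module_scheme \<Rightarrow> nat
       \<Rightarrow> ('a, ('a, 'b) basis_elem \<Rightarrow> 'a) module" where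
  "std_res R N k = free_module R (res_basis R N k)"

definition hom_group ::
    "('a, 'r) ring_scheme \<Rightarrow> ('a, 'b, 'm) module_scheme \<Rightarrow> ('a, 'c, 'n) module_scheme
       \<Rightarrow> ('b \<Rightarrow> 'c) monoid" where
  "hom_group R N M =
     \<lparr>carrier = linear_maps R N M,
      monoid.mult = (\<lambda>f g. \<lambda>x\<in>carrier N. f x \<oplus>\<^bsub>M\<^esub> g x),
      one = (\<lambda>x\<in>carrier N. \<zero>\<^bsub>M\<^esub>)\<rparr>"

definition Ext_cocycles ::
    "('a, 'r) ring_scheme \<Rightarrow> nat \<Rightarrow> ('a, 'b, 'm) module_scheme \<Rightarrow> ('a, 'c, 'n) module_scheme
       \<Rightarrow> ((('a, 'b) basis_elem \<Rightarrow> 'a) \<Rightarrow> 'c) set" where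
  "Ext_cocycles R n N M = {f \<in> linear_maps R (std_res R N n) M.
     \<forall>v\<in>carrier (std_res R N (Suc n)). f (differential R v) = \<zero>\<^bsub>M\<^esub>}"

definition Ext_coboundaries ::
    "('a, 'r) ring_scheme \<Rightarrow> nat \<Rightarrow> ('a, 'b, 'm) module_scheme \<Rightarrow> ('a, 'c, 'n) module_scheme
       \<Rightarrow> ((('a, 'b) basis_elem \<Rightarrow> 'a) \<Rightarrow> 'c) set" where
  "Ext_coboundaries R n N M = (case n of
       0 \<Rightarrow> {\<lambda>v\<in>carrier (std_res R N 0). \<zero>\<^bsub>M\<^esub>}
     | Suc k \<Rightarrow> (\<lambda>g. \<lambda>v\<in>carrier (std_res R N (Suc k)). g (differential R v)) `
                 linear_maps R (std_res R N k) M)"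

text \<open>The group \<open>Ext\<^sup>n\<^sub>R(N, M)\<close>: the \<open>n\<close>-th cohomology of the complex \<open>Hom\<^sub>R(F, M)\<close>, where \<open>F\<close> is the
  standard free resolution of \<open>N\<close>.\<close>

definition Ext ::
    "('a, 'r) ring_scheme \<Rightarrow> nat \<Rightarrow> ('a, 'b, 'm) module_scheme \<Rightarrow> ('a, 'c, 'n) module_scheme
       \<Rightarrow> ((('a, 'b) basis_elem \<Rightarrow> 'a) \<Rightarrow> 'c) set monoid" where
  "Ext R n N M =
     (hom_group R (std_res R N n) M)\<lparr>carrier := Ext_cocycles R n N M\<rparr> Mod Ext_coboundaries R n N M"

end

theory Submission
  imports Defs
begin

text \<open>Write \<open>(A, m, k)\<close> for the local ring \<open>R\<^sub>p\<close> and \<open>E\<^sup>i(I)\<close> for \<open>Ext\<^sup>i(A/I, M)\<close>.  Only cyclic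
  modules and the exact sequences \<open>0 \<rightarrow> A/(I : a) \<rightarrow> A/I \<rightarrow> A/(I + (a)) \<rightarrow> 0\<close> are needed.

  Let \<open>E\<^sup>n(m) = 0\<close>.  If \<open>J \<noteq> m\<close> and \<open>m\<close> is the only prime over \<open>J\<close>, some \<open>a \<in> m - J\<close> has
  \<open>(J : a) = m\<close>, so \<open>E\<^sup>n\<^sup>+\<^sup>1(J + (a)) \<rightarrow> E\<^sup>n\<^sup>+\<^sup>1(J)\<close> is injective; climbing from \<open>J\<close> to \<open>m\<close>,
  \<open>E\<^sup>n\<^sup>+\<^sup>1(m) \<rightarrow> E\<^sup>n\<^sup>+\<^sup>1(J)\<close> is injective.  As \<open>n \<ge> dim A\<close>, there are \<open>y\<^sub>1, \<dots>, y\<^sub>n \<in> m\<close> lying in no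
  prime but \<open>m\<close>, and every class in \<open>E\<^sup>i\<close> with \<open>i > n\<close> dies on \<open>A/(y\<^sub>1\<^sup>s, \<dots>, y\<^sub>n\<^sup>t)\<close> for large
  exponents.  This follows by induction on the number of the \<open>y\<close>: modulo \<open>y\<^sup>s\<close>, a class that dies on \<open>A/I\<close>
  comes from \<open>E\<^sup>i\<^sup>-\<^sup>1(I : y\<^sup>s)\<close>, and multiplication by a high power of \<open>y\<close> from
  \<open>A/(J : y\<^sup>N\<^sup>+\<^sup>s)\<close> to \<open>A/(I : y\<^sup>s)\<close> factors through \<open>A/J\<close>, as the chain of the ideals
  \<open>(J : y\<^sup>N)\<close> is stationary.  Hence \<open>E\<^sup>n\<^sup>+\<^sup>1(m) = 0\<close>.\<close>

section \<open>Linear maps\<close>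

text \<open>Over the ideals \<open>(y_1^s, ..., y_n^t)\<close> the direct limit of the
  \<open>E^i\<close> is the local cohomology of M with support in m. The second half of the argument
  is its vanishing in degrees above n; the first half embeds \<open>E^(n+1)(m)\<close> into every
  member of the system, which forces it to be zero. Working with single classes replaces limits and
  injective modules; since M is arbitrary, no finiteness of the groups \<open>E^i\<close>, and hence
  no Nakayama argument, is available. Cyclic modules suffice because adjoining one element to an
  ideal is the only extension ever made. They also share one type, so that quantifying over ideals
  replaces quantifying over modules. The delicate point is naturality: the class on
  \<open>(I : a)\<close> from which a class on \<open>I + (a)\<close> arises must be followed along
  a change of both the ideal and the element, on cochains of fixed resolutions. A mapping cone
  serves as auxiliary resolution there. The number n enters twice: n parameters make degree n + 1
  effaceable, and vanishing in degree n feeds the climb. As dim A <= n implies dim A <= n + 1, the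
  step can be repeated.\<close>

definition is_linear ::
    "('c, 'r) ring_scheme \<Rightarrow> ('c, 'x, 'm) module_scheme \<Rightarrow> ('c, 'y, 'n) module_scheme
       \<Rightarrow> ('x \<Rightarrow> 'y) \<Rightarrow> bool" where
  "is_linear A N M f \<longleftrightarrow> f \<in> carrier N \<rightarrow> carrier M \<and>
     (\<forall>x\<in>carrier N. \<forall>y\<in>carrier N. f (x \<oplus>\<^bsub>N\<^esub> y) = f x \<oplus>\<^bsub>M\<^esub> f y) \<and>
     (\<forall>a\<in>carrier A. \<forall>x\<in>carrier N. f (a \<odot>\<^bsub>N\<^esub> x) = a \<odot>\<^bsub>M\<^esub> f x)"

lemma is_linear_closed: "is_linear A N M f \<Longrightarrow> x \<in> carrier N \<Longrightarrow> f x \<in> carrier M"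
  by (auto simp: is_linear_def)

lemma is_linear_add:
  "is_linear A N M f \<Longrightarrow> x \<in> carrier N \<Longrightarrow> y \<in> carrier N \<Longrightarrow> f (x \<oplus>\<^bsub>N\<^esub> y) = f x \<oplus>\<^bsub>M\<^esub> f y"
  by (auto simp: is_linear_def)

lemma is_linear_smult:
  "is_linear A N M f \<Longrightarrow> a \<in> carrier A \<Longrightarrow> x \<in> carrier N \<Longrightarrow> f (a \<odot>\<^bsub>N\<^esub> x) = a \<odot>\<^bsub>M\<^esub> f x"
  by (auto simp: is_linear_def)

lemma is_linearI:
  assumes "\<And>x. x \<in> carrier N \<Longrightarrow> f x \<in> carrier M"
    and "\<And>x y. x \<in> carrier N \<Longrightarrow> y \<in> carrier N \<Longrightarrow> f (x \<oplus>\<^bsub>N\<^esub> y) = f x \<oplus>\<^bsub>M\<^esub> f y"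
    and "\<And>a x. a \<in> carrier A \<Longrightarrow> x \<in> carrier N \<Longrightarrow> f (a \<odot>\<^bsub>N\<^esub> x) = a \<odot>\<^bsub>M\<^esub> f x"
  shows "is_linear A N M f"
  using assms by (auto simp: is_linear_def)

lemma is_linear_zero:
  assumes "module A N" "module A M" "is_linear A N M f"
  shows "f \<zero>\<^bsub>N\<^esub> = \<zero>\<^bsub>M\<^esub>"
proof -
  interpret N: module A N by fact
  interpret M: module A M by fact
  have "f (\<zero>\<^bsub>A\<^esub> \<odot>\<^bsub>N\<^esub> \<zero>\<^bsub>N\<^esub>) = \<zero>\<^bsub>A\<^esub> \<odot>\<^bsub>M\<^esub> f \<zero>\<^bsub>N\<^esub>"
    by (rule is_linear_smult[OF assms(3)]) auto
  then show ?thesis using is_linear_closed[OF assms(3), of "\<zero>\<^bsub>N\<^esub>"] by simp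
qed

lemma is_linear_minus:
  assumes "module A N" "module A M" "is_linear A N M f" "x \<in> carrier N"
  shows "f (\<ominus>\<^bsub>N\<^esub> x) = \<ominus>\<^bsub>M\<^esub> f x"
proof -
  interpret N: module A N by fact
  interpret M: module A M by fact
  have "f (\<ominus>\<^bsub>N\<^esub> x) \<oplus>\<^bsub>M\<^esub> f x = \<zero>\<^bsub>M\<^esub>"
    using is_linear_add[OF assms(3), of "\<ominus>\<^bsub>N\<^esub> x" x] assms
    by (simp add: N.M.l_neg is_linear_zero)
  then show ?thesis using is_linear_closed[OF assms(3)] assms(4)
    by (intro M.M.minus_equality[symmetric]) auto
qed

lemma is_linear_diff:
  assumes "module A N" "module A M" "is_linear A N M f" "x \<in> carrier N" "y \<in> carrier N"
  shows "f (x \<ominus>\<^bsub>N\<^esub> y) = f x \<ominus>\<^bsub>M\<^esub> f y"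
proof -
  interpret N: module A N by fact
  show ?thesis using assms
    by (simp add: a_minus_def is_linear_add[OF assms(3)] is_linear_minus[OF assms(1-3)])
qed

lemma is_linear_comp:
  assumes "is_linear A L N f" "is_linear A N M g"
  shows "is_linear A L M (\<lambda>x. g (f x))"
  using assms unfolding is_linear_def by (auto simp: Pi_iff)

lemma is_linear_sum:
  assumes "module A M" "is_linear A N M f" "is_linear A N M g"
  shows "is_linear A N M (\<lambda>x. f x \<oplus>\<^bsub>M\<^esub> g x)"
proof -
  interpret M: module A M by fact
  show ?thesis
    using is_linear_closed[OF assms(2)] is_linear_closed[OF assms(3)]
    by (intro is_linearI)
       (auto simp: is_linear_add[OF assms(2)] is_linear_add[OF assms(3)] M.smult_r_distr
         is_linear_smult[OF assms(2)] is_linear_smult[OF assms(3)] M.M.a_ac)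
qed

lemma is_linear_neg:
  assumes "module A M" "is_linear A N M f"
  shows "is_linear A N M (\<lambda>x. \<ominus>\<^bsub>M\<^esub> f x)"
proof -
  interpret M: module A M by fact
  show ?thesis
    using is_linear_closed[OF assms(2)]
    by (intro is_linearI)
       (auto simp: is_linear_add[OF assms(2)] M.smult_r_minus M.M.minus_add
         is_linear_smult[OF assms(2)])
qed

lemma is_linear_sub:
  assumes "module A M" "is_linear A N M f" "is_linear A N M g"
  shows "is_linear A N M (\<lambda>x. f x \<ominus>\<^bsub>M\<^esub> g x)"
  unfolding a_minus_def by (intro is_linear_sum is_linear_neg assms)

lemma is_linear_zero_map:
  assumes "module A M"
  shows "is_linear A N M (\<lambda>x. \<zero>\<^bsub>M\<^esub>)"
proof -
  interpret M: module A M by fact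
  show ?thesis by (intro is_linearI) auto
qed

lemma is_linear_id: "is_linear A N N (\<lambda>x. x)"
  by (intro is_linearI) auto

section \<open>Free modules\<close>

definition basis_vec :: "('c, 'r) ring_scheme \<Rightarrow> 'i \<Rightarrow> 'i \<Rightarrow> 'c" where
  "basis_vec A e = (\<lambda>i. if i = e then \<one>\<^bsub>A\<^esub> else \<zero>\<^bsub>A\<^esub>)"

text \<open>Common form of the two maps of the standard resolution: \<open>augmentation\<close> is
  the case of \<open>gen_value\<close>, and \<open>differential\<close> agrees on the free module
  with the case of \<open>syz_value\<close>. Summing over the support avoids naming the
  basis.\<close>

definition lin_ext ::
    "('c, 'r) ring_scheme \<Rightarrow> ('c, 'y, 'n) module_scheme \<Rightarrow> ('i \<Rightarrow> 'y) \<Rightarrow> ('i \<Rightarrow> 'c) \<Rightarrow> 'y" where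
  "lin_ext A N g v = (\<Oplus>\<^bsub>N\<^esub> e\<in>{e. v e \<noteq> \<zero>\<^bsub>A\<^esub>}. v e \<odot>\<^bsub>N\<^esub> g e)"

context cring
begin

lemma free_module_carrierD:
  assumes "v \<in> carrier (free_module R B)"
  shows "v i \<in> carrier R" "i \<notin> B \<Longrightarrow> v i = \<zero>" "finite {i. v i \<noteq> \<zero>}" "{i. v i \<noteq> \<zero>} \<subseteq> B"
  using assms zero_closed by (fastforce simp: free_module_def)+

lemma free_module_is_module:
  fixes B :: "'i set"
  shows "module R (free_module R B)"
proof (rule moduleI)
  have fin: "finite {i. v i \<oplus> w i \<noteq> \<zero>}"
    if "finite {i. v i \<noteq> \<zero>}" "finite {i. w i \<noteq> \<zero>}" for v w :: "'i \<Rightarrow> 'a"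
    by (rule finite_subset[of _ "{i. v i \<noteq> \<zero>} \<union> {i. w i \<noteq> \<zero>}"]) (use that in auto)
  have fin': "finite {i. a \<otimes> v i \<noteq> \<zero>}"
    if "finite {i. v i \<noteq> \<zero>}" "a \<in> carrier R" for a and v :: "'i \<Rightarrow> 'a"
    by (rule finite_subset[of _ "{i. v i \<noteq> \<zero>}"]) (use that in auto)
  have m: "v i \<in> carrier R" if "v \<in> carrier (free_module R B)" for v i
    using free_module_carrierD[OF that] by auto
  show "cring R" by (rule is_cring)
  show "abelian_group (free_module R B)"
  proof (rule abelian_groupI)
    fix v assume v: "v \<in> carrier (free_module R B)"
    have "(\<lambda>i. \<ominus> v i) \<in> carrier (free_module R B)"
      using v by (auto simp: free_module_def elim!: rev_finite_subset)
    moreover have "(\<lambda>i. \<ominus> v i) \<oplus>\<^bsub>free_module R B\<^esub> v = \<zero>\<^bsub>free_module R B\<^esub>"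
      using m[OF v] by (auto simp: free_module_def l_neg)
    ultimately show "\<exists>w\<in>carrier (free_module R B).
        w \<oplus>\<^bsub>free_module R B\<^esub> v = \<zero>\<^bsub>free_module R B\<^esub>" by blast
  next
    fix u v w assume "u \<in> carrier (free_module R B)" "v \<in> carrier (free_module R B)"
      "w \<in> carrier (free_module R B)"
    then show "u \<oplus>\<^bsub>free_module R B\<^esub> v \<oplus>\<^bsub>free_module R B\<^esub> w
        = u \<oplus>\<^bsub>free_module R B\<^esub> (v \<oplus>\<^bsub>free_module R B\<^esub> w)"
      using m[of u] m[of v] m[of w] by (auto simp: free_module_def a_assoc)
  next
    fix v w assume "v \<in> carrier (free_module R B)" "w \<in> carrier (free_module R B)"
    then show "v \<oplus>\<^bsub>free_module R B\<^esub> w = w \<oplus>\<^bsub>free_module R B\<^esub> v"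
      using m[of v] m[of w] by (auto simp: free_module_def a_comm)
  next
    fix v assume "v \<in> carrier (free_module R B)"
    then show "\<zero>\<^bsub>free_module R B\<^esub> \<oplus>\<^bsub>free_module R B\<^esub> v = v"
      using m[of v] by (auto simp: free_module_def)
  qed (auto simp: free_module_def fin)
  show "\<one> \<odot>\<^bsub>free_module R B\<^esub> v = v" if "v \<in> carrier (free_module R B)" for v
    using m[OF that] by (auto simp: free_module_def)
  fix a b v w
  assume a: "a \<in> carrier R" "v \<in> carrier (free_module R B)"
  show "a \<odot>\<^bsub>free_module R B\<^esub> v \<in> carrier (free_module R B)"
    using a by (auto simp: free_module_def fin')
  show "a \<odot>\<^bsub>free_module R B\<^esub> (v \<oplus>\<^bsub>free_module R B\<^esub> w)
      = a \<odot>\<^bsub>free_module R B\<^esub> v \<oplus>\<^bsub>free_module R B\<^esub> a \<odot>\<^bsub>free_module R B\<^esub> w"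
    if "w \<in> carrier (free_module R B)"
    using m[OF a(2)] m[OF that] a by (auto simp: free_module_def r_distr)
  assume b: "b \<in> carrier R"
  show "(a \<oplus> b) \<odot>\<^bsub>free_module R B\<^esub> v
      = a \<odot>\<^bsub>free_module R B\<^esub> v \<oplus>\<^bsub>free_module R B\<^esub> b \<odot>\<^bsub>free_module R B\<^esub> v"
    using m[OF a(2)] a b by (auto simp: free_module_def l_distr)
  show "a \<otimes> b \<odot>\<^bsub>free_module R B\<^esub> v
      = a \<odot>\<^bsub>free_module R B\<^esub> (b \<odot>\<^bsub>free_module R B\<^esub> v)"
    using m[OF a(2)] a b by (auto simp: free_module_def m_assoc)
qed

lemma basis_vec_closed: "e \<in> B \<Longrightarrow> basis_vec R e \<in> carrier (free_module R B)"
  by (auto simp: free_module_def basis_vec_def elim!: rev_finite_subset[of "{e}"])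

text \<open>Two vectors have different supports; their sums can be added term by term only over a
  common finite superset. It has to stay inside \<open>B\<close>, where \<open>g\<close> takes
  values in \<open>N\<close>.\<close>

lemma lin_ext_superset:
  assumes "module R N" "\<And>e. e \<in> B \<Longrightarrow> g e \<in> carrier N" "v \<in> carrier (free_module R B)"
    and "finite S" "{e. v e \<noteq> \<zero>} \<subseteq> S" "S \<subseteq> B"
  shows "lin_ext R N g v = (\<Oplus>\<^bsub>N\<^esub> e\<in>S. v e \<odot>\<^bsub>N\<^esub> g e)"
proof -
  interpret N: module R N by fact
  have c: "v e \<odot>\<^bsub>N\<^esub> g e \<in> carrier N" if "e \<in> B" for e
    using free_module_carrierD(1)[OF assms(3)] assms(2)[OF that] by auto
  show ?thesis unfolding lin_ext_def
    by (rule N.M.add.finprod_mono_neutral_cong_left[simplified])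
       (use assms c in \<open>auto simp: Pi_iff\<close>)
qed

lemma lin_ext_linear:
  assumes "module R N" "\<And>e. e \<in> B \<Longrightarrow> g e \<in> carrier N"
  shows "is_linear R (free_module R B) N (lin_ext R N g)"
proof (rule is_linearI)
  interpret N: module R N by fact
  have sup: "lin_ext R N g v = (\<Oplus>\<^bsub>N\<^esub> e\<in>S. v e \<odot>\<^bsub>N\<^esub> g e)"
    if "v \<in> carrier (free_module R B)" "finite S" "{e. v e \<noteq> \<zero>} \<subseteq> S" "S \<subseteq> B" for v S
    using assms that by (intro lin_ext_superset)
  note D = free_module_carrierD
  interpret F: module R "free_module R B" by (rule free_module_is_module)
  fix x assume x: "x \<in> carrier (free_module R B)"
  have c: "v e \<odot>\<^bsub>N\<^esub> g e \<in> carrier N" if "v \<in> carrier (free_module R B)" "e \<in> B" for v e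
    using D(1)[OF that(1)] assms(2)[OF that(2)] by auto
  show "lin_ext R N g x \<in> carrier N"
    unfolding lin_ext_def by (rule N.M.finsum_closed) (use D(4)[OF x] c[OF x] in auto)
  show "lin_ext R N g (x \<oplus>\<^bsub>free_module R B\<^esub> y) = lin_ext R N g x \<oplus>\<^bsub>N\<^esub> lin_ext R N g y"
    if y: "y \<in> carrier (free_module R B)" for y
  proof -
    let ?S = "{e. x e \<noteq> \<zero>} \<union> {e. y e \<noteq> \<zero>}"
    have S: "finite ?S" "?S \<subseteq> B" using D[OF x] D[OF y] by auto
    have xy: "x \<oplus>\<^bsub>free_module R B\<^esub> y = (\<lambda>i. x i \<oplus> y i)" by (simp add: free_module_def)
    have "lin_ext R N g (x \<oplus>\<^bsub>free_module R B\<^esub> y) = (\<Oplus>\<^bsub>N\<^esub> e\<in>?S. (x e \<oplus> y e) \<odot>\<^bsub>N\<^esub> g e)"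
      by (subst sup[OF F.M.a_closed[OF x y] S(1) _ S(2)]) (auto simp: xy)
    also have "\<dots> = (\<Oplus>\<^bsub>N\<^esub> e\<in>?S. x e \<odot>\<^bsub>N\<^esub> g e \<oplus>\<^bsub>N\<^esub> y e \<odot>\<^bsub>N\<^esub> g e)"
      using S c[OF x] c[OF y] D(1)[OF x] D(1)[OF y] assms(2)
      by (intro N.M.finsum_cong') (auto simp: N.smult_l_distr subset_iff)
    also have "\<dots> = (\<Oplus>\<^bsub>N\<^esub> e\<in>?S. x e \<odot>\<^bsub>N\<^esub> g e) \<oplus>\<^bsub>N\<^esub> (\<Oplus>\<^bsub>N\<^esub> e\<in>?S. y e \<odot>\<^bsub>N\<^esub> g e)"
      using S c[OF x] c[OF y] by (intro N.M.finsum_addf) auto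
    also have "\<dots> = lin_ext R N g x \<oplus>\<^bsub>N\<^esub> lin_ext R N g y"
      using sup[OF x S(1) _ S(2)] sup[OF y S(1) _ S(2)] by auto
    finally show ?thesis .
  qed
  show "lin_ext R N g (a \<odot>\<^bsub>free_module R B\<^esub> x) = a \<odot>\<^bsub>N\<^esub> lin_ext R N g x"
    if a: "a \<in> carrier R" for a
  proof -
    let ?S = "{e. x e \<noteq> \<zero>}"
    have S: "finite ?S" "?S \<subseteq> B" using D[OF x] by auto
    have ax: "a \<odot>\<^bsub>free_module R B\<^esub> x = (\<lambda>i. a \<otimes> x i)" by (simp add: free_module_def)
    have "lin_ext R N g (a \<odot>\<^bsub>free_module R B\<^esub> x) = (\<Oplus>\<^bsub>N\<^esub> e\<in>?S. (a \<otimes> x e) \<odot>\<^bsub>N\<^esub> g e)"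
      using a by (subst sup[OF F.smult_closed[OF a x] S(1) _ S(2)]) (auto simp: ax)
    also have "\<dots> = (\<Oplus>\<^bsub>N\<^esub> e\<in>?S. a \<odot>\<^bsub>N\<^esub> (x e \<odot>\<^bsub>N\<^esub> g e))"
      using S c[OF x] D(1)[OF x] assms(2) a
      by (intro N.M.finsum_cong') (auto simp: N.smult_assoc1 subset_iff)
    also have "\<dots> = a \<odot>\<^bsub>N\<^esub> lin_ext R N g x"
      unfolding lin_ext_def using S c[OF x] a by (intro N.finsum_smult_ldistr[symmetric]) auto
    finally show ?thesis .
  qed
qed

lemma lin_ext_basis_vec:
  assumes "module R N" "\<And>e. e \<in> B \<Longrightarrow> g e \<in> carrier N" "e \<in> B"
  shows "lin_ext R N g (basis_vec R e) = g e"
proof -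
  interpret N: module R N by fact
  have "lin_ext R N g (basis_vec R e) = (\<Oplus>\<^bsub>N\<^esub> i\<in>{e}. basis_vec R e i \<odot>\<^bsub>N\<^esub> g i)"
    using assms by (intro lin_ext_superset[OF assms(1,2) basis_vec_closed[OF assms(3)]])
      (auto simp: basis_vec_def)
  also have "\<dots> = g e"
    using assms by (subst N.M.finsum_insert) (auto simp: basis_vec_def Pi_iff)
  finally show ?thesis .
qed

text \<open>Induction on the support: \<open>w\<close> is \<open>v\<close> with one coordinate
  erased.\<close>

lemma free_module_induct [consumes 1, case_names zero add]:
  assumes "v \<in> carrier (free_module R B)"
    and zero: "P (\<lambda>_. \<zero>)"
    and add: "\<And>a e w. a \<in> carrier R \<Longrightarrow> e \<in> B \<Longrightarrow> w \<in> carrier (free_module R B) \<Longrightarrow> P w \<Longrightarrow>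
        P (a \<odot>\<^bsub>free_module R B\<^esub> basis_vec R e \<oplus>\<^bsub>free_module R B\<^esub> w)"
  shows "P v"
proof -
  have "P v" if "finite S" "v \<in> carrier (free_module R B)" "{i. v i \<noteq> \<zero>} = S" for S v
    using that
  proof (induction S arbitrary: v rule: finite_induct)
    case empty
    then have "v = (\<lambda>_. \<zero>)" by auto
    then show ?case using zero by simp
  next
    case (insert e S)
    note D = free_module_carrierD[OF insert.prems(1)]
    define w where "w = (\<lambda>i. if i = e then \<zero> else v i)"
    have w: "w \<in> carrier (free_module R B)" "{i. w i \<noteq> \<zero>} = S"
      using insert by (auto simp: w_def free_module_def elim!: rev_finite_subset)
    have e: "e \<in> B" using D(4) insert.prems by auto
    have "v = v e \<odot>\<^bsub>free_module R B\<^esub> basis_vec R e \<oplus>\<^bsub>free_module R B\<^esub> w"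
      using D(1) by (auto simp: free_module_def basis_vec_def w_def)
    then show ?case using add[OF D(1) e w(1) insert.IH[OF w]] by metis
  qed
  then show ?thesis using assms(1) free_module_carrierD(3)[OF assms(1)] by blast
qed

lemma free_module_linear_eqI:
  assumes "module R N" "is_linear R (free_module R B) N f" "is_linear R (free_module R B) N g"
    and "\<And>e. e \<in> B \<Longrightarrow> f (basis_vec R e) = g (basis_vec R e)" "v \<in> carrier (free_module R B)"
  shows "f v = g v"
  using assms(5)
proof (induction rule: free_module_induct)
  case zero
  then show ?case
    using is_linear_zero[OF free_module_is_module assms(1) assms(2)]
      is_linear_zero[OF free_module_is_module assms(1) assms(3)]
    by (simp add: free_module_def)
next
  case (add a e w)
  interpret F: module R "free_module R B" by (rule free_module_is_module)
  show ?case using add assms(4)[OF add(2)] basis_vec_closed[OF add(2)]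
    by (simp add: is_linear_add[OF assms(2)] is_linear_add[OF assms(3)]
      is_linear_smult[OF assms(2)] is_linear_smult[OF assms(3)])
qed

text \<open>Instead of surjectivity of \<open>p\<close>, only the values of \<open>f\<close> are
  required to lie in its image. This is the form needed for lifting through a differential, whose
  image consists of cycles only.\<close>

lemma free_module_projective:
  assumes "module R L" "module R N" "is_linear R (free_module R B) N f" "is_linear R L N p"
    and "\<And>v. v \<in> carrier (free_module R B) \<Longrightarrow> f v \<in> p ` carrier L"
  shows "\<exists>h. is_linear R (free_module R B) L h \<and> (\<forall>v\<in>carrier (free_module R B). p (h v) = f v)"
proof -
  have "\<forall>e\<in>B. \<exists>x\<in>carrier L. p x = f (basis_vec R e)"
    using assms(5)[OF basis_vec_closed] by (metis imageE)
  then obtain g where g: "\<And>e. e \<in> B \<Longrightarrow> g e \<in> carrier L \<and> p (g e) = f (basis_vec R e)" by metis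
  have l: "is_linear R (free_module R B) L (lin_ext R L g)"
    using g by (intro lin_ext_linear assms(1)) auto
  have "p (lin_ext R L g v) = f v" if "v \<in> carrier (free_module R B)" for v
    by (rule free_module_linear_eqI[OF assms(2) is_linear_comp[OF l assms(4)] assms(3) _ that])
       (use g lin_ext_basis_vec[OF assms(1), of B g] in auto)
  with l show ?thesis by blast
qed

end

section \<open>Resolutions\<close>

text \<open>\<open>dif C k\<close> is indexed by its target, the object of degree \<open>k\<close>.
  A single type \<open>'p\<close> serves all degrees.\<close>

record ('c, 'p, 'x) aug_complex =
  obj :: "nat \<Rightarrow> ('c, 'p) module"
  dif :: "nat \<Rightarrow> 'p \<Rightarrow> 'p"
  aug :: "'p \<Rightarrow> 'x"
  base :: "('c, 'x) module"

text \<open>The map leaving degree 0 is the augmentation, so this predicate lets exactness be stated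
  once for all degrees.\<close>

definition aug_cycle :: "('c, 'p, 'x) aug_complex \<Rightarrow> nat \<Rightarrow> 'p \<Rightarrow> bool" where
  "aug_cycle C k v \<longleftrightarrow> (case k of
       0 \<Rightarrow> aug C v = \<zero>\<^bsub>base C\<^esub>
     | Suc j \<Rightarrow> dif C j v = \<zero>\<^bsub>obj C j\<^esub>)"

lemma aug_cycle_0 [simp]: "aug_cycle C 0 v \<longleftrightarrow> aug C v = \<zero>\<^bsub>base C\<^esub>"
  and aug_cycle_Suc [simp]: "aug_cycle C (Suc j) v \<longleftrightarrow> dif C j v = \<zero>\<^bsub>obj C j\<^esub>"
  by (auto simp: aug_cycle_def)

locale resolution = cring A for A :: "('c, 'r) ring_scheme" (structure) +
  fixes C :: "('c, 'p, 'x) aug_complex"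
  assumes base_module: "module A (base C)"
    and obj_module: "\<And>k. module A (obj C k)"
    and dif_linear: "\<And>k. is_linear A (obj C (Suc k)) (obj C k) (dif C k)"
    and aug_linear: "is_linear A (obj C 0) (base C) (aug C)"
    and aug_surj: "aug C ` carrier (obj C 0) = carrier (base C)"
    and exact: "\<And>k v. v \<in> carrier (obj C k) \<Longrightarrow>
      aug_cycle C k v \<longleftrightarrow> v \<in> dif C k ` carrier (obj C (Suc k))"
begin

lemma dif_closed: "v \<in> carrier (obj C (Suc k)) \<Longrightarrow> dif C k v \<in> carrier (obj C k)"
  using is_linear_closed[OF dif_linear] .

lemma aug_cycle_dif: "v \<in> carrier (obj C (Suc k)) \<Longrightarrow> aug_cycle C k (dif C k v)"
  using exact dif_closed by blast

lemma dif_dif: "v \<in> carrier (obj C (Suc (Suc k))) \<Longrightarrow> dif C k (dif C (Suc k) v) = \<zero>\<^bsub>obj C k\<^esub>"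
  using aug_cycle_dif[of v "Suc k"] by simp

lemma aug_dif: "v \<in> carrier (obj C (Suc 0)) \<Longrightarrow> aug C (dif C 0 v) = \<zero>\<^bsub>base C\<^esub>"
  using aug_cycle_dif[of v 0] by simp

end

section \<open>Exactness of the standard free resolution\<close>

definition std :: "('c, 'r) ring_scheme \<Rightarrow> ('c, 'x) module
    \<Rightarrow> ('c, ('c, 'x) basis_elem \<Rightarrow> 'c, 'x) aug_complex" where
  "std A N = \<lparr>obj = std_res A N, dif = (\<lambda>k. differential A), aug = augmentation A N, base = N\<rparr>"

lemma std_simps [simp]:
  "obj (std A N) = std_res A N" "dif (std A N) k = differential A"
  "aug (std A N) = augmentation A N" "base (std A N) = N"
  by (auto simp: std_def)

context cring
begin

lemma std_res_module: "module R (std_res R N k)"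
  unfolding std_res_def by (rule free_module_is_module)

lemma std_res_zero [simp]: "\<zero>\<^bsub>std_res R N k\<^esub> = (\<lambda>_. \<zero>)"
  by (simp add: std_res_def free_module_def)

lemma lin_comb_closed:
  "set xs \<subseteq> B \<times> carrier R \<Longrightarrow> lin_comb R xs \<in> carrier (free_module R B)"
proof (induction xs)
  case Nil
  then show ?case by (auto simp: free_module_def)
next
  case (Cons ea xs)
  interpret F: module R "free_module R B" by (rule free_module_is_module)
  have *: "lin_comb R (ea # xs)
      = snd ea \<odot>\<^bsub>free_module R B\<^esub> basis_vec R (fst ea) \<oplus>\<^bsub>free_module R B\<^esub> lin_comb R xs"
    using Cons.prems by (auto simp: free_module_def basis_vec_def)
  show ?case unfolding * using Cons by (auto intro!: F.M.a_closed F.smult_closed basis_vec_closed)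
qed

lemma lin_comb_surj:
  assumes "v \<in> carrier (free_module R B)"
  shows "\<exists>xs. set xs \<subseteq> B \<times> carrier R \<and> lin_comb R xs = v"
  using assms
proof (induction rule: free_module_induct)
  case zero
  show ?case by (rule exI[of _ "[]"]) auto
next
  case (add a e w)
  then obtain xs where xs: "set xs \<subseteq> B \<times> carrier R" "lin_comb R xs = w" by auto
  have "lin_comb R ((e, a) # xs)
      = a \<odot>\<^bsub>free_module R B\<^esub> basis_vec R e \<oplus>\<^bsub>free_module R B\<^esub> w"
    using add xs by (auto simp: free_module_def basis_vec_def)
  then show ?case using xs add by (intro exI[of _ "(e, a) # xs"]) auto
qed

text \<open>\<open>differential\<close> is defined coordinate by coordinate, whereas
  \<open>lin_ext\<close> sums inside the free module; this reconciles the two.\<close>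

lemma finsum_free_module:
  assumes "finite S" "\<And>e. e \<in> S \<Longrightarrow> g e \<in> carrier (free_module R B)"
  shows "(\<Oplus>\<^bsub>free_module R B\<^esub> e\<in>S. g e) = (\<lambda>i. \<Oplus> e\<in>S. g e i)"
  using assms
proof (induction S rule: finite_induct)
  case empty
  interpret F: module R "free_module R B" by (rule free_module_is_module)
  show ?case by (simp only: F.M.finsum_empty finsum_empty) (simp add: free_module_def)
next
  case (insert e S)
  interpret F: module R "free_module R B" by (rule free_module_is_module)
  have "(\<Oplus>\<^bsub>free_module R B\<^esub> e\<in>insert e S. g e)
      = g e \<oplus>\<^bsub>free_module R B\<^esub> (\<lambda>i. \<Oplus> e\<in>S. g e i)"
    using insert by (subst F.M.finsum_insert) auto
  also have "\<dots> = (\<lambda>i. g e i \<oplus> (\<Oplus> e\<in>S. g e i))" by (simp add: free_module_def)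
  also have "\<dots> = (\<lambda>i. \<Oplus> e\<in>insert e S. g e i)"
    using insert free_module_carrierD(1)[OF insert.prems] by (subst finsum_insert) (auto simp: Pi_iff)
  finally show ?case .
qed

lemma syz_value_closed:
  "e \<in> res_basis R N (Suc k) \<Longrightarrow> syz_value R e \<in> carrier (std_res R N k)"
  unfolding std_res_def by (auto intro: lin_comb_closed)

lemma differential_eq_lin_ext:
  assumes "v \<in> carrier (std_res R N (Suc k))"
  shows "differential R v = lin_ext R (std_res R N k) (syz_value R) v"
proof -
  interpret F: module R "std_res R N k" by (rule std_res_module)
  note D = free_module_carrierD[OF assms[unfolded std_res_def]]
  have c: "v e \<odot>\<^bsub>std_res R N k\<^esub> syz_value R e \<in> carrier (std_res R N k)"
    if "e \<in> {e. v e \<noteq> \<zero>}" for e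
    using that D(1,4) by (intro F.smult_closed syz_value_closed) auto
  have "lin_ext R (std_res R N k) (syz_value R) v
      = (\<lambda>i. \<Oplus> e\<in>{e. v e \<noteq> \<zero>}. (v e \<odot>\<^bsub>std_res R N k\<^esub> syz_value R e) i)"
    unfolding lin_ext_def using D(3) c unfolding std_res_def by (rule finsum_free_module)
  then show ?thesis by (simp add: differential_def std_res_def free_module_def)
qed

lemma is_linear_cong:
  assumes "is_linear R N M f" "module R N" "\<And>x. x \<in> carrier N \<Longrightarrow> g x = f x"
  shows "is_linear R N M g"
proof -
  interpret N: module R N by fact
  show ?thesis
    using is_linear_closed[OF assms(1)]
    by (intro is_linearI)
      (auto simp: assms(3) is_linear_add[OF assms(1)] is_linear_smult[OF assms(1)])
qed

lemma differential_linear: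
  "is_linear R (std_res R N (Suc k)) (std_res R N k) (differential R)"
proof (rule is_linear_cong[OF _ std_res_module differential_eq_lin_ext])
  show "is_linear R (std_res R N (Suc k)) (std_res R N k)
      (lin_ext R (std_res R N k) (syz_value R))"
    by (subst std_res_def) (intro lin_ext_linear std_res_module syz_value_closed)
qed

lemma differential_basis_vec:
  assumes "e \<in> res_basis R N (Suc k)"
  shows "differential R (basis_vec R e) = syz_value R e"
proof -
  have "basis_vec R e \<in> carrier (std_res R N (Suc k))"
    unfolding std_res_def by (rule basis_vec_closed[OF assms])
  then have "differential R (basis_vec R e)
      = lin_ext R (std_res R N k) (syz_value R) (basis_vec R e)"
    by (rule differential_eq_lin_ext)
  also have "\<dots> = syz_value R e"
    using std_res_module syz_value_closed assms by (rule lin_ext_basis_vec)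
  finally show ?thesis .
qed

lemma augmentation_eq_lin_ext: "augmentation R N = lin_ext R N gen_value"
  by (rule ext) (simp add: augmentation_def lin_ext_def)

lemma augmentation_linear:
  "module R N \<Longrightarrow> is_linear R (std_res R N 0) N (augmentation R N)"
  unfolding augmentation_eq_lin_ext std_res_def by (rule lin_ext_linear) auto

lemma augmentation_basis_vec:
  "module R N \<Longrightarrow> x \<in> carrier N \<Longrightarrow> augmentation R N (basis_vec R (Gen x)) = x"
  unfolding augmentation_eq_lin_ext
  by (subst lin_ext_basis_vec[where B = "Gen ` carrier N"]) auto

lemma aug_cycle_std: "aug_cycle (std R N) k v \<longleftrightarrow> is_cycle R N k v"
  by (cases k) (auto simp: is_cycle_def)

lemma std_resolution:
  assumes "module R N"
  shows "resolution R (std R N)"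
proof (intro resolution.intro resolution_axioms.intro is_cring, unfold std_simps)
  show "module R N" by fact
  show "module R (std_res R N k)" for k by (rule std_res_module)
  show "is_linear R (std_res R N (Suc k)) (std_res R N k) (differential R)" for k
    by (rule differential_linear)
  show aug: "is_linear R (std_res R N 0) N (augmentation R N)"
    by (rule augmentation_linear[OF assms])
  show "augmentation R N ` carrier (std_res R N 0) = carrier N"
  proof (intro subset_antisym subsetI)
    fix x assume x: "x \<in> carrier N"
    then show "x \<in> augmentation R N ` carrier (std_res R N 0)"
      using augmentation_basis_vec[OF assms x]
      by (intro image_eqI[of _ _ "basis_vec R (Gen x)"])
        (auto simp: std_res_def intro: basis_vec_closed)
  qed (use is_linear_closed[OF aug] in auto)
  fix k v assume v: "v \<in> carrier (std_res R N k)"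
  show "aug_cycle (std R N) k v \<longleftrightarrow> v \<in> differential R ` carrier (std_res R N (Suc k))"
  proof
    assume c: "aug_cycle (std R N) k v"
    obtain xs where xs: "set xs \<subseteq> res_basis R N k \<times> carrier R" "lin_comb R xs = v"
      using lin_comb_surj[OF v[unfolded std_res_def]] by blast
    \<comment> \<open>Every expression of a cycle is itself a basis element one degree higher, so
      the cycle is the image of a single basis vector.\<close>
    have e: "Syz xs \<in> res_basis R N (Suc k)" using xs c by (auto simp: aug_cycle_std)
    show "v \<in> differential R ` carrier (std_res R N (Suc k))"
      using differential_basis_vec[OF e] xs basis_vec_closed[OF e]
      by (intro image_eqI[of _ _ "basis_vec R (Syz xs)"]) (auto simp: std_res_def)
  next
    assume "v \<in> differential R ` carrier (std_res R N (Suc k))"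
    then obtain w where w: "w \<in> carrier (std_res R N (Suc k))" "v = differential R w" by auto
    \<comment> \<open>The composite of consecutive maps is linear, so it vanishes once it vanishes
      on basis vectors; there it does because \<open>res_basis\<close> admits only expressions of
      cycles.\<close>
    have bas: "aug_cycle (std R N) k (differential R (basis_vec R e))"
      if "e \<in> res_basis R N (Suc k)" for e
      using that differential_basis_vec[OF that] by (auto simp: aug_cycle_std)
    have d: "is_linear R (free_module R (res_basis R N (Suc k))) (std_res R N k) (differential R)"
      using differential_linear[of N k] by (simp add: std_res_def)
    show "aug_cycle (std R N) k v"
    proof (cases k)
      case 0
      have "is_linear R (free_module R (res_basis R N (Suc k))) N
          (\<lambda>w. augmentation R N (differential R w))"
        by (rule is_linear_comp[OF d]) (simp only: 0 aug)
      then have "augmentation R N (differential R w) = \<zero>\<^bsub>N\<^esub>"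
        using w(1) bas
        by (elim free_module_linear_eqI[OF assms _ is_linear_zero_map[OF assms]])
          (simp_all only: std_res_def 0 aug_cycle_0 std_simps)
      then show ?thesis using w 0 by simp
    next
      case (Suc j)
      have "is_linear R (free_module R (res_basis R N (Suc k))) (std_res R N j)
          (\<lambda>w. differential R (differential R w))"
        by (rule is_linear_comp[OF d]) (simp only: Suc differential_linear)
      then have "differential R (differential R w) = \<zero>\<^bsub>std_res R N j\<^esub>"
        using w(1) bas
        by (elim free_module_linear_eqI[OF std_res_module _ is_linear_zero_map[OF std_res_module]])
          (simp_all only: std_res_def Suc aug_cycle_Suc std_simps)
      then show ?thesis using w Suc by simp
    qed
  qed
qed

end

section \<open>Chain maps and homotopies\<close>

lemma (in abelian_group) minus_eq_zeroD:
  assumes "x \<ominus> y = \<zero>" "x \<in> carrier G" "y \<in> carrier G"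
  shows "x = y"
  using minus_equality[of x "\<ominus> y"] assms by (simp add: a_minus_def)

definition chain_map ::
    "('c, 'r) ring_scheme \<Rightarrow> ('c, 'p, 'x) aug_complex \<Rightarrow> ('c, 'q, 'y) aug_complex
       \<Rightarrow> ('x \<Rightarrow> 'y) \<Rightarrow> (nat \<Rightarrow> 'p \<Rightarrow> 'q) \<Rightarrow> bool" where
  "chain_map A C D \<phi> \<theta> \<longleftrightarrow>
     (\<forall>k. is_linear A (obj C k) (obj D k) (\<theta> k)) \<and>
     (\<forall>v\<in>carrier (obj C 0). aug D (\<theta> 0 v) = \<phi> (aug C v)) \<and>
     (\<forall>k. \<forall>v\<in>carrier (obj C (Suc k)). dif D k (\<theta> (Suc k) v) = \<theta> k (dif C k v))"

text \<open>The homotopy has no component leaving the base, so the equation in degree 0 lacks the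
  second term. In higher degrees it is the usual \<theta> = d h + h d.\<close>

definition null_homotopy ::
    "('c, 'r) ring_scheme \<Rightarrow> ('c, 'p, 'x) aug_complex \<Rightarrow> ('c, 'q, 'y) aug_complex
       \<Rightarrow> (nat \<Rightarrow> 'p \<Rightarrow> 'q) \<Rightarrow> (nat \<Rightarrow> 'p \<Rightarrow> 'q) \<Rightarrow> bool" where
  "null_homotopy A C D \<theta> h \<longleftrightarrow>
     (\<forall>k. is_linear A (obj C k) (obj D (Suc k)) (h k)) \<and>
     (\<forall>v\<in>carrier (obj C 0). dif D 0 (h 0 v) = \<theta> 0 v) \<and>
     (\<forall>k. \<forall>v\<in>carrier (obj C (Suc k)).
        dif D (Suc k) (h (Suc k) v) = \<theta> (Suc k) v \<ominus>\<^bsub>obj D (Suc k)\<^esub> h k (dif C k v))"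

lemma chain_mapD:
  assumes "chain_map A C D \<phi> \<theta>"
  shows "is_linear A (obj C k) (obj D k) (\<theta> k)"
    and "v \<in> carrier (obj C 0) \<Longrightarrow> aug D (\<theta> 0 v) = \<phi> (aug C v)"
    and "w \<in> carrier (obj C (Suc k)) \<Longrightarrow> dif D k (\<theta> (Suc k) w) = \<theta> k (dif C k w)"
  using assms by (auto simp: chain_map_def)

lemma chain_map_closed:
  "chain_map A C D \<phi> \<theta> \<Longrightarrow> v \<in> carrier (obj C k) \<Longrightarrow> \<theta> k v \<in> carrier (obj D k)"
  using is_linear_closed[OF chain_mapD(1)] .

lemma null_homotopyD:
  assumes "null_homotopy A C D \<theta> h"
  shows "is_linear A (obj C k) (obj D (Suc k)) (h k)"
    and "v \<in> carrier (obj C 0) \<Longrightarrow> dif D 0 (h 0 v) = \<theta> 0 v"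
    and "w \<in> carrier (obj C (Suc k)) \<Longrightarrow>
      dif D (Suc k) (h (Suc k) w) = \<theta> (Suc k) w \<ominus>\<^bsub>obj D (Suc k)\<^esub> h k (dif C k w)"
  using assms by (auto simp: null_homotopy_def)

lemma null_homotopy_closed:
  "null_homotopy A C D \<theta> h \<Longrightarrow> v \<in> carrier (obj C k) \<Longrightarrow> h k v \<in> carrier (obj D (Suc k))"
  using is_linear_closed[OF null_homotopyD(1)] .

lemma chain_map_comp:
  assumes "chain_map A C D \<phi> \<theta>" "chain_map A D E \<psi> \<zeta>"
  shows "chain_map A C E (\<lambda>x. \<psi> (\<phi> x)) (\<lambda>k v. \<zeta> k (\<theta> k v))"
  unfolding chain_map_def
  using chain_mapD[OF assms(1)] chain_mapD[OF assms(2)] chain_map_closed[OF assms(1)]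
  by (intro conjI allI ballI is_linear_comp[OF chain_mapD(1)[OF assms(1)]]) simp_all

lemma chain_map_cong:
  assumes "chain_map A C D \<phi> \<theta>" "resolution A C" "\<And>x. x \<in> carrier (base C) \<Longrightarrow> \<psi> x = \<phi> x"
  shows "chain_map A C D \<psi> \<theta>"
  using assms is_linear_closed[OF resolution.aug_linear[OF assms(2)]]
  by (auto simp: chain_map_def)

locale free_resolution = resolution A C for A :: "('c, 'r) ring_scheme" (structure)
    and C :: "('c, 'i \<Rightarrow> 'c, 'x) aug_complex" +
  fixes B :: "nat \<Rightarrow> 'i set"
  assumes obj_free: "\<And>k. obj C k = free_module A (B k)"
begin

text \<open>The comparison theorem: a chain map is built degree by degree from projectivity of the
  free objects and exactness of the target.\<close>

lemma lift_exists:
  assumes "resolution A D" "is_linear A (base C) (base D) \<phi>"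
  shows "\<exists>\<theta>. chain_map A C D \<phi> \<theta>"
proof -
  interpret D: resolution A D by fact
  \<comment> \<open>The invariant that cycles go to cycles is what puts the next map to be lifted
    into the image of \<open>dif D k\<close>. The clause for \<open>k = 0\<close> keeps the
    augmentation, since dependent choice relates only consecutive degrees.\<close>
  define P where "P = (\<lambda>k \<theta>. is_linear A (obj C k) (obj D k) \<theta> \<and>
    (\<forall>v\<in>carrier (obj C k). aug_cycle C k v \<longrightarrow> aug_cycle D k (\<theta> v)) \<and>
    (k = 0 \<longrightarrow> (\<forall>v\<in>carrier (obj C 0). aug D (\<theta> v) = \<phi> (aug C v))))"
  have "\<exists>\<theta>. \<forall>k. P k (\<theta> k) \<and>
    (\<forall>v\<in>carrier (obj C (Suc k)). dif D k (\<theta> (Suc k) v) = \<theta> k (dif C k v))"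
  proof (rule dependent_nat_choice[where P = P and Q = "\<lambda>k \<theta> \<theta>'.
      \<forall>v\<in>carrier (obj C (Suc k)). dif D k (\<theta>' v) = \<theta> (dif C k v)"])
    have lin: "is_linear A (free_module A (B 0)) (base D) (\<lambda>v. \<phi> (aug C v))"
      using is_linear_comp[OF aug_linear assms(2)] by (simp add: obj_free)
    have "\<exists>\<theta>. is_linear A (free_module A (B 0)) (obj D 0) \<theta> \<and>
        (\<forall>v\<in>carrier (free_module A (B 0)). aug D (\<theta> v) = \<phi> (aug C v))"
      by (rule free_module_projective[OF D.obj_module D.base_module lin D.aug_linear])
        (use is_linear_closed[OF lin] D.aug_surj in auto)
    then obtain \<theta> where "is_linear A (obj C 0) (obj D 0) \<theta>"
        "\<forall>v\<in>carrier (obj C 0). aug D (\<theta> v) = \<phi> (aug C v)" by (auto simp: obj_free)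
    then show "\<exists>\<theta>. P 0 \<theta>"
      using is_linear_zero[OF base_module D.base_module assms(2)]
      by (auto simp: P_def)
  next
    fix \<theta> k assume P: "P k \<theta>"
    have lin: "is_linear A (free_module A (B (Suc k))) (obj D k) (\<lambda>v. \<theta> (dif C k v))"
      using is_linear_comp[OF dif_linear, of k "obj D k" \<theta>] P by (simp add: obj_free P_def)
    have "\<exists>\<theta>'. is_linear A (free_module A (B (Suc k))) (obj D (Suc k)) \<theta>' \<and>
        (\<forall>v\<in>carrier (free_module A (B (Suc k))). dif D k (\<theta>' v) = \<theta> (dif C k v))"
    proof (rule free_module_projective[OF D.obj_module D.obj_module lin D.dif_linear])
      fix v assume v: "v \<in> carrier (free_module A (B (Suc k)))"
      then have "aug_cycle C k (dif C k v)" using aug_cycle_dif by (simp add: obj_free)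
      then have "aug_cycle D k (\<theta> (dif C k v))"
        using P dif_closed[of v k] v by (simp add: P_def obj_free)
      then show "\<theta> (dif C k v) \<in> dif D k ` carrier (obj D (Suc k))"
        using D.exact is_linear_closed[OF lin v] by blast
    qed
    then obtain \<theta>' where \<theta>': "is_linear A (obj C (Suc k)) (obj D (Suc k)) \<theta>'"
        "\<And>v. v\<in>carrier (obj C (Suc k)) \<Longrightarrow> dif D k (\<theta>' v) = \<theta> (dif C k v)" by (auto simp: obj_free)
    have "\<theta> \<zero>\<^bsub>obj C k\<^esub> = \<zero>\<^bsub>obj D k\<^esub>"
      using is_linear_zero[OF obj_module D.obj_module] P by (auto simp: P_def)
    with \<theta>' show "\<exists>\<theta>'. P (Suc k) \<theta>' \<and>
        (\<forall>v\<in>carrier (obj C (Suc k)). dif D k (\<theta>' v) = \<theta> (dif C k v))"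
      by (auto simp: P_def)
  qed
  then show ?thesis by (auto simp: chain_map_def P_def)
qed

lemma null_homotopy_exists:
  assumes "resolution A D" "chain_map A C D (\<lambda>x. \<zero>\<^bsub>base D\<^esub>) \<theta>"
  shows "\<exists>h. null_homotopy A C D \<theta> h"
proof -
  interpret D: resolution A D by fact
  note \<theta> = chain_mapD[OF assms(2)] chain_map_closed[OF assms(2)]
  \<comment> \<open>On cycles the term \<open>h d\<close> drops out of the homotopy equation.
    Knowing d h = \<theta> there is enough to make \<theta> - h d a cycle in the next degree, hence
    liftable.\<close>
  define P where "P = (\<lambda>k h. is_linear A (obj C k) (obj D (Suc k)) h \<and>
    (\<forall>v\<in>carrier (obj C k). aug_cycle C k v \<longrightarrow> dif D k (h v) = \<theta> k v) \<and>
    (k = 0 \<longrightarrow> (\<forall>v\<in>carrier (obj C 0). dif D 0 (h v) = \<theta> 0 v)))"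
  have "\<exists>h. \<forall>k. P k (h k) \<and>
    (\<forall>v\<in>carrier (obj C (Suc k)).
       dif D (Suc k) (h (Suc k) v) = \<theta> (Suc k) v \<ominus>\<^bsub>obj D (Suc k)\<^esub> h k (dif C k v))"
  proof (rule dependent_nat_choice[where P = P and Q = "\<lambda>k h h'.
      \<forall>v\<in>carrier (obj C (Suc k)).
        dif D (Suc k) (h' v) = \<theta> (Suc k) v \<ominus>\<^bsub>obj D (Suc k)\<^esub> h (dif C k v)"])
    have "\<exists>h. is_linear A (free_module A (B 0)) (obj D (Suc 0)) h \<and>
        (\<forall>v\<in>carrier (free_module A (B 0)). dif D 0 (h v) = \<theta> 0 v)"
    proof (rule free_module_projective[OF D.obj_module D.obj_module _ D.dif_linear])
      show "is_linear A (free_module A (B 0)) (obj D 0) (\<theta> 0)"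
        using \<theta>(1)[of 0] by (simp add: obj_free)
      fix v assume v: "v \<in> carrier (free_module A (B 0))"
      then show "\<theta> 0 v \<in> dif D 0 ` carrier (obj D (Suc 0))"
        using D.exact[of "\<theta> 0 v" 0] \<theta>(4)[of v 0] \<theta>(2)[of v] by (simp add: obj_free)
    qed
    then show "\<exists>h. P 0 h" by (auto simp: P_def obj_free)
  next
    fix h k assume P: "P k h"
    interpret Dk: module A "obj D k" by (rule D.obj_module)
    interpret Dk': module A "obj D (Suc k)" by (rule D.obj_module)
    let ?f = "\<lambda>v. \<theta> (Suc k) v \<ominus>\<^bsub>obj D (Suc k)\<^esub> h (dif C k v)"
    have h: "is_linear A (obj C k) (obj D (Suc k)) h" using P by (simp add: P_def)
    have lin': "is_linear A (obj C (Suc k)) (obj D (Suc k)) ?f"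
      by (intro is_linear_sub D.obj_module \<theta>(1) is_linear_comp[OF dif_linear h])
    then have lin: "is_linear A (free_module A (B (Suc k))) (obj D (Suc k)) ?f"
      by (simp add: obj_free)
    have "\<exists>h'. is_linear A (free_module A (B (Suc k))) (obj D (Suc (Suc k))) h' \<and>
        (\<forall>v\<in>carrier (free_module A (B (Suc k))). dif D (Suc k) (h' v) = ?f v)"
    proof (rule free_module_projective[OF D.obj_module D.obj_module lin D.dif_linear])
      fix v assume "v \<in> carrier (free_module A (B (Suc k)))"
      then have v: "v \<in> carrier (obj C (Suc k))" by (simp add: obj_free)
      have "dif D k (h (dif C k v)) = \<theta> k (dif C k v)"
        using P dif_closed[OF v] aug_cycle_dif[OF v] by (simp add: P_def)
      then have "dif D k (?f v) = \<theta> k (dif C k v) \<ominus>\<^bsub>obj D k\<^esub> \<theta> k (dif C k v)"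
        using is_linear_diff[OF D.obj_module D.obj_module D.dif_linear \<theta>(4)[OF v]
            is_linear_closed[OF h dif_closed[OF v]]] \<theta>(3)[OF v] by simp
      then have "aug_cycle D (Suc k) (?f v)"
        using \<theta>(4)[OF dif_closed[OF v]] by (simp add: Dk.M.minus_eq Dk.M.r_neg)
      then show "?f v \<in> dif D (Suc k) ` carrier (obj D (Suc (Suc k)))"
        using D.exact is_linear_closed[OF lin' v] by blast
    qed
    then obtain h' where h': "is_linear A (obj C (Suc k)) (obj D (Suc (Suc k))) h'"
        "\<And>v. v\<in>carrier (obj C (Suc k)) \<Longrightarrow> dif D (Suc k) (h' v) = ?f v" by (auto simp: obj_free)
    have "h \<zero>\<^bsub>obj C k\<^esub> = \<zero>\<^bsub>obj D (Suc k)\<^esub>"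
      using is_linear_zero[OF obj_module D.obj_module h] .
    then have "dif D (Suc k) (h' v) = \<theta> (Suc k) v"
      if "v \<in> carrier (obj C (Suc k))" "aug_cycle C (Suc k) v" for v
      using h'(2)[OF that(1)] that(2) \<theta>(4)[OF that(1)] by (simp add: Dk'.M.minus_eq)
    with h' show "\<exists>h'. P (Suc k) h' \<and>
        (\<forall>v\<in>carrier (obj C (Suc k)). dif D (Suc k) (h' v) = ?f v)"
      by (auto simp: P_def)
  qed
  then show ?thesis by (auto simp: null_homotopy_def P_def)
qed

text \<open>The difference of two lifts of the same map covers the zero map of the bases.\<close>

lemma lifts_homotopic:
  assumes "resolution A D" "chain_map A C D \<phi> \<theta>" "chain_map A C D \<phi> \<theta>'"
    and \<phi>: "is_linear A (base C) (base D) \<phi>"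
  shows "\<exists>h. null_homotopy A C D (\<lambda>k v. \<theta> k v \<ominus>\<^bsub>obj D k\<^esub> \<theta>' k v) h"
proof (rule null_homotopy_exists[OF assms(1)])
  interpret D: resolution A D by fact
  note \<theta> = chain_mapD[OF assms(2)] chain_map_closed[OF assms(2)]
  note \<theta>' = chain_mapD[OF assms(3)] chain_map_closed[OF assms(3)]
  interpret N: module A "base D" by (rule D.base_module)
  show "chain_map A C D (\<lambda>x. \<zero>\<^bsub>base D\<^esub>) (\<lambda>k v. \<theta> k v \<ominus>\<^bsub>obj D k\<^esub> \<theta>' k v)"
    unfolding chain_map_def
  proof (intro conjI allI ballI)
    show "is_linear A (obj C k) (obj D k) (\<lambda>v. \<theta> k v \<ominus>\<^bsub>obj D k\<^esub> \<theta>' k v)" for k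
      by (intro is_linear_sub D.obj_module \<theta> \<theta>')
    fix v assume v: "v \<in> carrier (obj C 0)"
    have "aug D (\<theta> 0 v \<ominus>\<^bsub>obj D 0\<^esub> \<theta>' 0 v) = \<phi> (aug C v) \<ominus>\<^bsub>base D\<^esub> \<phi> (aug C v)"
      using is_linear_diff[OF D.obj_module D.base_module D.aug_linear \<theta>(4)[OF v] \<theta>'(4)[OF v]]
      by (simp add: \<theta>(2)[OF v] \<theta>'(2)[OF v])
    then show "aug D (\<theta> 0 v \<ominus>\<^bsub>obj D 0\<^esub> \<theta>' 0 v) = \<zero>\<^bsub>base D\<^esub>"
      using is_linear_closed[OF \<phi> is_linear_closed[OF aug_linear v]]
      by (simp add: N.M.minus_eq N.M.r_neg)
  next
    fix k v assume v: "v \<in> carrier (obj C (Suc k))"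
    show "dif D k (\<theta> (Suc k) v \<ominus>\<^bsub>obj D (Suc k)\<^esub> \<theta>' (Suc k) v)
        = \<theta> k (dif C k v) \<ominus>\<^bsub>obj D k\<^esub> \<theta>' k (dif C k v)"
      using is_linear_diff[OF D.obj_module D.obj_module D.dif_linear \<theta>(4)[OF v] \<theta>'(4)[OF v]]
      by (simp add: \<theta>(3)[OF v] \<theta>'(3)[OF v])
  qed
qed

end

lemma (in cring) std_free_resolution:
  assumes "module R N"
  shows "free_resolution R (std R N) (res_basis R N)"
  using std_resolution[OF assms]
  by (auto intro!: free_resolution.intro free_resolution_axioms.intro simp: std_res_def)

section \<open>Cohomology with coefficients in a module\<close>

definition cocycle ::
    "('c, 'r) ring_scheme \<Rightarrow> ('c, 'p, 'x) aug_complex \<Rightarrow> ('c, 'y, 'n) module_scheme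
       \<Rightarrow> nat \<Rightarrow> ('p \<Rightarrow> 'y) \<Rightarrow> bool" where
  "cocycle A C M i f \<longleftrightarrow> is_linear A (obj C i) M f \<and>
     (\<forall>v\<in>carrier (obj C (Suc i)). f (dif C i v) = \<zero>\<^bsub>M\<^esub>)"

text \<open>Cochains are plain functions and only their values on the carrier matter, unlike in
  \<open>Ext_coboundaries\<close>. No map enters degree 0, so only zero bounds there.\<close>

definition coboundary ::
    "('c, 'r) ring_scheme \<Rightarrow> ('c, 'p, 'x) aug_complex \<Rightarrow> ('c, 'y, 'n) module_scheme
       \<Rightarrow> nat \<Rightarrow> ('p \<Rightarrow> 'y) \<Rightarrow> bool" where
  "coboundary A C M i f \<longleftrightarrow> (case i of
       0 \<Rightarrow> \<forall>v\<in>carrier (obj C 0). f v = \<zero>\<^bsub>M\<^esub>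
     | Suc k \<Rightarrow> \<exists>g. is_linear A (obj C k) M g \<and>
         (\<forall>v\<in>carrier (obj C (Suc k)). f v = g (dif C k v)))"

lemma coboundary_0 [simp]:
    "coboundary A C M 0 f \<longleftrightarrow> (\<forall>v\<in>carrier (obj C 0). f v = \<zero>\<^bsub>M\<^esub>)"
  and coboundary_Suc: "coboundary A C M (Suc k) f \<longleftrightarrow> (\<exists>g. is_linear A (obj C k) M g \<and>
         (\<forall>v\<in>carrier (obj C (Suc k)). f v = g (dif C k v)))"
  by (auto simp: coboundary_def)

lemma coboundary_cong:
  assumes "coboundary A C M i f" "\<And>v. v \<in> carrier (obj C i) \<Longrightarrow> g v = f v"
  shows "coboundary A C M i g"
  using assms by (cases i) (auto simp: coboundary_Suc)

lemma coboundary_add: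
  assumes "module A M" "coboundary A C M i f" "coboundary A C M i g"
  shows "coboundary A C M i (\<lambda>v. f v \<oplus>\<^bsub>M\<^esub> g v)"
proof -
  interpret M: module A M by fact
  show ?thesis
  proof (cases i)
    case 0
    then show ?thesis using assms by auto
  next
    case (Suc k)
    obtain f' g' where "is_linear A (obj C k) M f'" "is_linear A (obj C k) M g'"
      "\<forall>v\<in>carrier (obj C (Suc k)). f v = f' (dif C k v)"
      "\<forall>v\<in>carrier (obj C (Suc k)). g v = g' (dif C k v)"
      using assms Suc by (auto simp: coboundary_Suc)
    then show ?thesis using is_linear_sum[OF assms(1), of _ f' g'] Suc
      by (auto simp: coboundary_Suc intro!: exI[of _ "\<lambda>v. f' v \<oplus>\<^bsub>M\<^esub> g' v"])
  qed
qed

lemma cocycle_pullback: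
  assumes "chain_map A C D \<phi> \<theta>" "cocycle A D M i f"
  shows "cocycle A C M i (\<lambda>v. f (\<theta> i v))"
  using assms chain_mapD[OF assms(1)] chain_map_closed[OF assms(1)] unfolding cocycle_def
  by (metis is_linear_comp)

lemma coboundary_pullback:
  assumes "chain_map A C D \<phi> \<theta>" "coboundary A D M i f"
  shows "coboundary A C M i (\<lambda>v. f (\<theta> i v))"
proof (cases i)
  case 0
  then show ?thesis using assms chain_map_closed[OF assms(1)] by auto
next
  case (Suc k)
  then obtain g where g: "is_linear A (obj D k) M g"
      "\<And>v. v\<in>carrier (obj D (Suc k)) \<Longrightarrow> f v = g (dif D k v)"
    using assms by (auto simp: coboundary_Suc)
  then have "is_linear A (obj C k) M (\<lambda>v. g (\<theta> k v))"
    using is_linear_comp[OF chain_mapD(1)[OF assms(1)]] by blast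
  then show ?thesis using g(2) chain_mapD(3)[OF assms(1)] chain_map_closed[OF assms(1)] Suc
    by (auto simp: coboundary_Suc)
qed

text \<open>From \<theta> = d h + h d and f d = 0 one gets f \<theta> = (f h) d, so
  \<open>f h\<close> is the bounding cochain; in degree 0 already f \<theta> = f d h = 0.\<close>

lemma coboundary_of_null_homotopy:
  assumes "module A M" "resolution A C" "resolution A D" "null_homotopy A C D \<theta> h"
    and "\<And>v. v \<in> carrier (obj C i) \<Longrightarrow> \<theta> i v \<in> carrier (obj D i)" "cocycle A D M i f"
  shows "coboundary A C M i (\<lambda>v. f (\<theta> i v))"
proof -
  interpret M: module A M by fact
  interpret C: resolution A C by fact
  interpret D: resolution A D by fact
  note h = null_homotopyD[OF assms(4)] null_homotopy_closed[OF assms(4)]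
  have f: "is_linear A (obj D i) M f"
      "\<And>v. v\<in>carrier (obj D (Suc i)) \<Longrightarrow> f (dif D i v) = \<zero>\<^bsub>M\<^esub>"
    using assms(6) by (auto simp: cocycle_def)
  show ?thesis
  proof (cases i)
    case 0
    then show ?thesis using f h(2,4) by (metis coboundary_0)
  next
    case (Suc k)
    have "f (\<theta> (Suc k) v) = f (h k (dif C k v))" if v: "v \<in> carrier (obj C (Suc k))" for v
    proof -
      have c: "\<theta> (Suc k) v \<in> carrier (obj D (Suc k))" "h k (dif C k v) \<in> carrier (obj D (Suc k))"
        using v assms(5) h(4) C.dif_closed Suc by auto
      have "f (\<theta> (Suc k) v) \<ominus>\<^bsub>M\<^esub> f (h k (dif C k v)) = f (dif D (Suc k) (h (Suc k) v))"
        using is_linear_diff[OF D.obj_module assms(1) f(1), unfolded Suc, OF c] h(3)[OF v] by simp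
      also have "\<dots> = \<zero>\<^bsub>M\<^esub>" using f(2) h(4)[OF v] Suc by auto
      finally show ?thesis using is_linear_closed[OF f(1)] c Suc by (auto dest: M.M.minus_eq_zeroD)
    qed
    moreover have "is_linear A (obj C k) M (\<lambda>v. f (h k v))"
      using is_linear_comp[OF h(1)] f(1) Suc by simp
    ultimately show ?thesis using Suc by (auto simp: coboundary_Suc)
  qed
qed

text \<open>The class of \<open>f\<close> on \<open>N\<close> is pulled back to zero along \<phi>.
  One lift is asked for; for linear \<phi> and a cocycle \<open>f\<close> the choice does not
  matter, by \<open>ext_zero_lift\<close>.\<close>

definition ext_zero ::
    "('c, 'r) ring_scheme \<Rightarrow> ('c, 'x) module \<Rightarrow> ('c, 'z) module \<Rightarrow> ('c, 'y, 'n) module_scheme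
       \<Rightarrow> nat \<Rightarrow> ('x \<Rightarrow> 'z) \<Rightarrow> ((('c, 'z) basis_elem \<Rightarrow> 'c) \<Rightarrow> 'y) \<Rightarrow> bool" where
  "ext_zero A L N M i \<phi> f \<longleftrightarrow> (\<exists>\<theta>. chain_map A (std A L) (std A N) \<phi> \<theta> \<and>
     coboundary A (std A L) M i (\<lambda>v. f (\<theta> i v)))"

context cring
begin

lemma std_lift_exists:
  assumes "module R L" "module R N" "is_linear R L N \<phi>"
  shows "\<exists>\<theta>. chain_map R (std R L) (std R N) \<phi> \<theta>"
  using free_resolution.lift_exists[OF std_free_resolution[OF assms(1)] std_resolution[OF assms(2)]]
    assms(3) by simp

text \<open>Two lifts are homotopic, so the pullbacks of \<open>f\<close> along them differ by a
  coboundary.\<close>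

lemma ext_zero_lift:
  assumes mod: "module R L" "module R N" "module R M" and \<phi>: "is_linear R L N \<phi>"
    and f: "cocycle R (std R N) M i f" and z: "ext_zero R L N M i \<phi> f"
    and \<theta>: "chain_map R (std R L) (std R N) \<phi> \<theta>"
  shows "coboundary R (std R L) M i (\<lambda>v. f (\<theta> i v))"
proof -
  interpret M: module R M by fact
  interpret L: free_resolution R "std R L" "res_basis R L" by (rule std_free_resolution[OF mod(1)])
  interpret N: resolution R "std R N" by (rule std_resolution[OF mod(2)])
  interpret Ni: module R "std_res R N i" by (rule std_res_module)
  obtain \<theta>' where \<theta>': "chain_map R (std R L) (std R N) \<phi> \<theta>'"
    and cob: "coboundary R (std R L) M i (\<lambda>v. f (\<theta>' i v))"
    using z by (auto simp: ext_zero_def)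
  have "\<exists>h. null_homotopy R (std R L) (std R N) (\<lambda>k v. \<theta> k v \<ominus>\<^bsub>obj (std R N) k\<^esub> \<theta>' k v) h"
    by (rule L.lifts_homotopic[OF N.resolution_axioms \<theta> \<theta>']) (simp add: \<phi>)
  then obtain h where
    "null_homotopy R (std R L) (std R N) (\<lambda>k v. \<theta> k v \<ominus>\<^bsub>obj (std R N) k\<^esub> \<theta>' k v) h" by blast
  then have "coboundary R (std R L) M i (\<lambda>v. f (\<theta> i v \<ominus>\<^bsub>obj (std R N) i\<^esub> \<theta>' i v))"
    by (rule coboundary_of_null_homotopy[OF mod(3) L.resolution_axioms N.resolution_axioms])
      (use f chain_map_closed[OF \<theta>] chain_map_closed[OF \<theta>'] in auto)
  from coboundary_add[OF mod(3) this cob] show ?thesis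
  proof (rule coboundary_cong)
    fix v assume v: "v \<in> carrier (obj (std R L) i)"
    have c: "\<theta> i v \<in> carrier (std_res R N i)" "\<theta>' i v \<in> carrier (std_res R N i)"
      using chain_map_closed[OF \<theta> v] chain_map_closed[OF \<theta>' v] by auto
    have f': "is_linear R (std_res R N i) M f" using f by (simp add: cocycle_def)
    have "f (\<theta> i v \<ominus>\<^bsub>std_res R N i\<^esub> \<theta>' i v) = f (\<theta> i v) \<ominus>\<^bsub>M\<^esub> f (\<theta>' i v)"
      using is_linear_diff[OF std_res_module mod(3) f' c] .
    then show "f (\<theta> i v) = f (\<theta> i v \<ominus>\<^bsub>obj (std R N) i\<^esub> \<theta>' i v) \<oplus>\<^bsub>M\<^esub> f (\<theta>' i v)"
      using is_linear_closed[OF f' c(1)] is_linear_closed[OF f' c(2)]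
      by (simp add: M.M.minus_eq M.M.a_assoc M.M.l_neg)
  qed
qed

lemma ext_zero_cong:
  assumes "module R L" "ext_zero R L N M i \<phi> f" "\<And>x. x \<in> carrier L \<Longrightarrow> \<psi> x = \<phi> x"
  shows "ext_zero R L N M i \<psi> f"
  using assms chain_map_cong[OF _ std_resolution[OF assms(1)]] unfolding ext_zero_def
  by (metis std_simps(4))

lemma ext_zero_comp:
  assumes "module R K" "module R L" "is_linear R K L \<psi>" "ext_zero R L N M i \<phi> f"
  shows "ext_zero R K N M i (\<lambda>x. \<phi> (\<psi> x)) f"
proof -
  obtain \<zeta> where \<zeta>: "chain_map R (std R K) (std R L) \<psi> \<zeta>"
    using std_lift_exists assms by blast
  obtain \<theta> where \<theta>: "chain_map R (std R L) (std R N) \<phi> \<theta>"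
    and cob: "coboundary R (std R L) M i (\<lambda>v. f (\<theta> i v))"
    using assms by (auto simp: ext_zero_def)
  show ?thesis unfolding ext_zero_def
    using chain_map_comp[OF \<zeta> \<theta>] coboundary_pullback[OF \<zeta> cob] by blast
qed

text \<open>The cocycle f \<theta> represents the restriction to \<open>L\<close>, and further
  restriction to \<open>K\<close> can be tested on either representative. The backward direction
  needs independence of the lift.\<close>

lemma ext_zero_pullback:
  assumes mod: "module R K" "module R L" "module R N" "module R M"
    and lin: "is_linear R K L \<psi>" "is_linear R L N \<phi>"
    and f: "cocycle R (std R N) M i f" and \<theta>: "chain_map R (std R L) (std R N) \<phi> \<theta>"
  shows "ext_zero R K L M i \<psi> (\<lambda>v. f (\<theta> i v)) \<longleftrightarrow> ext_zero R K N M i (\<lambda>x. \<phi> (\<psi> x)) f"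
proof
  assume "ext_zero R K L M i \<psi> (\<lambda>v. f (\<theta> i v))"
  then show "ext_zero R K N M i (\<lambda>x. \<phi> (\<psi> x)) f"
    using chain_map_comp[OF _ \<theta>] unfolding ext_zero_def by fast
next
  assume z: "ext_zero R K N M i (\<lambda>x. \<phi> (\<psi> x)) f"
  obtain \<zeta> where \<zeta>: "chain_map R (std R K) (std R L) \<psi> \<zeta>"
    using std_lift_exists mod lin by blast
  show "ext_zero R K L M i \<psi> (\<lambda>v. f (\<theta> i v))"
    using ext_zero_lift[OF mod(1,3,4) is_linear_comp[OF lin] f z chain_map_comp[OF \<zeta> \<theta>]] \<zeta>
    unfolding ext_zero_def by blast
qed

lemma ext_zero_id:
  assumes "module R N" "module R M" "cocycle R (std R N) M i f"
  shows "ext_zero R N N M i (\<lambda>x. x) f \<longleftrightarrow> coboundary R (std R N) M i f"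
proof -
  have id: "chain_map R (std R N) (std R N) (\<lambda>x. x) (\<lambda>k v. v)"
    by (auto simp: chain_map_def is_linear_id)
  show ?thesis
    using ext_zero_lift[OF assms(1,1,2) is_linear_id assms(3) _ id] id
    by (auto simp: ext_zero_def)
qed

text \<open>A section of the augmentation makes \<open>N\<close> projective, hence its higher cohomology vanishes.\<close>

lemma coboundary_of_section:
  assumes mod: "module R N" "module R M"
    and sec: "is_linear R N (std_res R N 0) sec" "\<And>x. x \<in> carrier N \<Longrightarrow> augmentation R N (sec x) = x"
    and f: "cocycle R (std R N) M (Suc i) f"
  shows "coboundary R (std R N) M (Suc i) f"
proof -
  interpret N: free_resolution R "std R N" "res_basis R N" by (rule std_free_resolution[OF mod(1)])
  interpret N0: module R "std_res R N 0" by (rule std_res_module)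
  interpret Nm: module R N by fact
  \<comment> \<open>In degree 0 the splitting given by the section is subtracted from the identity,
    so the augmentation kills the result and \<theta> covers the zero map. In positive degrees
    \<theta> is the identity, so a null homotopy bounds \<open>f\<close> itself.\<close>
  define \<theta> where "\<theta> = (\<lambda>k v. case k of
      0 \<Rightarrow> v \<ominus>\<^bsub>std_res R N 0\<^esub> sec (augmentation R N v) | Suc _ \<Rightarrow> v)"
  note aug = N.aug_linear[simplified]
  have \<theta>0: "is_linear R (std_res R N 0) (std_res R N 0) (\<theta> 0)"
    unfolding \<theta>_def nat.case
    by (intro is_linear_sub is_linear_id std_res_module is_linear_comp[OF aug sec(1)])
  have "chain_map R (std R N) (std R N) (\<lambda>x. \<zero>\<^bsub>base (std R N)\<^esub>) \<theta>"
    unfolding chain_map_def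
  proof (intro conjI allI ballI)
    show "is_linear R (obj (std R N) k) (obj (std R N) k) (\<theta> k)" for k
      using \<theta>0 by (cases k) (auto simp: \<theta>_def is_linear_id)
    fix v assume "v \<in> carrier (obj (std R N) 0)"
    then have v: "v \<in> carrier (std_res R N 0)" by simp
    note a = is_linear_closed[OF aug v]
    have "augmentation R N (\<theta> 0 v)
        = augmentation R N v \<ominus>\<^bsub>N\<^esub> augmentation R N (sec (augmentation R N v))"
      unfolding \<theta>_def nat.case
      by (rule is_linear_diff[OF std_res_module mod(1) aug v is_linear_closed[OF sec(1) a]])
    then show "aug (std R N) (\<theta> 0 v) = \<zero>\<^bsub>base (std R N)\<^esub>"
      using a sec(2) by (simp add: Nm.M.minus_eq Nm.M.r_neg)
  next
    fix k v assume v: "v \<in> carrier (obj (std R N) (Suc k))"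
    \<comment> \<open>Compatibility between degrees 1 and 0: boundaries have augmentation zero, so
      nothing is subtracted from them.\<close>
    have "sec \<zero>\<^bsub>N\<^esub> = \<zero>\<^bsub>std_res R N 0\<^esub>"
      by (rule is_linear_zero[OF mod(1) std_res_module sec(1)])
    then show "dif (std R N) k (\<theta> (Suc k) v) = \<theta> k (dif (std R N) k v)"
      using v N.aug_dif[of v] N.dif_closed[of v k]
      by (cases k) (auto simp: \<theta>_def N0.M.minus_eq simp del: std_res_zero)
  qed
  from N.null_homotopy_exists[OF N.resolution_axioms this]
  obtain h where "null_homotopy R (std R N) (std R N) \<theta> h" by blast
  from coboundary_of_null_homotopy[OF mod(2) N.resolution_axioms N.resolution_axioms this _ f]
  show ?thesis by (simp add: \<theta>_def)
qed

end

section \<open>Mapping cones\<close>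

definition prod_module ::
    "('c, 'x, 'm) module_scheme \<Rightarrow> ('c, 'y, 'n) module_scheme \<Rightarrow> ('c, 'x \<times> 'y) module" where
  "prod_module N L =
     \<lparr>carrier = carrier N \<times> carrier L, monoid.mult = undefined, one = undefined,
      ring.zero = (\<zero>\<^bsub>N\<^esub>, \<zero>\<^bsub>L\<^esub>),
      ring.add = (\<lambda>(x, y) (x', y'). (x \<oplus>\<^bsub>N\<^esub> x', y \<oplus>\<^bsub>L\<^esub> y')),
      smult = (\<lambda>a (x, y). (a \<odot>\<^bsub>N\<^esub> x, a \<odot>\<^bsub>L\<^esub> y))\<rparr>"

lemma prod_module_simps [simp]:
  "carrier (prod_module N L) = carrier N \<times> carrier L"
  "\<zero>\<^bsub>prod_module N L\<^esub> = (\<zero>\<^bsub>N\<^esub>, \<zero>\<^bsub>L\<^esub>)"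
  "(x, y) \<oplus>\<^bsub>prod_module N L\<^esub> (x', y') = (x \<oplus>\<^bsub>N\<^esub> x', y \<oplus>\<^bsub>L\<^esub> y')"
  "a \<odot>\<^bsub>prod_module N L\<^esub> (x, y) = (a \<odot>\<^bsub>N\<^esub> x, a \<odot>\<^bsub>L\<^esub> y)"
  by (auto simp: prod_module_def)

lemma prod_module_is_module:
  assumes "module A N" "module A L"
  shows "module A (prod_module N L)"
proof -
  interpret N: module A N by fact
  interpret L: module A L by fact
  show ?thesis
  proof (rule moduleI)
    show "cring A" by (rule N.R.is_cring)
    show "abelian_group (prod_module N L)"
    proof (rule abelian_groupI)
      fix z assume "z \<in> carrier (prod_module N L)"
      then show "\<exists>w\<in>carrier (prod_module N L). w \<oplus>\<^bsub>prod_module N L\<^esub> z = \<zero>\<^bsub>prod_module N L\<^esub>"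
        by (intro bexI[of _ "(\<ominus>\<^bsub>N\<^esub> fst z, \<ominus>\<^bsub>L\<^esub> snd z)"]) (auto simp: N.M.l_neg L.M.l_neg)
    qed (auto simp: N.M.a_ac L.M.a_ac)
  qed (auto simp: N.smult_l_distr N.smult_r_distr N.smult_assoc1
      L.smult_l_distr L.smult_r_distr L.smult_assoc1)
qed

definition zero_module :: "('c, 'x) module \<Rightarrow> ('c, 'x) module" where
  "zero_module N = N\<lparr>carrier := {\<zero>\<^bsub>N\<^esub>}\<rparr>"

lemma zero_module_is_module:
  assumes "module A N"
  shows "module A (zero_module N)"
proof -
  interpret N: module A N by fact
  show ?thesis
    by (rule moduleI, rule N.R.is_cring, rule abelian_groupI) (auto simp: zero_module_def)
qed

text \<open>The missing object in degree -1 is represented by the zero submodule of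
  \<open>obj D 0\<close>, so that every degree has the same type.\<close>

definition shifted :: "('c, 'q, 'y) aug_complex \<Rightarrow> nat \<Rightarrow> ('c, 'q) module" where
  "shifted D k = (case k of 0 \<Rightarrow> zero_module (obj D 0) | Suc j \<Rightarrow> obj D j)"

text \<open>The cone of a chain map \<open>\<alpha> : D \<rightarrow> C\<close> covering an injection with cokernel \<open>p : base C \<rightarrow> N\<close>
  resolves \<open>N\<close>.\<close>

definition mapping_cone ::
    "('c, 'q, 'y) aug_complex \<Rightarrow> ('c, 'p, 'x) aug_complex \<Rightarrow> (nat \<Rightarrow> 'q \<Rightarrow> 'p)
       \<Rightarrow> ('x \<Rightarrow> 'z) \<Rightarrow> ('c, 'z) module \<Rightarrow> ('c, 'p \<times> 'q, 'z) aug_complex" where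
  "mapping_cone D C \<alpha> p N =
     \<lparr>obj = (\<lambda>k. prod_module (obj C k) (shifted D k)),
      dif = (\<lambda>k (x, y). (dif C k x \<oplus>\<^bsub>obj C k\<^esub> \<alpha> k y,
        case k of 0 \<Rightarrow> \<zero>\<^bsub>obj D 0\<^esub> | Suc j \<Rightarrow> \<ominus>\<^bsub>obj D j\<^esub> dif D j y)),
      aug = (\<lambda>(x, y). p (aug C x)), base = N\<rparr>"

lemma shifted_simps [simp]:
  "shifted D 0 = zero_module (obj D 0)" "shifted D (Suc j) = obj D j"
  by (auto simp: shifted_def)

lemma zero_module_simps [simp]:
  "carrier (zero_module N) = {\<zero>\<^bsub>N\<^esub>}" "\<zero>\<^bsub>zero_module N\<^esub> = \<zero>\<^bsub>N\<^esub>"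
  "x \<oplus>\<^bsub>zero_module N\<^esub> y = x \<oplus>\<^bsub>N\<^esub> y" "a \<odot>\<^bsub>zero_module N\<^esub> x = a \<odot>\<^bsub>N\<^esub> x"
  by (auto simp: zero_module_def)

lemma cone_simps [simp]:
  "obj (mapping_cone D C \<alpha> p N) k = prod_module (obj C k) (shifted D k)"
  "dif (mapping_cone D C \<alpha> p N) 0 (x, y) = (dif C 0 x \<oplus>\<^bsub>obj C 0\<^esub> \<alpha> 0 y, \<zero>\<^bsub>obj D 0\<^esub>)"
  "dif (mapping_cone D C \<alpha> p N) (Suc j) (x, y)
    = (dif C (Suc j) x \<oplus>\<^bsub>obj C (Suc j)\<^esub> \<alpha> (Suc j) y, \<ominus>\<^bsub>obj D j\<^esub> dif D j y)"
  "aug (mapping_cone D C \<alpha> p N) (x, y) = p (aug C x)"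
  "base (mapping_cone D C \<alpha> p N) = N"
  by (auto simp: mapping_cone_def)

lemma shifted_module:
  assumes "resolution A D"
  shows "module A (shifted D k)"
  by (cases k) (use resolution.obj_module[OF assms] zero_module_is_module in auto)

text \<open>Exactness is checked on elements. The description of the kernel of \<open>p\<close> is
  used in degree 0. Injectivity of \<open>a\<close> is used in degree 1, where a cycle
  \<open>(x, y)\<close> gives only \<open>a (aug D y) = 0\<close> and \<open>aug D y = 0\<close> is
  wanted.\<close>

lemma cone_resolution:
  assumes C: "resolution A C" and D: "resolution A D" and N: "module A N"
    and \<alpha>: "chain_map A D C a \<alpha>"
    and inj: "\<And>y. y \<in> carrier (base D) \<Longrightarrow> a y = \<zero>\<^bsub>base C\<^esub> \<Longrightarrow> y = \<zero>\<^bsub>base D\<^esub>"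
    and a: "is_linear A (base D) (base C) a"
    and p: "is_linear A (base C) N p" "p ` carrier (base C) = carrier N"
    and ker: "\<And>x. x \<in> carrier (base C) \<Longrightarrow> p x = \<zero>\<^bsub>N\<^esub> \<longleftrightarrow> x \<in> a ` carrier (base D)"
  shows "resolution A (mapping_cone D C \<alpha> p N)" (is "resolution A ?K")
proof -
  interpret C: resolution A C by fact
  interpret D: resolution A D by fact
  interpret N: module A N by fact
  interpret bC: module A "base C" by (rule C.base_module)
  note \<alpha>' = chain_mapD[OF \<alpha>] chain_map_closed[OF \<alpha>]
  show ?thesis
  proof (intro resolution.intro resolution_axioms.intro C.is_cring)
    show "module A (base ?K)" by (simp add: N)
    show "module A (obj ?K k)" for k
      by (simp add: prod_module_is_module C.obj_module shifted_module[OF D])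
    show "is_linear A (obj ?K 0) (base ?K) (aug ?K)"
      by (intro is_linearI)
        (auto simp: is_linear_closed[OF is_linear_comp[OF C.aug_linear p(1)]]
          is_linear_add[OF is_linear_comp[OF C.aug_linear p(1)]]
          is_linear_smult[OF is_linear_comp[OF C.aug_linear p(1)]])
    have "aug ?K ` (carrier (obj C 0) \<times> {\<zero>\<^bsub>obj D 0\<^esub>})
        = p ` (aug C ` carrier (obj C 0))"
      by (auto simp: image_iff)
    then show "aug ?K ` carrier (obj ?K 0)
        = carrier (base ?K)"
      using p C.aug_surj by simp
    fix k
    interpret Ck: module A "obj C k" by (rule C.obj_module)
    show "is_linear A (obj ?K (Suc k)) (obj ?K k) (dif ?K k)"
    proof -
      have *: "dif C k (x \<oplus>\<^bsub>obj C (Suc k)\<^esub> x') \<oplus>\<^bsub>obj C k\<^esub> \<alpha> k (y \<oplus>\<^bsub>obj D k\<^esub> y')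
          = (dif C k x \<oplus>\<^bsub>obj C k\<^esub> \<alpha> k y) \<oplus>\<^bsub>obj C k\<^esub> (dif C k x' \<oplus>\<^bsub>obj C k\<^esub> \<alpha> k y')"
        if "x \<in> carrier (obj C (Suc k))" "x' \<in> carrier (obj C (Suc k))"
          "y \<in> carrier (obj D k)" "y' \<in> carrier (obj D k)" for x x' y y'
        using that C.dif_closed[of _ k] \<alpha>'(4)[of _ k]
        by (simp add: is_linear_add[OF C.dif_linear] is_linear_add[OF \<alpha>'(1)] Ck.M.a_ac)
      show ?thesis
      proof (cases k)
        case 0
        interpret D0: module A "obj D 0" by (rule D.obj_module)
        show ?thesis
          using * C.dif_closed[of _ k] \<alpha>'(4)[of _ k] unfolding 0
          by (intro is_linearI)
            (auto simp: is_linear_smult[OF C.dif_linear] is_linear_smult[OF \<alpha>'(1)]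
              Ck.smult_r_distr[unfolded 0] Ck.M.a_closed[unfolded 0])
      next
        case (Suc j)
        interpret Dj: module A "obj D j" by (rule D.obj_module)
        show ?thesis
          using * C.dif_closed[of _ k] \<alpha>'(4)[of _ k] D.dif_closed[of _ j] unfolding Suc
          by (intro is_linearI)
            (auto simp: is_linear_smult[OF C.dif_linear] is_linear_smult[OF \<alpha>'(1)]
              is_linear_smult[OF D.dif_linear] is_linear_add[OF D.dif_linear]
              Dj.M.minus_add Dj.smult_r_minus Ck.smult_r_distr[unfolded Suc]
              Ck.M.a_closed[unfolded Suc])
      qed
    qed
    fix v assume v: "v \<in> carrier (obj ?K k)"
    show "aug_cycle ?K k v
        \<longleftrightarrow> v \<in> dif ?K k ` carrier (obj ?K (Suc k))"
    proof (cases k)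
      case 0
      obtain x where x: "v = (x, \<zero>\<^bsub>obj D 0\<^esub>)" "x \<in> carrier (obj C 0)"
        using v 0 by auto
      have ax: "aug C x \<in> carrier (base C)" using is_linear_closed[OF C.aug_linear x(2)] .
      have "aug_cycle ?K k v \<longleftrightarrow> aug C x \<in> a ` carrier (base D)"
        using ker[OF ax] by (simp add: 0 x)
      also have "\<dots> \<longleftrightarrow> (\<exists>x'\<in>carrier (obj C (Suc 0)). \<exists>y\<in>carrier (obj D 0).
          x = dif C 0 x' \<oplus>\<^bsub>obj C 0\<^esub> \<alpha> 0 y)"
      proof
        assume "aug C x \<in> a ` carrier (base D)"
        then obtain y where y: "y \<in> carrier (obj D 0)" "aug C x = a (aug D y)"
          using D.aug_surj by force
        have ay: "\<alpha> 0 y \<in> carrier (obj C 0)" using \<alpha>'(4) y by auto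
        have "aug C (x \<ominus>\<^bsub>obj C 0\<^esub> \<alpha> 0 y) = aug C x \<ominus>\<^bsub>base C\<^esub> aug C (\<alpha> 0 y)"
          by (rule is_linear_diff[OF C.obj_module C.base_module C.aug_linear x(2) ay])
        also have "\<dots> = \<zero>\<^bsub>base C\<^esub>"
          using ax y \<alpha>'(2)[OF y(1)] by (simp add: bC.M.minus_eq bC.M.r_neg)
        finally have "x \<ominus>\<^bsub>obj C 0\<^esub> \<alpha> 0 y \<in> dif C 0 ` carrier (obj C (Suc 0))"
          using C.exact[of "x \<ominus>\<^bsub>obj C 0\<^esub> \<alpha> 0 y" 0] Ck.M.minus_closed[unfolded 0, OF x(2) ay] by simp
        then obtain x' where x': "x' \<in> carrier (obj C (Suc 0))" "x \<ominus>\<^bsub>obj C 0\<^esub> \<alpha> 0 y = dif C 0 x'"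
          by auto
        have "x = dif C 0 x' \<oplus>\<^bsub>obj C 0\<^esub> \<alpha> 0 y"
          unfolding x'(2)[symmetric] using x(2) ay Ck.M.minus_eq[unfolded 0] Ck.M.a_assoc[unfolded 0]
            Ck.M.l_neg[unfolded 0] Ck.M.a_inv_closed[unfolded 0] Ck.M.r_zero[unfolded 0] by simp
        then show "\<exists>x'\<in>carrier (obj C (Suc 0)). \<exists>y\<in>carrier (obj D 0).
          x = dif C 0 x' \<oplus>\<^bsub>obj C 0\<^esub> \<alpha> 0 y" using x' y by blast
      next
        assume "\<exists>x'\<in>carrier (obj C (Suc 0)). \<exists>y\<in>carrier (obj D 0).
          x = dif C 0 x' \<oplus>\<^bsub>obj C 0\<^esub> \<alpha> 0 y"
        then obtain x' y where xy: "x' \<in> carrier (obj C (Suc 0))" "y \<in> carrier (obj D 0)"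
          "x = dif C 0 x' \<oplus>\<^bsub>obj C 0\<^esub> \<alpha> 0 y" by blast
        have d: "aug D y \<in> carrier (base D)" using is_linear_closed[OF D.aug_linear xy(2)] .
        have "aug C x = a (aug D y)"
          unfolding xy(3)
          using is_linear_add[OF C.aug_linear C.dif_closed[OF xy(1)] \<alpha>'(4)[OF xy(2)]]
            C.aug_dif[OF xy(1)] \<alpha>'(2)[OF xy(2)] is_linear_closed[OF a d] by simp
        then show "aug C x \<in> a ` carrier (base D)" using d by auto
      qed
      also have "\<dots> \<longleftrightarrow> v \<in> dif ?K k ` carrier (obj ?K (Suc k))"
        by (force simp: 0 x)
      finally show ?thesis .
    next
      case (Suc j)
      interpret Dj: module A "obj D j" by (rule D.obj_module)
      interpret Cj: module A "obj C j" by (rule C.obj_module)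
      obtain x y where xy: "v = (x, y)" "x \<in> carrier (obj C (Suc j))" "y \<in> carrier (obj D j)"
        using v Suc by auto
      note ay = \<alpha>'(4)[OF xy(3)] and dx = C.dif_closed[OF xy(2)]
      show ?thesis
      proof
        assume "aug_cycle ?K k v"
        then have cyc1: "dif C j x \<oplus>\<^bsub>obj C j\<^esub> \<alpha> j y = \<zero>\<^bsub>obj C j\<^esub>"
          using Suc xy by (cases j) auto
        have "aug_cycle D j y"
        proof (cases j)
          case 0
          have d: "aug D y \<in> carrier (base D)"
            using is_linear_closed[OF D.aug_linear] xy(3) 0 by simp
          have "aug C (dif C 0 x \<oplus>\<^bsub>obj C 0\<^esub> \<alpha> 0 y) = \<zero>\<^bsub>base C\<^esub> \<oplus>\<^bsub>base C\<^esub> a (aug D y)"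
            using is_linear_add[OF C.aug_linear dx[unfolded 0] ay[unfolded 0]]
              C.aug_dif[OF xy(2)[unfolded 0]] \<alpha>'(2)[OF xy(3)[unfolded 0]] by simp
          then have "a (aug D y) = \<zero>\<^bsub>base C\<^esub>"
            using is_linear_closed[OF a d] cyc1[unfolded 0]
              is_linear_zero[OF C.obj_module C.base_module C.aug_linear] by simp
          then show ?thesis using inj[OF d] 0 by simp
        next
          case (Suc l)
          interpret Dl: module A "obj D l" by (rule D.obj_module)
          have "\<ominus>\<^bsub>obj D l\<^esub> dif D l y = \<zero>\<^bsub>obj D l\<^esub>"
            using \<open>aug_cycle ?K k v\<close> \<open>k = Suc j\<close> Suc xy by simp
          then show ?thesis
            using D.dif_closed[of y l] xy(3) Suc Dl.M.add.inv_eq_1_iff by simp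
        qed
        then obtain y' where y': "y' \<in> carrier (obj D (Suc j))" "y = dif D j y'"
          using D.exact[OF xy(3)] by auto
        interpret Dj': module A "obj D (Suc j)" by (rule D.obj_module)
        \<comment> \<open>The second component of the cone differential is \<open>- dif D j\<close>,
          so a preimage of \<open>y\<close> needs the opposite sign.\<close>
        define z where "z = \<ominus>\<^bsub>obj D (Suc j)\<^esub> y'"
        have z: "z \<in> carrier (obj D (Suc j))" "dif D j z = \<ominus>\<^bsub>obj D j\<^esub> y"
          unfolding z_def y'(2) using y'(1) is_linear_minus[OF D.obj_module D.obj_module D.dif_linear]
          by auto
        note az = \<alpha>'(4)[OF z(1)]
        have "dif C j (x \<ominus>\<^bsub>obj C k\<^esub> \<alpha> (Suc j) z) = dif C j x \<ominus>\<^bsub>obj C j\<^esub> \<alpha> j (dif D j z)"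
          using is_linear_diff[OF C.obj_module C.obj_module C.dif_linear xy(2) az] \<alpha>'(3)[OF z(1)]
          by (simp add: Suc)
        also have "\<dots> = dif C j x \<oplus>\<^bsub>obj C j\<^esub> \<alpha> j y"
          using is_linear_minus[OF D.obj_module C.obj_module \<alpha>'(1) xy(3)] ay
          by (simp add: z(2) Cj.M.minus_eq)
        finally have "x \<ominus>\<^bsub>obj C k\<^esub> \<alpha> (Suc j) z \<in> dif C (Suc j) ` carrier (obj C (Suc (Suc j)))"
          using C.exact[of "x \<ominus>\<^bsub>obj C k\<^esub> \<alpha> (Suc j) z" "Suc j"] cyc1 Ck.M.minus_closed xy(2) az
          by (simp add: Suc)
        then obtain x' where x': "x' \<in> carrier (obj C (Suc (Suc j)))"
          "x \<ominus>\<^bsub>obj C k\<^esub> \<alpha> (Suc j) z = dif C (Suc j) x'" by auto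
        have "x = dif C (Suc j) x' \<oplus>\<^bsub>obj C k\<^esub> \<alpha> (Suc j) z"
          unfolding x'(2)[symmetric] using xy(2) az
          by (simp add: Suc[symmetric] Ck.M.minus_eq Ck.M.a_assoc Ck.M.l_neg)
        then have "v = dif ?K k (x', z)"
          using xy by (simp add: Suc z(2))
        then show "v \<in> dif ?K k ` carrier (obj ?K (Suc k))"
          using x'(1) z(1) by (intro image_eqI[of _ _ "(x', z)"]) (auto simp: Suc)
      next
        assume "v \<in> dif ?K k ` carrier (obj ?K (Suc k))"
        then obtain x' z where x'z: "x' \<in> carrier (obj C (Suc (Suc j)))" "z \<in> carrier (obj D (Suc j))"
          "v = dif ?K k (x', z)" by (auto simp: Suc)
        then have x: "x = dif C (Suc j) x' \<oplus>\<^bsub>obj C (Suc j)\<^esub> \<alpha> (Suc j) z"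
          and y: "y = \<ominus>\<^bsub>obj D j\<^esub> dif D j z" using xy by (auto simp: Suc)
        note dz = D.dif_closed[OF x'z(2)]
        have "dif C j x = \<zero>\<^bsub>obj C j\<^esub> \<oplus>\<^bsub>obj C j\<^esub> \<alpha> j (dif D j z)"
          unfolding x using is_linear_add[OF C.dif_linear C.dif_closed[OF x'z(1)] \<alpha>'(4)[OF x'z(2)]]
            C.dif_dif[OF x'z(1)] \<alpha>'(3)[OF x'z(2)] by simp
        then have dx0: "dif C j x \<oplus>\<^bsub>obj C j\<^esub> \<alpha> j y = \<zero>\<^bsub>obj C j\<^esub>"
          using is_linear_minus[OF D.obj_module C.obj_module \<alpha>'(1) dz] \<alpha>'(4)[OF dz]
          by (simp add: y Cj.M.r_neg)
        have "\<ominus>\<^bsub>obj D l\<^esub> dif D l y = \<zero>\<^bsub>obj D l\<^esub>" if "j = Suc l" for l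
        proof -
          interpret Dl: module A "obj D l" by (rule D.obj_module)
          have "dif D l y = \<ominus>\<^bsub>obj D l\<^esub> dif D l (dif D j z)"
            unfolding y
            using is_linear_minus[OF D.obj_module D.obj_module D.dif_linear[of l]] dz that by simp
          then show ?thesis using D.dif_dif[of z l] x'z(2) that by simp
        qed
        then show "aug_cycle ?K k v"
          using dx0 Suc xy
          by (cases j) auto
      qed
    qed
  qed
qed

lemma is_linear_fst: "is_linear A (prod_module N L) N fst"
  and is_linear_snd: "is_linear A (prod_module N L) L snd"
  by (auto intro!: is_linearI)

lemma (in abelian_group) add_cancel_minus:
  "\<lbrakk>b \<in> carrier G; c \<in> carrier G\<rbrakk> \<Longrightarrow> b \<oplus> (c \<ominus> b) = c"
  unfolding a_minus_def by (metis a_inv_closed a_lcomm r_neg r_zero)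

text \<open>Here \<open>b\<close> stands for \<pi> \<alpha> \<gamma>, which enters the boundaries of
  the two homotopies \<pi> \<omega> and \<open>h\<close> \<gamma> with opposite signs and has to
  cancel in \<open>connecting_natural\<close>.\<close>

lemma (in abelian_group) minus_regroup:
  assumes "b \<in> carrier G" "c \<in> carrier G" "h \<in> carrier G" "w \<in> carrier G"
  shows "(b \<ominus> h) \<oplus> (c \<ominus> b \<ominus> w) = c \<oplus> (\<ominus> h \<oplus> \<ominus> w)"
proof -
  have "(b \<ominus> h) \<oplus> (d \<ominus> w) = (b \<oplus> d) \<oplus> (\<ominus> h \<oplus> \<ominus> w)" if "d \<in> carrier G" for d
    using assms that by (simp add: a_minus_def a_ac)
  from this[of "c \<ominus> b"] show ?thesis using assms by (simp add: add_cancel_minus)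
qed

text \<open>The cancellation again, after evaluation of cochains; the difference
  \<open>b - f\<close> left over is a value of \<open>e\<close> \<gamma>.\<close>

lemma (in abelian_group) minus_regroup':
  assumes "b \<in> carrier G" "c \<in> carrier G" "f \<in> carrier G" "w \<in> carrier G"
  shows "f \<oplus> (c \<ominus> b \<ominus> w) = c \<oplus> (\<ominus> w \<oplus> \<ominus> (b \<ominus> f))"
  using assms by (simp add: a_minus_def minus_add a_ac)

text \<open>\<open>connecting A N' N N'' a p M k f e\<close>: the class of \<open>f\<close> on \<open>N''\<close> restricts to zero on
  \<open>N\<close>, and \<open>e\<close> is the class on \<open>N'\<close> from which the connecting map produces \<open>f\<close>.\<close>

definition connecting ::
    "('c, 'r) ring_scheme \<Rightarrow> ('c, 'x) module \<Rightarrow> ('c, 'x) module \<Rightarrow> ('c, 'x) module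
       \<Rightarrow> ('x \<Rightarrow> 'x) \<Rightarrow> ('x \<Rightarrow> 'x) \<Rightarrow> ('c, 'y, 'n) module_scheme \<Rightarrow> nat
       \<Rightarrow> ((('c, 'x) basis_elem \<Rightarrow> 'c) \<Rightarrow> 'y) \<Rightarrow> ((('c, 'x) basis_elem \<Rightarrow> 'c) \<Rightarrow> 'y) \<Rightarrow> bool" where
  "connecting A N' N N'' a p M k f e \<longleftrightarrow> (\<exists>\<alpha> \<pi> h g.
     chain_map A (std A N') (std A N) a \<alpha> \<and> chain_map A (std A N) (std A N'') p \<pi> \<and>
     null_homotopy A (std A N') (std A N'') (\<lambda>j v. \<pi> j (\<alpha> j v)) h \<and>
     is_linear A (std_res A N k) M g \<and>
     (\<forall>v\<in>carrier (std_res A N (Suc k)). f (\<pi> (Suc k) v) = g (differential A v)) \<and>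
     e = (\<lambda>v. g (\<alpha> k v) \<ominus>\<^bsub>M\<^esub> f (h k v)))"

context cring
begin

text \<open>As p a = 0, the composite \<pi> \<alpha> has a null homotopy \<open>h\<close>. On
  boundaries both g \<alpha> and f h take the value f \<pi> \<alpha>, the former because f \<pi> = g
  d, the latter because f d = 0; their difference is therefore a cocycle.\<close>

lemma connecting_exists:
  assumes mod: "module R N'" "module R N" "module R N''" "module R M"
    and lin: "is_linear R N' N a" "is_linear R N N'' p"
    and pa: "\<And>x. x \<in> carrier N' \<Longrightarrow> p (a x) = \<zero>\<^bsub>N''\<^esub>"
    and f: "cocycle R (std R N'') M (Suc k) f" and z: "ext_zero R N N'' M (Suc k) p f"
  shows "\<exists>e. connecting R N' N N'' a p M k f e \<and> cocycle R (std R N') M k e"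
proof -
  interpret M: module R M by fact
  interpret N': free_resolution R "std R N'" "res_basis R N'" by (rule std_free_resolution[OF mod(1)])
  interpret N: resolution R "std R N" by (rule std_resolution[OF mod(2)])
  interpret N'': resolution R "std R N''" by (rule std_resolution[OF mod(3)])
  obtain \<alpha> where \<alpha>: "chain_map R (std R N') (std R N) a \<alpha>"
    using std_lift_exists mod lin by blast
  obtain \<pi> g where \<pi>: "chain_map R (std R N) (std R N'') p \<pi>"
    and g: "is_linear R (std_res R N k) M g"
      "\<And>v. v\<in>carrier (std_res R N (Suc k)) \<Longrightarrow> f (\<pi> (Suc k) v) = g (differential R v)"
    using z by (auto simp: ext_zero_def coboundary_Suc)
  have "chain_map R (std R N') (std R N'') (\<lambda>x. \<zero>\<^bsub>base (std R N'')\<^esub>) (\<lambda>j v. \<pi> j (\<alpha> j v))"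
    by (rule chain_map_cong[OF chain_map_comp[OF \<alpha> \<pi>] N'.resolution_axioms]) (simp add: pa)
  from N'.null_homotopy_exists[OF N''.resolution_axioms this]
  obtain h where h: "null_homotopy R (std R N') (std R N'') (\<lambda>j v. \<pi> j (\<alpha> j v)) h" by blast
  define e where "e = (\<lambda>v. g (\<alpha> k v) \<ominus>\<^bsub>M\<^esub> f (h k v))"
  have f': "is_linear R (std_res R N'' (Suc k)) M f"
      "\<And>v. v\<in>carrier (std_res R N'' (Suc (Suc k))) \<Longrightarrow> f (differential R v) = \<zero>\<^bsub>M\<^esub>"
    using f by (auto simp: cocycle_def)
  have "cocycle R (std R N') M k e"
    unfolding cocycle_def
  proof (intro conjI ballI)
    show "is_linear R (obj (std R N') k) M e"
      unfolding e_def
      using is_linear_comp[OF chain_mapD(1)[OF \<alpha>], of k M g]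
        is_linear_comp[OF null_homotopyD(1)[OF h], of k M f] g(1) f'(1)
      by (intro is_linear_sub mod) auto
    fix v assume v: "v \<in> carrier (obj (std R N') (Suc k))"
    have c: "\<pi> (Suc k) (\<alpha> (Suc k) v) \<in> carrier (std_res R N'' (Suc k))"
        "h k (differential R v) \<in> carrier (std_res R N'' (Suc k))"
      using chain_map_closed[OF \<pi> chain_map_closed[OF \<alpha> v]]
        null_homotopy_closed[OF h N'.dif_closed[OF v]] by auto
    have "e (dif (std R N') k v) = f (\<pi> (Suc k) (\<alpha> (Suc k) v)) \<ominus>\<^bsub>M\<^esub> f (h k (differential R v))"
      using g(2)[of "\<alpha> (Suc k) v"] chain_map_closed[OF \<alpha> v] chain_mapD(3)[OF \<alpha> v] by (simp add: e_def)
    also have "\<dots> = f (\<pi> (Suc k) (\<alpha> (Suc k) v) \<ominus>\<^bsub>std_res R N'' (Suc k)\<^esub> h k (differential R v))"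
      using is_linear_diff[OF std_res_module mod(4) f'(1) c] by simp
    also have "\<dots> = f (differential R (h (Suc k) v))"
      using null_homotopyD(3)[OF h v] by simp
    also have "\<dots> = \<zero>\<^bsub>M\<^esub>" using f'(2) null_homotopy_closed[OF h v] by simp
    finally show "e (dif (std R N') k v) = \<zero>\<^bsub>M\<^esub>" .
  qed
  then show ?thesis using \<alpha> \<pi> h g unfolding connecting_def e_def by blast
qed

text \<open>Here \<open>e\<close> is pulled back along a morphism from a short exact sequence \<open>L' \<rightarrow> L \<rightarrow> L''\<close> to the
  sequence \<open>N' \<rightarrow> N \<rightarrow> N''\<close>.  The map \<open>\<zeta>\<close> from the mapping cone of \<open>L' \<rightarrow> L\<close> lifts \<open>L'' \<rightarrow> N''\<close>,
  and \<open>f\<close> is a coboundary on the cone.\<close>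

lemma connecting_natural:
  fixes L :: "('a, 'l) module"
  assumes mod: "module R N'" "module R N" "module R N''" "module R M"
    and modL: "module R L'" "module R L" "module R L''"
    and lin: "is_linear R N' N a" "is_linear R N N'' p"
    and linL: "is_linear R L' L a\<^sub>L" "is_linear R L L'' p\<^sub>L"
    and inj: "\<And>y. y \<in> carrier L' \<Longrightarrow> a\<^sub>L y = \<zero>\<^bsub>L\<^esub> \<Longrightarrow> y = \<zero>\<^bsub>L'\<^esub>"
    and surj: "p\<^sub>L ` carrier L = carrier L''"
    and ker: "\<And>x. x \<in> carrier L \<Longrightarrow> p\<^sub>L x = \<zero>\<^bsub>L''\<^esub> \<longleftrightarrow> x \<in> a\<^sub>L ` carrier L'"
    and vert: "is_linear R L' N' c" "is_linear R L N b" "is_linear R L'' N'' q"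
    and comm: "\<And>x. x \<in> carrier L' \<Longrightarrow> b (a\<^sub>L x) = a (c x)"
      "\<And>x. x \<in> carrier L \<Longrightarrow> q (p\<^sub>L x) = p (b x)"
    and f: "cocycle R (std R N'') M (Suc k) f"
    and e: "connecting R N' N N'' a p M k f e" "cocycle R (std R N') M k e"
    and z: "ext_zero R L' N' M k c e"
  shows "ext_zero R L'' N'' M (Suc k) q f"
proof -
  interpret M: module R M by fact
  interpret N': free_resolution R "std R N'" "res_basis R N'" by (rule std_free_resolution[OF mod(1)])
  interpret N: resolution R "std R N" by (rule std_resolution[OF mod(2)])
  interpret N'': resolution R "std R N''" by (rule std_resolution[OF mod(3)])
  interpret L': free_resolution R "std R L'" "res_basis R L'" by (rule std_free_resolution[OF modL(1)])
  interpret L: resolution R "std R L" by (rule std_resolution[OF modL(2)])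
  interpret L'': free_resolution R "std R L''" "res_basis R L''"
    by (rule std_free_resolution[OF modL(3)])
  obtain \<alpha> \<pi> h g where \<alpha>: "chain_map R (std R N') (std R N) a \<alpha>"
    and \<pi>: "chain_map R (std R N) (std R N'') p \<pi>"
    and h: "null_homotopy R (std R N') (std R N'') (\<lambda>j v. \<pi> j (\<alpha> j v)) h"
    and g: "is_linear R (std_res R N k) M g"
      "\<And>v. v\<in>carrier (std_res R N (Suc k)) \<Longrightarrow> f (\<pi> (Suc k) v) = g (differential R v)"
    and e_def: "e = (\<lambda>v. g (\<alpha> k v) \<ominus>\<^bsub>M\<^esub> f (h k v))"
    using e(1) by (auto simp: connecting_def)
  obtain \<gamma> where \<gamma>: "chain_map R (std R L') (std R N') c \<gamma>"
    and e\<gamma>: "coboundary R (std R L') M k (\<lambda>v. e (\<gamma> k v))"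
    using z by (auto simp: ext_zero_def)
  obtain \<beta> where \<beta>: "chain_map R (std R L) (std R N) b \<beta>"
    using std_lift_exists mod modL vert by blast
  obtain \<alpha>\<^sub>L where \<alpha>\<^sub>L: "chain_map R (std R L') (std R L) a\<^sub>L \<alpha>\<^sub>L"
    using std_lift_exists modL linL by blast
  \<comment> \<open>The left square commutes on modules only. On resolutions \<beta>
    \<alpha>\<open>\<^sub>L\<close> and \<alpha> \<gamma> are two lifts of the same map, and
    \<omega> measures their difference.\<close>
  have "\<exists>\<omega>. null_homotopy R (std R L') (std R N)
      (\<lambda>j v. \<beta> j (\<alpha>\<^sub>L j v) \<ominus>\<^bsub>obj (std R N) j\<^esub> \<alpha> j (\<gamma> j v)) \<omega>"
  proof (rule L'.lifts_homotopic[OF N.resolution_axioms chain_map_comp[OF \<alpha>\<^sub>L \<beta>]])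
    show "chain_map R (std R L') (std R N) (\<lambda>x. b (a\<^sub>L x)) (\<lambda>j v. \<alpha> j (\<gamma> j v))"
      by (rule chain_map_cong[OF chain_map_comp[OF \<gamma> \<alpha>] L'.resolution_axioms]) (simp add: comm)
    show "is_linear R (base (std R L')) (base (std R N)) (\<lambda>x. b (a\<^sub>L x))"
      using is_linear_comp[OF linL(1) vert(2)] by simp
  qed
  then obtain \<omega> where \<omega>: "null_homotopy R (std R L') (std R N)
      (\<lambda>j v. \<beta> j (\<alpha>\<^sub>L j v) \<ominus>\<^bsub>obj (std R N) j\<^esub> \<alpha> j (\<gamma> j v)) \<omega>" by blast
  let ?K = "mapping_cone (std R L') (std R L) \<alpha>\<^sub>L p\<^sub>L L''"
  interpret K: resolution R ?K
    by (rule cone_resolution[OF L.resolution_axioms L'.resolution_axioms modL(3) \<alpha>\<^sub>L])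
      (use inj surj ker linL in auto)
  \<comment> \<open>\<open>s\<close> compares the standard resolution of \<open>L''\<close> with the
    cone, so \<zeta> after \<open>s\<close> is a lift of \<open>q\<close>, and what bounds on the
    cone bounds after pulling back along \<open>s\<close>.\<close>
  have "\<exists>s. chain_map R (std R L'') ?K (\<lambda>x. x) s"
    by (rule L''.lift_exists[OF K.resolution_axioms]) (simp add: is_linear_id)
  then obtain s where s: "chain_map R (std R L'') ?K (\<lambda>x. x) s" by blast
  \<comment> \<open>A chain map on the cone is a chain map on the resolution of \<open>L\<close>
    together with a null homotopy of its composite with \<alpha>\<open>\<^sub>L\<close>. For \<pi>
    \<beta> such a homotopy is h \<gamma> + \<pi> \<omega>: \<open>h\<close> contracts \<pi>
    \<alpha>, and \<omega> passes from \<alpha> \<gamma> to \<beta>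
    \<alpha>\<open>\<^sub>L\<close>.\<close>
  define \<zeta> where "\<zeta> = (\<lambda>j z. case j of 0 \<Rightarrow> \<pi> 0 (\<beta> 0 (fst z))
    | Suc i \<Rightarrow> \<pi> (Suc i) (\<beta> (Suc i) (fst z)) \<oplus>\<^bsub>std_res R N'' (Suc i)\<^esub>
        (h i (\<gamma> i (snd z)) \<oplus>\<^bsub>std_res R N'' (Suc i)\<^esub> \<pi> (Suc i) (\<omega> i (snd z))))"
  have f': "is_linear R (std_res R N'' (Suc k)) M f"
      "\<And>v. v\<in>carrier (std_res R N'' (Suc (Suc k))) \<Longrightarrow> f (differential R v) = \<zero>\<^bsub>M\<^esub>"
    using f by (auto simp: cocycle_def)
  have lins: "is_linear R (std_res R L j) (std_res R N'' j) (\<lambda>x. \<pi> j (\<beta> j x))"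
      "is_linear R (std_res R L' j) (std_res R N'' (Suc j)) (\<lambda>y. h j (\<gamma> j y))"
      "is_linear R (std_res R L' j) (std_res R N'' (Suc j)) (\<lambda>y. \<pi> (Suc j) (\<omega> j y))" for j
    using is_linear_comp[OF chain_mapD(1)[OF \<beta>] chain_mapD(1)[OF \<pi>]]
      is_linear_comp[OF chain_mapD(1)[OF \<gamma>] null_homotopyD(1)[OF h]]
      is_linear_comp[OF null_homotopyD(1)[OF \<omega>] chain_mapD(1)[OF \<pi>]] by simp_all
  note cl = lins[THEN is_linear_closed]
  have \<zeta>_linear: "is_linear R (obj ?K j) (std_res R N'' j) (\<zeta> j)" for j
  proof (cases j)
    case 0
    then show ?thesis using is_linear_comp[OF is_linear_fst lins(1)] by (simp add: \<zeta>_def)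
  next
    case (Suc i)
    show ?thesis unfolding Suc \<zeta>_def nat.case cone_simps shifted_simps std_simps
      by (intro is_linear_sum std_res_module is_linear_comp[OF is_linear_fst lins(1)]
        is_linear_comp[OF is_linear_snd lins(2)] is_linear_comp[OF is_linear_snd lins(3)])
  qed
  have \<zeta>: "chain_map R ?K (std R N'') q \<zeta>"
    unfolding chain_map_def
  proof (intro conjI allI ballI)
    show "is_linear R (obj ?K j) (obj (std R N'') j) (\<zeta> j)" for j
      using \<zeta>_linear by simp
    fix v assume "v \<in> carrier (obj ?K 0)"
    then have v: "fst v \<in> carrier (std_res R L 0)" by auto
    have "aug (std R N'') (\<zeta> 0 v) = p (b (augmentation R L (fst v)))"
      using chain_mapD(2)[OF \<pi> chain_map_closed[OF \<beta>], of "fst v"] chain_mapD(2)[OF \<beta>, of "fst v"] v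
      by (simp add: \<zeta>_def)
    then show "aug (std R N'') (\<zeta> 0 v) = q (aug ?K v)"
      using comm(2)[of "augmentation R L (fst v)"] is_linear_closed[OF L.aug_linear, of "fst v"] v
      by (cases v) simp
  next
    fix j v assume "v \<in> carrier (obj ?K (Suc j))"
    then obtain x y where v: "v = (x, y)" "x \<in> carrier (std_res R L (Suc j))"
        "y \<in> carrier (std_res R L' j)" by auto
    interpret Nj: module R "std_res R N'' j" by (rule std_res_module)
    have dx: "differential R x \<in> carrier (std_res R L j)" using L.dif_closed[of x j] v by simp
    have ay: "\<alpha>\<^sub>L j y \<in> carrier (std_res R L j)" using chain_map_closed[OF \<alpha>\<^sub>L, of y j] v by simp
    have \<gamma>y: "\<gamma> j y \<in> carrier (std_res R N' j)" using chain_map_closed[OF \<gamma>, of y j] v by simp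
    have \<alpha>\<gamma>y: "\<alpha> j (\<gamma> j y) \<in> carrier (std_res R N j)"
      using chain_map_closed[OF \<alpha>, of "\<gamma> j y" j] \<gamma>y by simp
    have \<beta>ay: "\<beta> j (\<alpha>\<^sub>L j y) \<in> carrier (std_res R N j)"
      using chain_map_closed[OF \<beta>, of _ j] ay by simp
    have \<omega>y: "\<omega> j y \<in> carrier (std_res R N (Suc j))"
      using null_homotopy_closed[OF \<omega>, of y j] v by simp
    let ?A = "\<pi> j (\<beta> j (differential R x))" and ?B = "\<pi> j (\<alpha> j (\<gamma> j y))"
      and ?C = "\<pi> j (\<beta> j (\<alpha>\<^sub>L j y))"
    have c: "?A \<in> carrier (std_res R N'' j)" "?B \<in> carrier (std_res R N'' j)"
        "?C \<in> carrier (std_res R N'' j)"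
      using cl(1)[OF dx] cl(1)[OF ay] chain_map_closed[OF \<pi>, of _ j] \<alpha>\<gamma>y by auto
    have \<pi>lin: "is_linear R (std_res R N j) (std_res R N'' j) (\<pi> j)"
      using chain_mapD(1)[OF \<pi>] by simp
    have CB: "\<pi> j (\<beta> j (\<alpha>\<^sub>L j y) \<ominus>\<^bsub>std_res R N j\<^esub> \<alpha> j (\<gamma> j y)) = ?C \<ominus>\<^bsub>std_res R N'' j\<^esub> ?B"
      by (rule is_linear_diff[OF std_res_module std_res_module \<pi>lin \<beta>ay \<alpha>\<gamma>y])
    have "differential R (\<zeta> (Suc j) v) = differential R (\<pi> (Suc j) (\<beta> (Suc j) x))
        \<oplus>\<^bsub>std_res R N'' j\<^esub> (differential R (h j (\<gamma> j y))
        \<oplus>\<^bsub>std_res R N'' j\<^esub> differential R (\<pi> (Suc j) (\<omega> j y)))"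
    proof -
      interpret Nj': module R "std_res R N'' (Suc j)" by (rule std_res_module)
      show ?thesis
        using cl v is_linear_add[OF differential_linear[of N'' j]] by (simp add: \<zeta>_def)
    qed
    also have "differential R (\<pi> (Suc j) (\<beta> (Suc j) x)) = ?A"
      using chain_mapD(3)[OF \<pi> chain_map_closed[OF \<beta>], of x j] chain_mapD(3)[OF \<beta>, of x j] v by simp
    also have "differential R (\<pi> (Suc j) (\<omega> j y)) = \<pi> j (differential R (\<omega> j y))"
      using chain_mapD(3)[OF \<pi>, of "\<omega> j y" j] \<omega>y by simp
    finally have d\<zeta>: "differential R (\<zeta> (Suc j) v) = ?A \<oplus>\<^bsub>std_res R N'' j\<^esub>
        (differential R (h j (\<gamma> j y)) \<oplus>\<^bsub>std_res R N'' j\<^esub> \<pi> j (differential R (\<omega> j y)))" .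
    have AC: "\<pi> j (\<beta> j (differential R x \<oplus>\<^bsub>std_res R L j\<^esub> \<alpha>\<^sub>L j y)) = ?A \<oplus>\<^bsub>std_res R N'' j\<^esub> ?C"
      using is_linear_add[OF lins(1) dx ay] .
    show "dif (std R N'') j (\<zeta> (Suc j) v) = \<zeta> j (dif ?K j v)"
    proof (cases j)
      case 0
      have "differential R (h j (\<gamma> j y)) = ?B"
        using null_homotopyD(2)[OF h, of "\<gamma> 0 y"] \<gamma>y 0 by simp
      moreover have "\<pi> j (differential R (\<omega> j y)) = ?C \<ominus>\<^bsub>std_res R N'' j\<^esub> ?B"
        using null_homotopyD(2)[OF \<omega>, of y] v CB 0 by simp
      ultimately have "differential R (\<zeta> (Suc j) v) = ?A \<oplus>\<^bsub>std_res R N'' j\<^esub> ?C"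
        using d\<zeta> Nj.M.add_cancel_minus[OF c(2,3)] by simp
      then show ?thesis using AC v(1) by (simp add: 0 \<zeta>_def)
    next
      case (Suc i)
      have dy: "differential R y \<in> carrier (std_res R L' i)" using L'.dif_closed[of y i] v Suc by simp
      let ?H = "h i (\<gamma> i (differential R y))" and ?W = "\<pi> j (\<omega> i (differential R y))"
      have \<omega>dy: "\<omega> i (differential R y) \<in> carrier (std_res R N j)"
        using null_homotopy_closed[OF \<omega>, of _ i] dy Suc by simp
      have c': "?H \<in> carrier (std_res R N'' j)" "?W \<in> carrier (std_res R N'' j)"
        using cl(2,3)[OF dy] Suc by auto
      have "differential R (h j (\<gamma> j y)) = ?B \<ominus>\<^bsub>std_res R N'' j\<^esub> ?H"
        using null_homotopyD(3)[OF h, of "\<gamma> j y" i] \<gamma>y chain_mapD(3)[OF \<gamma>, of y i] v Suc by simp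
      moreover have "\<pi> j (differential R (\<omega> j y))
          = ?C \<ominus>\<^bsub>std_res R N'' j\<^esub> ?B \<ominus>\<^bsub>std_res R N'' j\<^esub> ?W"
      proof -
        interpret Nj': module R "std_res R N j" by (rule std_res_module)
        have "differential R (\<omega> j y) = \<beta> j (\<alpha>\<^sub>L j y) \<ominus>\<^bsub>std_res R N j\<^esub> \<alpha> j (\<gamma> j y)
            \<ominus>\<^bsub>std_res R N j\<^esub> \<omega> i (differential R y)"
          using null_homotopyD(3)[OF \<omega>, of y i] v Suc by simp
        then show ?thesis
          using is_linear_diff[OF std_res_module std_res_module \<pi>lin Nj'.M.minus_closed[OF \<beta>ay \<alpha>\<gamma>y] \<omega>dy]
            CB by simp
      qed
      ultimately have "differential R (\<zeta> (Suc j) v) = (?A \<oplus>\<^bsub>std_res R N'' j\<^esub> ?C)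
          \<oplus>\<^bsub>std_res R N'' j\<^esub> (\<ominus>\<^bsub>std_res R N'' j\<^esub> ?H \<oplus>\<^bsub>std_res R N'' j\<^esub> \<ominus>\<^bsub>std_res R N'' j\<^esub> ?W)"
        using d\<zeta> Nj.M.minus_regroup[OF c(2,3) c'] c c' by (simp add: Nj.M.a_assoc)
      moreover have "h i (\<gamma> i (\<ominus>\<^bsub>std_res R L' i\<^esub> differential R y)) = \<ominus>\<^bsub>std_res R N'' j\<^esub> ?H"
        using is_linear_minus[OF std_res_module std_res_module lins(2) dy] Suc by simp
      moreover have "\<pi> j (\<omega> i (\<ominus>\<^bsub>std_res R L' i\<^esub> differential R y)) = \<ominus>\<^bsub>std_res R N'' j\<^esub> ?W"
        using is_linear_minus[OF std_res_module std_res_module lins(3) dy] Suc by simp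
      ultimately show ?thesis using AC v(1) by (simp add: Suc \<zeta>_def)
    qed
  qed
  \<comment> \<open>Substituting f \<pi> = g d turns f \<zeta> into g \<beta> d + f h \<gamma> + g d
    \<omega>. The middle term is g \<alpha> \<gamma> - e \<gamma>, and e \<gamma> is a coboundary by
    assumption.\<close>
  have cob: "coboundary R ?K M (Suc k) (\<lambda>v. f (\<zeta> (Suc k) v))"
  proof -
    have g\<beta>: "is_linear R (std_res R L k) M (\<lambda>x. g (\<beta> k x))"
      using is_linear_comp[OF chain_mapD(1)[OF \<beta>], of k M g] g(1) by simp
    define F where "F = (\<lambda>y. f (h k (\<gamma> k y)))"
    define B where "B = (\<lambda>y. g (\<alpha> k (\<gamma> k y)))"
    define C where "C = (\<lambda>y. g (\<beta> k (\<alpha>\<^sub>L k y)))"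
    define A where "A = (\<lambda>x. g (\<beta> k (differential R x)))"
    have ay: "\<alpha>\<^sub>L k y \<in> carrier (std_res R L k)" if "y \<in> carrier (std_res R L' k)" for y
      using chain_map_closed[OF \<alpha>\<^sub>L, of y k] that by simp
    have dx: "differential R x \<in> carrier (std_res R L k)" if "x \<in> carrier (std_res R L (Suc k))" for x
      using L.dif_closed[of x k] that by simp
    have \<alpha>\<gamma>y: "\<alpha> k (\<gamma> k y) \<in> carrier (std_res R N k)" if "y \<in> carrier (std_res R L' k)" for y
      using chain_map_closed[OF \<alpha> chain_map_closed[OF \<gamma>], of y k] that by simp
    have \<beta>ay: "\<beta> k (\<alpha>\<^sub>L k y) \<in> carrier (std_res R N k)" if "y \<in> carrier (std_res R L' k)" for y
      using chain_map_closed[OF \<beta>, of _ k] ay[OF that] by simp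
    have \<omega>y: "\<omega> k y \<in> carrier (std_res R N (Suc k))" if "y \<in> carrier (std_res R L' k)" for y
      using null_homotopy_closed[OF \<omega>, of y k] that by simp
    have c: "F y \<in> carrier M" "B y \<in> carrier M" "C y \<in> carrier M" if "y \<in> carrier (std_res R L' k)" for y
      using cl(2)[OF that] is_linear_closed[OF f'(1)] is_linear_closed[OF g(1)] \<alpha>\<gamma>y[OF that] \<beta>ay[OF that]
      by (auto simp: F_def B_def C_def)
    have cA: "A x \<in> carrier M" if "x \<in> carrier (std_res R L (Suc k))" for x
      using is_linear_closed[OF g\<beta>] dx[OF that] by (simp add: A_def)
    have eq: "f (\<zeta> (Suc k) (x, y)) = A x \<oplus>\<^bsub>M\<^esub> (F y \<oplus>\<^bsub>M\<^esub> g (differential R (\<omega> k y)))"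
      if x: "x \<in> carrier (std_res R L (Suc k))" and y: "y \<in> carrier (std_res R L' k)" for x y
    proof -
      have "f (\<zeta> (Suc k) (x, y)) = f (\<pi> (Suc k) (\<beta> (Suc k) x)) \<oplus>\<^bsub>M\<^esub>
          (f (h k (\<gamma> k y)) \<oplus>\<^bsub>M\<^esub> f (\<pi> (Suc k) (\<omega> k y)))"
      proof -
        interpret Nk: module R "std_res R N'' (Suc k)" by (rule std_res_module)
        show ?thesis using cl x y is_linear_add[OF f'(1)] by (simp add: \<zeta>_def)
      qed
      then show ?thesis
        using g(2)[of "\<beta> (Suc k) x"] g(2)[OF \<omega>y[OF y]] chain_map_closed[OF \<beta>, of x "Suc k"]
          chain_mapD(3)[OF \<beta>, of x k] x by (simp add: A_def F_def)
    qed
    have CB: "g (\<beta> k (\<alpha>\<^sub>L k y) \<ominus>\<^bsub>std_res R N k\<^esub> \<alpha> k (\<gamma> k y)) = C y \<ominus>\<^bsub>M\<^esub> B y"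
      if "y \<in> carrier (std_res R L' k)" for y
      unfolding C_def B_def
      by (rule is_linear_diff[OF std_res_module mod(4) g(1) \<beta>ay[OF that] \<alpha>\<gamma>y[OF that]])
    have AC: "g (\<beta> k (differential R x \<oplus>\<^bsub>std_res R L k\<^esub> \<alpha>\<^sub>L k y)) = A x \<oplus>\<^bsub>M\<^esub> C y"
      if "x \<in> carrier (std_res R L (Suc k))" "y \<in> carrier (std_res R L' k)" for x y
      unfolding A_def C_def using is_linear_add[OF g\<beta> dx ay] that by blast
    have e': "e (\<gamma> k y) = B y \<ominus>\<^bsub>M\<^esub> F y" for y by (simp add: e_def B_def F_def)
    show ?thesis
    proof (cases k)
      \<comment> \<open>In degree 0 a coboundary is zero, so e \<gamma> vanishes and g \<beta> alone
        bounds.\<close>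
      case 0
      have "f (\<zeta> (Suc k) (x, y)) = g (\<beta> k (fst (dif ?K k (x, y))))"
        if x: "x \<in> carrier (std_res R L (Suc k))" and y: "y \<in> carrier (std_res R L' k)" for x y
      proof -
        have "F y = B y"
          using M.M.minus_eq_zeroD[OF _ c(2)[OF y] c(1)[OF y]] e\<gamma> e'[of y] y 0 by simp
        moreover have "g (differential R (\<omega> k y)) = C y \<ominus>\<^bsub>M\<^esub> B y"
          using null_homotopyD(2)[OF \<omega>, of y] CB[OF y] y 0 by simp
        ultimately have "f (\<zeta> (Suc k) (x, y)) = A x \<oplus>\<^bsub>M\<^esub> C y"
          using eq[OF x y] M.M.add_cancel_minus[OF c(2)[OF y] c(3)[OF y]] by simp
        then show ?thesis using AC[OF x y] by (simp add: 0)
      qed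
      then show ?thesis
        using is_linear_comp[OF is_linear_fst g\<beta>] unfolding coboundary_Suc
        by (intro exI[of _ "\<lambda>z. g (\<beta> k (fst z))"]) auto
    next
      \<comment> \<open>Here e \<gamma> = u d, and the bounding cochain is g \<beta> on the first
        component plus g \<omega> + u on the second; the minus sign of the cone differential makes
        the plus signs correct.\<close>
      case (Suc l)
      obtain u where u: "is_linear R (std_res R L' l) M u"
        "\<And>y. y \<in> carrier (std_res R L' k) \<Longrightarrow> e (\<gamma> k y) = u (differential R y)"
        using e\<gamma> by (auto simp: Suc coboundary_Suc)
      have g\<omega>: "is_linear R (std_res R L' l) M (\<lambda>y. g (\<omega> l y))"
        using is_linear_comp[OF null_homotopyD(1)[OF \<omega>], of l M g] g(1) Suc by simp
      have "f (\<zeta> (Suc k) (x, y)) = g (\<beta> k (fst (dif ?K k (x, y)))) \<oplus>\<^bsub>M\<^esub>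
          (g (\<omega> l (snd (dif ?K k (x, y)))) \<oplus>\<^bsub>M\<^esub> u (snd (dif ?K k (x, y))))"
        if x: "x \<in> carrier (std_res R L (Suc k))" and y: "y \<in> carrier (std_res R L' k)" for x y
      proof -
        interpret Nk: module R "std_res R N k" by (rule std_res_module)
        have dy: "differential R y \<in> carrier (std_res R L' l)" using L'.dif_closed[of y l] y Suc by simp
        let ?W = "g (\<omega> l (differential R y))"
        have W: "?W \<in> carrier M" using is_linear_closed[OF g\<omega> dy] .
        have \<omega>dy: "\<omega> l (differential R y) \<in> carrier (std_res R N k)"
          using null_homotopy_closed[OF \<omega>, of _ l] dy Suc by simp
        have "differential R (\<omega> k y) = \<beta> k (\<alpha>\<^sub>L k y) \<ominus>\<^bsub>std_res R N k\<^esub> \<alpha> k (\<gamma> k y)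
            \<ominus>\<^bsub>std_res R N k\<^esub> \<omega> l (differential R y)"
          using null_homotopyD(3)[OF \<omega>, of y l] y Suc by simp
        then have "g (differential R (\<omega> k y)) = C y \<ominus>\<^bsub>M\<^esub> B y \<ominus>\<^bsub>M\<^esub> ?W"
          using is_linear_diff[OF std_res_module mod(4) g(1)
              Nk.M.minus_closed[OF \<beta>ay[OF y] \<alpha>\<gamma>y[OF y]] \<omega>dy] CB[OF y] by simp
        then have "f (\<zeta> (Suc k) (x, y)) = (A x \<oplus>\<^bsub>M\<^esub> C y) \<oplus>\<^bsub>M\<^esub> (\<ominus>\<^bsub>M\<^esub> ?W \<oplus>\<^bsub>M\<^esub> \<ominus>\<^bsub>M\<^esub> u (differential R y))"
          using eq[OF x y] M.M.minus_regroup'[OF c(2)[OF y] c(3)[OF y] c(1)[OF y] W] c[OF y] cA[OF x] W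
            u(2)[OF y] e'[of y] is_linear_closed[OF u(1) dy] by (simp add: M.M.a_assoc)
        moreover have "g (\<omega> l (\<ominus>\<^bsub>std_res R L' l\<^esub> differential R y)) = \<ominus>\<^bsub>M\<^esub> ?W"
          by (rule is_linear_minus[OF std_res_module mod(4) g\<omega> dy])
        moreover have "u (\<ominus>\<^bsub>std_res R L' l\<^esub> differential R y) = \<ominus>\<^bsub>M\<^esub> u (differential R y)"
          by (rule is_linear_minus[OF std_res_module mod(4) u(1) dy])
        ultimately show ?thesis using AC[OF x y] by (simp add: Suc)
      qed
      moreover have "is_linear R (obj ?K k) M (\<lambda>z. g (\<beta> k (fst z)) \<oplus>\<^bsub>M\<^esub> (g (\<omega> l (snd z)) \<oplus>\<^bsub>M\<^esub> u (snd z)))"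
        using is_linear_comp[OF is_linear_fst g\<beta>, of "std_res R L' l"]
          is_linear_comp[OF is_linear_snd g\<omega>, of "std_res R L k"]
          is_linear_comp[OF is_linear_snd u(1), of "std_res R L k"]
        by (intro is_linear_sum mod) (simp_all add: Suc)
      ultimately show ?thesis
        unfolding coboundary_Suc
        by (intro exI[of _ "\<lambda>z. g (\<beta> k (fst z)) \<oplus>\<^bsub>M\<^esub> (g (\<omega> l (snd z)) \<oplus>\<^bsub>M\<^esub> u (snd z))"]) auto
    qed
  qed
  show ?thesis unfolding ext_zero_def
    using chain_map_comp[OF s \<zeta>] coboundary_pullback[OF s cob] by fast
qed

end

section \<open>Ideals of noetherian rings\<close>

definition adjoin :: "('a, 'r) ring_scheme \<Rightarrow> 'a set \<Rightarrow> 'a \<Rightarrow> 'a set" where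
  "adjoin R I a = {i \<oplus>\<^bsub>R\<^esub> r \<otimes>\<^bsub>R\<^esub> a | i r. i \<in> I \<and> r \<in> carrier R}"

definition colon :: "('a, 'r) ring_scheme \<Rightarrow> 'a set \<Rightarrow> 'a \<Rightarrow> 'a set" where
  "colon R I a = {r \<in> carrier R. r \<otimes>\<^bsub>R\<^esub> a \<in> I}"

context cring
begin

lemma ideal_closed:
  assumes "ideal I R"
  shows "\<zero> \<in> I" "x \<in> I \<Longrightarrow> x \<in> carrier R" "x \<in> I \<Longrightarrow> y \<in> I \<Longrightarrow> x \<oplus> y \<in> I"
    "x \<in> I \<Longrightarrow> r \<in> carrier R \<Longrightarrow> r \<otimes> x \<in> I" "x \<in> I \<Longrightarrow> r \<in> carrier R \<Longrightarrow> x \<otimes> r \<in> I"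
    "x \<in> I \<Longrightarrow> \<ominus> x \<in> I" "x \<in> I \<Longrightarrow> y \<in> I \<Longrightarrow> x \<ominus> y \<in> I"
proof -
  interpret ideal I R by fact
  show "\<zero> \<in> I" "x \<in> I \<Longrightarrow> x \<in> carrier R" "x \<in> I \<Longrightarrow> y \<in> I \<Longrightarrow> x \<oplus> y \<in> I"
    "x \<in> I \<Longrightarrow> r \<in> carrier R \<Longrightarrow> r \<otimes> x \<in> I" "x \<in> I \<Longrightarrow> r \<in> carrier R \<Longrightarrow> x \<otimes> r \<in> I"
    "x \<in> I \<Longrightarrow> \<ominus> x \<in> I" "x \<in> I \<Longrightarrow> y \<in> I \<Longrightarrow> x \<ominus> y \<in> I"
    by (auto simp: I_l_closed I_r_closed a_minus_def)
qed

lemma ideal_by_closure: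
  assumes "I \<subseteq> carrier R" "\<zero> \<in> I" "\<And>x y. x \<in> I \<Longrightarrow> y \<in> I \<Longrightarrow> x \<oplus> y \<in> I"
    "\<And>x r. x \<in> I \<Longrightarrow> r \<in> carrier R \<Longrightarrow> r \<otimes> x \<in> I"
  shows "ideal I R"
proof (rule idealI[OF ring_axioms])
  show "subgroup I (add_monoid R)"
  proof (rule add.subgroupI)
    fix x assume x: "x \<in> I"
    then have "(\<ominus> \<one>) \<otimes> x \<in> I" using assms(4) by blast
    then show "\<ominus> x \<in> I" using x assms(1) by (simp add: l_minus subset_iff)
  qed (use assms in auto)
  fix a x assume "a \<in> I" "x \<in> carrier R"
  then show "x \<otimes> a \<in> I" "a \<otimes> x \<in> I" using assms(1,4) m_comm[of a x] by auto
qed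

text \<open>Side condition of \<open>mult_map\<close> for the projection \<open>R/K\<close>
  \<rightarrow> \<open>R/J\<close>, which is multiplication by 1.\<close>

lemma one_mult_mem: "K \<subseteq> J \<Longrightarrow> ideal K R \<Longrightarrow> x \<in> K \<Longrightarrow> \<one> \<otimes> x \<in> J"
  using ideal_closed(2)[of K x] by auto

lemma adjoin_ideal:
  assumes "ideal I R" "a \<in> carrier R"
  shows "ideal (adjoin R I a) R"
proof (rule ideal_by_closure)
  note I = ideal_closed[OF assms(1)]
  show "adjoin R I a \<subseteq> carrier R" using I(2) assms(2) by (auto simp: adjoin_def)
  have "\<zero> = \<zero> \<oplus> \<zero> \<otimes> a" using assms by simp
  then show "\<zero> \<in> adjoin R I a" using I(1) unfolding adjoin_def by blast
  fix x assume "x \<in> adjoin R I a"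
  then obtain i r where x: "i \<in> I" "r \<in> carrier R" "x = i \<oplus> r \<otimes> a" by (auto simp: adjoin_def)
  show "x \<oplus> y \<in> adjoin R I a" if y: "y \<in> adjoin R I a" for y
  proof -
    obtain j s where y: "j \<in> I" "s \<in> carrier R" "y = j \<oplus> s \<otimes> a" using y by (auto simp: adjoin_def)
    have "x \<oplus> y = (i \<oplus> j) \<oplus> (r \<oplus> s) \<otimes> a"
      using x y I(2) assms(2) by (simp add: l_distr a_ac)
    then show ?thesis unfolding adjoin_def using x y I(3) by blast
  qed
  show "s \<otimes> x \<in> adjoin R I a" if s: "s \<in> carrier R" for s
  proof -
    have "s \<otimes> x = s \<otimes> i \<oplus> (s \<otimes> r) \<otimes> a"
      using x s I(2) assms(2) by (simp add: r_distr m_assoc)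
    then show ?thesis unfolding adjoin_def using x s I(4) by blast
  qed
qed

lemma adjoin_superset: "ideal I R \<Longrightarrow> a \<in> carrier R \<Longrightarrow> I \<subseteq> adjoin R I a"
proof
  fix i assume "ideal I R" "a \<in> carrier R" "i \<in> I"
  then have "i = i \<oplus> \<zero> \<otimes> a" using ideal_closed(2) by simp
  then show "i \<in> adjoin R I a" unfolding adjoin_def using \<open>i \<in> I\<close> by blast
qed

lemma adjoin_self: "ideal I R \<Longrightarrow> a \<in> carrier R \<Longrightarrow> a \<in> adjoin R I a"
proof -
  assume a: "ideal I R" "a \<in> carrier R"
  then have "a = \<zero> \<oplus> \<one> \<otimes> a" by simp
  then show ?thesis unfolding adjoin_def using ideal_closed(1)[OF a(1)] by blast
qed

lemma adjoin_least: "ideal J R \<Longrightarrow> I \<subseteq> J \<Longrightarrow> a \<in> J \<Longrightarrow> adjoin R I a \<subseteq> J"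
  by (auto simp: adjoin_def intro: ideal_closed)

lemma colon_ideal: "ideal I R \<Longrightarrow> a \<in> carrier R \<Longrightarrow> ideal (colon R I a) R"
  by (rule ideal_by_closure) (auto simp: colon_def l_distr m_assoc ideal_closed)

lemma colon_superset: "ideal I R \<Longrightarrow> a \<in> carrier R \<Longrightarrow> I \<subseteq> colon R I a"
  by (auto simp: colon_def ideal_closed)

section \<open>Prime ideals and prime avoidance\<close>

lemma prime_ideal: "primeideal P R \<Longrightarrow> ideal P R"
  by (simp add: primeideal.axioms(1))

lemma prime_mult_iff:
  assumes "primeideal P R" "a \<in> carrier R" "b \<in> carrier R"
  shows "a \<otimes> b \<in> P \<longleftrightarrow> a \<in> P \<or> b \<in> P"
proof -
  interpret primeideal P R by fact
  show ?thesis using I_prime I_l_closed I_r_closed assms by blast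
qed

lemma prime_pow: "primeideal P R \<Longrightarrow> a \<in> carrier R \<Longrightarrow> a [^] (k::nat) \<in> P \<Longrightarrow> a \<in> P"
proof (induction k)
  case 0
  then show ?case
    using ideal.one_imp_carrier[OF prime_ideal] primeideal.I_notcarr by force
next
  case (Suc k)
  then show ?case using prime_mult_iff[of P "a [^] k" a] by auto
qed

text \<open>The product of one element outside \<open>P\<close> from each of the ideals lies in all
  of them and, \<open>P\<close> being prime, not in \<open>P\<close>.\<close>

lemma prime_finite_intersection:
  assumes "finite S" "primeideal P R" "ideal I R" "\<And>Q. Q \<in> S \<Longrightarrow> ideal Q R"
    and "\<not> I \<subseteq> P" "\<And>Q. Q \<in> S \<Longrightarrow> \<not> Q \<subseteq> P"
  shows "\<exists>z. z \<in> I \<and> (\<forall>Q\<in>S. z \<in> Q) \<and> z \<notin> P"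
  using assms
proof (induction S rule: finite_induct)
  case empty
  then show ?case by blast
next
  case (insert Q S)
  then obtain z where z: "z \<in> I" "\<forall>Q\<in>S. z \<in> Q" "z \<notin> P" by auto
  obtain w where w: "w \<in> Q" "w \<notin> P" using insert.prems by blast
  have I: "ideal I R" "ideal Q R" using insert.prems by auto
  have c: "z \<in> carrier R" "w \<in> carrier R" using z w ideal_closed(2)[OF I(1)] ideal_closed(2)[OF I(2)] by auto
  have "\<forall>Q'\<in>insert Q S. z \<otimes> w \<in> Q'"
    using z w c insert.prems(3) by (auto intro: ideal_closed)
  moreover have "z \<otimes> w \<in> I" "z \<otimes> w \<notin> P"
    using z w c ideal_closed(5)[OF I(1)] prime_mult_iff[OF insert.prems(1)] by auto
  ultimately show ?case by blast
qed

lemma prime_avoidance: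
  assumes "finite S" "\<And>P. P \<in> S \<Longrightarrow> primeideal P R" "ideal I R" "\<And>P. P \<in> S \<Longrightarrow> \<not> I \<subseteq> P"
  shows "\<exists>y\<in>I. \<forall>P\<in>S. y \<notin> P"
  using assms
proof (induction "card S" arbitrary: S rule: less_induct)
  case less
  show ?case
  proof (cases "S = {}")
    case True
    then show ?thesis using ideal_closed(1)[OF less.prems(3)] by blast
  next
    case False
    then obtain P S' where S: "S = insert P S'" "P \<notin> S'" by (metis all_not_in_conv mk_disjoint_insert)
    then have fin: "finite S'" using less.prems by simp
    show ?thesis
    proof (cases "\<exists>Q\<in>S'. Q \<subseteq> P")
      case True
      then obtain Q where Q: "Q \<in> S'" "Q \<subseteq> P" by blast
      have "\<exists>y\<in>I. \<forall>P\<in>S - {Q}. y \<notin> P"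
        using less.prems Q S by (intro less.hyps) (auto intro: psubset_card_mono)
      then show ?thesis using Q S by auto
    next
      case False
      have "\<exists>y\<in>I. \<forall>P\<in>S'. y \<notin> P"
        using less.prems S fin by (intro less.hyps) (auto intro: psubset_card_mono)
      then obtain y where y: "y \<in> I" "\<forall>Q\<in>S'. y \<notin> Q" by blast
      show ?thesis
      proof (cases "y \<in> P")
        case True
        have P: "primeideal P R" "ideal P R" using less.prems(2) S prime_ideal by auto
        have "\<exists>z. z \<in> I \<and> (\<forall>Q\<in>S'. z \<in> Q) \<and> z \<notin> P"
          using S False less.prems(2,4)
          by (intro prime_finite_intersection[OF fin P(1) less.prems(3)])
            (auto intro!: prime_ideal simp del: subset_iff)
        then obtain z where z: "z \<in> I" "\<forall>Q\<in>S'. z \<in> Q" "z \<notin> P" by blast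
        have c: "y \<in> carrier R" "z \<in> carrier R" using y z ideal_closed(2)[OF less.prems(3)] by auto
        \<comment> \<open>Each prime of \<open>S\<close> contains exactly one of the two summands:
          \<open>P\<close> contains \<open>y\<close>, the others contain \<open>z\<close>.\<close>
        have "y \<oplus> z \<notin> Q" if Q: "ideal Q R" "(y \<in> Q) \<noteq> (z \<in> Q)" for Q
        proof
          assume "y \<oplus> z \<in> Q"
          moreover have "(y \<oplus> z) \<ominus> y = z" "(y \<oplus> z) \<ominus> z = y"
            using c add_cancel_minus[of y z] by (simp_all add: a_minus_def a_assoc r_neg)
          ultimately show False using Q(2) ideal_closed(7)[OF Q(1) \<open>y \<oplus> z \<in> Q\<close>] by metis
        qed
        then have "y \<oplus> z \<notin> Q" if "Q \<in> S" for Q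
          using that S True y z prime_ideal[OF less.prems(2)[OF that]] by auto
        then have "\<forall>Q\<in>S. y \<oplus> z \<notin> Q" by blast
        moreover have "y \<oplus> z \<in> I" using y z ideal_closed(3)[OF less.prems(3)] by blast
        ultimately show ?thesis by blast
      qed (use y S in auto)
    qed
  qed
qed

end

section \<open>Consequences of the maximal condition on ideals\<close>

locale noetherian_cring = cring R + noetherian_ring R for R (structure)
begin

text \<open>A nonempty chain of ideals contains its own union, so Zorn's lemma applies to any
  property \<open>Q\<close>.\<close>

lemma noetherian_max_ideal:
  assumes "ideal I\<^sub>0 R" "Q I\<^sub>0"
  obtains I where "ideal I R" "Q I" "\<And>J. ideal J R \<Longrightarrow> Q J \<Longrightarrow> I \<subseteq> J \<Longrightarrow> J = I"
proof -
  let ?F = "{I. ideal I R \<and> Q I}"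
  have "\<exists>I\<in>?F. \<forall>J\<in>?F. I \<subseteq> J \<longrightarrow> J = I"
  proof (rule subset_Zorn_nonempty)
    show "?F \<noteq> {}" using assms by blast
    fix C assume C: "C \<noteq> {}" "subset.chain ?F C"
    then have "subset.chain {I. ideal I R} C" by (auto simp: pred_on.chain_def)
    then have "\<Union>C \<in> C" by (rule ideal_chain_is_trivial[OF C(1)])
    then show "\<Union>C \<in> ?F" using C by (auto simp: pred_on.chain_def)
  qed
  then show ?thesis using that by blast
qed

text \<open>The ideals \<open>(I : y^k)\<close> grow with \<open>k\<close>, and a maximal one among
  them equals all later ones.\<close>

lemma colon_power_stable:
  assumes "ideal I R" "y \<in> carrier R"
  obtains N :: nat where "\<And>(s::nat) r. r \<in> carrier R \<Longrightarrow> r \<otimes> y [^] (N + s) \<in> I \<Longrightarrow> r \<otimes> y [^] N \<in> I"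
proof -
  define Q where "Q = (\<lambda>J. \<exists>k::nat. J = colon R I (y [^] k))"
  have "ideal (colon R I (y [^] (0::nat))) R" "Q (colon R I (y [^] (0::nat)))"
    unfolding Q_def using colon_ideal[OF assms(1) nat_pow_closed[OF assms(2)]] by blast+
  then obtain J where "Q J" and max': "\<And>J'. ideal J' R \<Longrightarrow> Q J' \<Longrightarrow> J \<subseteq> J' \<Longrightarrow> J' = J"
    by (rule noetherian_max_ideal[where Q = Q]) blast
  then obtain N where J: "J = colon R I (y [^] (N::nat))" by (auto simp: Q_def)
  have max: "colon R I (y [^] k) = J" if "J \<subseteq> colon R I (y [^] k)" for k :: nat
    using max'[OF colon_ideal[OF assms(1)] _ that] assms(2) by (auto simp: Q_def)
  have "r \<otimes> y [^] N \<in> I" if r: "r \<in> carrier R" "r \<otimes> y [^] (N + s) \<in> I" for s r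
  proof -
    have "J \<subseteq> colon R I (y [^] (N + s))"
    proof
      fix x assume "x \<in> J"
      then have x: "x \<in> carrier R" "x \<otimes> y [^] N \<in> I" by (auto simp: J colon_def)
      have "x \<otimes> y [^] (N + s) = (x \<otimes> y [^] N) \<otimes> y [^] s"
        using x assms(2) by (simp add: nat_pow_mult[symmetric] m_assoc)
      then show "x \<in> colon R I (y [^] (N + s))"
        using x assms(2) ideal_closed(5)[OF assms(1) x(2), of "y [^] s"] by (simp add: colon_def)
    qed
    then have "colon R I (y [^] (N + s)) = J" using max by blast
    then show ?thesis using r by (auto simp: J colon_def)
  qed
  then show ?thesis using that by blast
qed

text \<open>Noetherian induction: a maximal counterexample \<open>K\<close> is proper and not prime,
  so it contains a product \<open>ab\<close> of two elements outside it, and the primes over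
  \<open>K + (a)\<close> and over \<open>K + (b)\<close> are already under control.\<close>

lemma finite_primes_over:
  assumes "ideal I R"
  shows "\<exists>S. finite S \<and> (\<forall>P\<in>S. primeideal P R \<and> I \<subseteq> P) \<and>
    (\<forall>Q. primeideal Q R \<longrightarrow> I \<subseteq> Q \<longrightarrow> (\<exists>P\<in>S. P \<subseteq> Q))"
proof (rule ccontr)
  define good where "good = (\<lambda>I. \<exists>S. finite S \<and> (\<forall>P\<in>S. primeideal P R \<and> I \<subseteq> P) \<and>
    (\<forall>Q. primeideal Q R \<longrightarrow> I \<subseteq> Q \<longrightarrow> (\<exists>P\<in>S. P \<subseteq> Q)))"
  assume "\<not> ?thesis"
  then have "\<not> good I" by (simp add: good_def)
  with assms obtain K where K: "ideal K R" "\<not> good K"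
    and max: "\<And>J. ideal J R \<Longrightarrow> \<not> good J \<Longrightarrow> K \<subseteq> J \<Longrightarrow> J = K"
    by (rule noetherian_max_ideal[where Q = "\<lambda>I. \<not> good I"]) blast+
  have "\<not> primeideal K R"
    using K(2) unfolding good_def by (metis finite.emptyI finite.insertI insertI1 order_refl singletonD)
  moreover have "carrier R \<noteq> K"
  proof
    assume "carrier R = K"
    then have "\<nexists>Q. primeideal Q R \<and> K \<subseteq> Q"
      using primeideal.I_notcarr ideal_closed(2)[OF prime_ideal] by blast
    then have "good K" unfolding good_def by (intro exI[of _ "{}"]) auto
    then show False using K(2) by simp
  qed
  ultimately obtain a b where ab: "a \<in> carrier R" "b \<in> carrier R" "a \<otimes> b \<in> K" "a \<notin> K" "b \<notin> K"
    using ideal.primeidealCD[OF K(1) is_cring] by blast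
  have "good (adjoin R K c)" if "c \<in> carrier R" "c \<notin> K" for c
    using max[OF adjoin_ideal[OF K(1) that(1)] _ adjoin_superset[OF K(1) that(1)]]
      adjoin_self[OF K(1) that(1)] that(2) by blast
  then have "good (adjoin R K a)" "good (adjoin R K b)" using ab by auto
  then obtain S T where S: "finite S" "\<forall>P\<in>S. primeideal P R \<and> adjoin R K a \<subseteq> P"
      "\<forall>Q. primeideal Q R \<longrightarrow> adjoin R K a \<subseteq> Q \<longrightarrow> (\<exists>P\<in>S. P \<subseteq> Q)"
    and T: "finite T" "\<forall>P\<in>T. primeideal P R \<and> adjoin R K b \<subseteq> P"
      "\<forall>Q. primeideal Q R \<longrightarrow> adjoin R K b \<subseteq> Q \<longrightarrow> (\<exists>P\<in>T. P \<subseteq> Q)"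
    unfolding good_def by metis
  have "\<exists>P\<in>S \<union> T. P \<subseteq> Q" if Q: "primeideal Q R" "K \<subseteq> Q" for Q
  proof -
    have "a \<in> Q \<or> b \<in> Q" using prime_mult_iff[OF Q(1) ab(1,2)] ab(3) Q(2) by blast
    then have "adjoin R K a \<subseteq> Q \<or> adjoin R K b \<subseteq> Q"
      using adjoin_least[OF prime_ideal[OF Q(1)] Q(2)] by blast
    then show ?thesis using S(3) T(3) Q(1) by blast
  qed
  moreover have "\<forall>P\<in>S \<union> T. primeideal P R \<and> K \<subseteq> P"
    using S(2) T(2) adjoin_superset[OF K(1)] ab by blast
  ultimately have "good K" unfolding good_def using S(1) T(1) by (intro exI[of _ "S \<union> T"]) auto
  then show False using K(2) by blast
qed

text \<open>Existence of an associated prime of \<open>R/J\<close>: an annihilator of a nonzero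
  element that is maximal among such annihilators is prime.\<close>

lemma maximal_colon_prime:
  assumes "ideal J R" "J \<noteq> carrier R"
  obtains a where "a \<in> carrier R" "a \<notin> J" "primeideal (colon R J a) R"
proof -
  define Q where "Q = (\<lambda>I. \<exists>b. b \<in> carrier R \<and> b \<notin> J \<and> I = colon R J b)"
  obtain b where "b \<in> carrier R" "b \<notin> J" using assms(2) ideal_closed(2)[OF assms(1)] by blast
  then have "ideal (colon R J b) R" "Q (colon R J b)"
    using colon_ideal[OF assms(1)] by (auto simp: Q_def)
  then obtain I where "Q I" and max': "\<And>I'. ideal I' R \<Longrightarrow> Q I' \<Longrightarrow> I \<subseteq> I' \<Longrightarrow> I' = I"
    by (rule noetherian_max_ideal[where Q = Q]) blast
  then obtain a where a: "a \<in> carrier R" "a \<notin> J" and I: "I = colon R J a" by (auto simp: Q_def)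
  have max: "colon R J b = colon R J a"
    if "b \<in> carrier R" "b \<notin> J" "colon R J a \<subseteq> colon R J b" for b
    using max'[OF colon_ideal[OF assms(1) that(1)] _ that(3)[folded I]] that(1,2) I
    by (auto simp: Q_def)
  have "primeideal (colon R J a) R"
  proof (rule primeidealI[OF colon_ideal[OF assms(1) a(1)] is_cring])
    have "\<one> \<notin> colon R J a" using a by (simp add: colon_def)
    then show "carrier R \<noteq> colon R J a" by auto
    fix x y assume x: "x \<in> carrier R" and y: "y \<in> carrier R" and xy: "x \<otimes> y \<in> colon R J a"
    show "x \<in> colon R J a \<or> y \<in> colon R J a"
    proof (rule disjCI)
      assume "y \<notin> colon R J a"
      then have ya: "y \<otimes> a \<notin> J" using y by (simp add: colon_def)
      have "r \<otimes> (y \<otimes> a) \<in> J" if "r \<in> carrier R" "r \<otimes> a \<in> J" for r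
      proof -
        have "r \<otimes> (y \<otimes> a) = y \<otimes> (r \<otimes> a)" using that y a by (simp add: m_ac)
        then show ?thesis using ideal_closed(4)[OF assms(1) that(2) y] by simp
      qed
      \<comment> \<open>Maximality turns this inclusion into an equality, and \<open>xya\<close>
        lying in \<open>J\<close> then says that \<open>x\<close> kills \<open>a\<close> modulo
        \<open>J\<close>.\<close>
      then have "colon R J a \<subseteq> colon R J (y \<otimes> a)" by (auto simp: colon_def)
      then have "colon R J (y \<otimes> a) = colon R J a" using max ya y a by simp
      moreover have "x \<in> colon R J (y \<otimes> a)" using xy x y a by (simp add: colon_def m_assoc)
      ultimately show "x \<in> colon R J a" by simp
    qed
  qed
  then show ?thesis using a that by blast
qed

end

section \<open>Chains of primes and systems of parameters\<close>

definition prime_chain :: "('a, 'r) ring_scheme \<Rightarrow> nat \<Rightarrow> (nat \<Rightarrow> 'a set) \<Rightarrow> bool" where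
  "prime_chain R n P \<longleftrightarrow> (\<forall>i\<le>n. primeideal (P i) R) \<and> (\<forall>i<n. P i \<subset> P (Suc i))"

lemma krull_dim_ge: "prime_chain R n P \<Longrightarrow> enat n \<le> krull_dim R"
  unfolding krull_dim_def prime_chain_def by (rule Sup_upper) blast

locale noetherian_local_ring = noetherian_cring R for R (structure) +
  fixes m :: "'a set"
  assumes m_prime: "primeideal m R"
    and local: "\<And>I. ideal I R \<Longrightarrow> I \<noteq> carrier R \<Longrightarrow> I \<subseteq> m"
begin

text \<open>Each new element avoids the finitely many primes, other than \<open>m\<close>, from
  which every prime over the earlier elements can be reached. A prime over the longer list then
  strictly contains one of these, which lengthens its chain by one. The exception for
  \<open>m\<close> is forced, as the elements are chosen in \<open>m\<close>.\<close>

lemma parameters_exist: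
  "\<exists>ys. length ys = j \<and> set ys \<subseteq> m \<and>
     (\<forall>Q. primeideal Q R \<longrightarrow> set ys \<subseteq> Q \<longrightarrow> Q = m \<or> (\<exists>P. prime_chain R j P \<and> P j = Q))"
proof (induction j)
  case 0
  have "prime_chain R 0 (\<lambda>_. Q)" if "primeideal Q R" for Q
    using that by (simp add: prime_chain_def)
  then show ?case by (intro exI[of _ "[]"]) fastforce
next
  case (Suc j)
  then obtain ys where ys: "length ys = j" "set ys \<subseteq> m"
    and ht: "\<And>Q. primeideal Q R \<Longrightarrow> set ys \<subseteq> Q \<Longrightarrow> Q = m \<or> (\<exists>P. prime_chain R j P \<and> P j = Q)"
    by blast
  have ys': "set ys \<subseteq> carrier R" using ys(2) ideal_closed(2)[OF prime_ideal[OF m_prime]] by blast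
  obtain S where S: "finite S" "\<forall>P\<in>S. primeideal P R \<and> Idl (set ys) \<subseteq> P"
      "\<forall>Q. primeideal Q R \<longrightarrow> Idl (set ys) \<subseteq> Q \<longrightarrow> (\<exists>P\<in>S. P \<subseteq> Q)"
    using finite_primes_over[OF genideal_ideal[OF ys']] by blast
  \<comment> \<open>Any other prime lies properly inside \<open>m\<close>, so \<open>m\<close> is
    not contained in it and avoidance applies.\<close>
  have "\<exists>y\<in>m. \<forall>P\<in>S - {m}. y \<notin> P"
  proof (rule prime_avoidance)
    show "\<not> m \<subseteq> P" if "P \<in> S - {m}" for P
      using that S(2) local[of P] primeideal.I_notcarr prime_ideal by blast
  qed (use S m_prime prime_ideal in auto)
  then obtain y where y: "y \<in> m" "\<forall>P\<in>S - {m}. y \<notin> P" by blast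
  have "Q = m \<or> (\<exists>P. prime_chain R (Suc j) P \<and> P (Suc j) = Q)"
    if Q: "primeideal Q R" "set (y # ys) \<subseteq> Q" for Q
  proof (rule disjCI)
    assume no: "\<nexists>P. prime_chain R (Suc j) P \<and> P (Suc j) = Q"
    have "Idl (set ys) \<subseteq> Q" using Q(2) by (intro genideal_minimal prime_ideal Q(1)) auto
    then obtain P where P: "P \<in> S" "P \<subseteq> Q" using S(3) Q(1) by blast
    show "Q = m"
    proof (cases "P = m")
      case True
      then show ?thesis
        using P(2) local[OF prime_ideal[OF Q(1)]] primeideal.I_notcarr[OF Q(1)] by blast
    next
      case False
      then have "P \<subset> Q" using P y(2) Q(2) by auto
      moreover have "primeideal P R" "set ys \<subseteq> P"
        using S(2) P(1) genideal_self[OF ys'] by auto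
      then obtain c where c: "prime_chain R j c" "c j = P" using ht False by blast
      ultimately have "prime_chain R (Suc j) (c(Suc j := Q))"
        using Q(1) by (auto simp: prime_chain_def less_Suc_eq le_Suc_eq)
      then show ?thesis using no by auto
    qed
  qed
  then show ?case using ys y by (intro exI[of _ "y # ys"]) auto
qed

text \<open>A prime other than \<open>m\<close> over n such elements would end a chain of length n,
  and adding \<open>m\<close> on top would exceed the dimension.\<close>

lemma system_of_parameters:
  assumes "krull_dim R \<le> enat n"
  obtains ys where "length ys = n" "set ys \<subseteq> m" "\<And>Q. primeideal Q R \<Longrightarrow> set ys \<subseteq> Q \<Longrightarrow> Q = m"
proof -
  obtain ys where ys: "length ys = n" "set ys \<subseteq> m"
    and ht: "\<And>Q. primeideal Q R \<Longrightarrow> set ys \<subseteq> Q \<Longrightarrow> Q = m \<or> (\<exists>P. prime_chain R n P \<and> P n = Q)"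
    using parameters_exist by metis
  have "Q = m" if Q: "primeideal Q R" "set ys \<subseteq> Q" for Q
  proof (rule ccontr)
    assume "Q \<noteq> m"
    then obtain P where P: "prime_chain R n P" "P n = Q" using ht Q by blast
    have "Q \<subset> m" using \<open>Q \<noteq> m\<close> local[OF prime_ideal[OF Q(1)]] primeideal.I_notcarr[OF Q(1)] by blast
    then have "prime_chain R (Suc n) (P(Suc n := m))"
      using P m_prime by (auto simp: prime_chain_def less_Suc_eq le_Suc_eq)
    then have "enat (Suc n) \<le> enat n" using krull_dim_ge assms order_trans by blast
    then show False by simp
  qed
  then show ?thesis using that ys by blast
qed

end

section \<open>Cyclic modules\<close>

text \<open>Built in the same way as \<open>residue_module\<close>, which thereby becomes an
  instance by mere unfolding.\<close>

definition cyclic_module :: "('a, 'r) ring_scheme \<Rightarrow> 'a set \<Rightarrow> ('a, 'a set) module" where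
  "cyclic_module R I = module_via (\<lambda>x. I +>\<^bsub>R\<^esub> x) (R Quot I)"

text \<open>Multiplication by \<open>r\<close> as a map \<open>R/I \<rightarrow> R/J\<close>, defined when \<open>rI \<subseteq> J\<close>.\<close>

definition mult_map :: "('a, 'r) ring_scheme \<Rightarrow> 'a set \<Rightarrow> 'a \<Rightarrow> 'a set \<Rightarrow> 'a set" where
  "mult_map R J r Y = (\<Union>x\<in>Y. J +>\<^bsub>R\<^esub> (r \<otimes>\<^bsub>R\<^esub> x))"

context cring
begin

lemma coset_eq_iff:
  assumes "ideal I R" "x \<in> carrier R" "y \<in> carrier R"
  shows "I +> x = I +> y \<longleftrightarrow> x \<ominus> y \<in> I"
  using quotient_eq_iff_same_a_r_cos[OF assms] by auto

lemma coset_self: "ideal I R \<Longrightarrow> x \<in> carrier R \<Longrightarrow> x \<in> I +> x"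
  using ideal_closed(1)[of I] by (auto simp: a_r_coset_def' intro!: bexI[of _ \<zero>])

lemma coset_eq_ideal_iff:
  assumes "ideal I R" "x \<in> carrier R"
  shows "I +> x = I \<longleftrightarrow> x \<in> I"
proof -
  have "I +> \<zero> = I" using a_rcos_zero[OF assms(1), of \<zero>] ideal_closed(1)[OF assms(1)] by simp
  then show ?thesis using coset_eq_iff[OF assms zero_closed] assms by (simp add: a_minus_def)
qed

lemma cyclic_carrier: "carrier (cyclic_module R I) = (\<lambda>x. I +> x) ` carrier R"
  by (auto simp: cyclic_module_def module_via_def FactRing_def A_RCOSETS_def' )

lemma cyclic_ops:
  assumes "ideal I R" "x \<in> carrier R" "y \<in> carrier R"
  shows "\<zero>\<^bsub>cyclic_module R I\<^esub> = I"
    and "(I +> x) \<oplus>\<^bsub>cyclic_module R I\<^esub> (I +> y) = I +> (x \<oplus> y)"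
    and "x \<odot>\<^bsub>cyclic_module R I\<^esub> (I +> y) = I +> (x \<otimes> y)"
proof -
  interpret ideal I R by fact
  show "\<zero>\<^bsub>cyclic_module R I\<^esub> = I"
    "(I +> x) \<oplus>\<^bsub>cyclic_module R I\<^esub> (I +> y) = I +> (x \<oplus> y)"
    "x \<odot>\<^bsub>cyclic_module R I\<^esub> (I +> y) = I +> (x \<otimes> y)"
    using assms by (auto simp: cyclic_module_def module_via_def FactRing_def a_rcos_sum rcoset_mult_add)
qed

lemma cyclic_is_module:
  assumes "ideal I R"
  shows "module R (cyclic_module R I)"
proof -
  interpret Q: ring "R Quot I" by (rule ideal.quotient_is_ring[OF assms])
  note ops = cyclic_ops[OF assms]
  show ?thesis
  proof (rule moduleI[OF is_cring])
    show "abelian_group (cyclic_module R I)"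
    proof (rule abelian_groupI)
      fix Y assume "Y \<in> carrier (cyclic_module R I)"
      then obtain x where x: "x \<in> carrier R" "Y = I +> x" by (auto simp: cyclic_carrier)
      have "(I +> (\<ominus> x)) \<oplus>\<^bsub>cyclic_module R I\<^esub> Y = \<zero>\<^bsub>cyclic_module R I\<^esub>"
        using ops coset_eq_ideal_iff[OF assms zero_closed] ideal_closed(1)[OF assms] x
        by (simp add: l_neg)
      then show "\<exists>Z\<in>carrier (cyclic_module R I). Z \<oplus>\<^bsub>cyclic_module R I\<^esub> Y = \<zero>\<^bsub>cyclic_module R I\<^esub>"
        using x by (auto simp: cyclic_carrier intro!: bexI[of _ "\<ominus> x"])
    qed (use Q.a_closed Q.zero_closed Q.a_assoc Q.a_comm Q.l_zero in
        \<open>auto simp: cyclic_module_def module_via_def\<close>)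
  qed (auto simp: cyclic_carrier ops l_distr r_distr m_assoc)
qed

lemma mult_map_coset:
  assumes "ideal I R" "ideal J R" "r \<in> carrier R" "\<And>i. i \<in> I \<Longrightarrow> r \<otimes> i \<in> J" "x \<in> carrier R"
  shows "mult_map R J r (I +> x) = J +> (r \<otimes> x)"
proof -
  have "J +> (r \<otimes> y) = J +> (r \<otimes> x)" if yx: "y \<in> I +> x" for y
  proof -
    obtain i where i: "i \<in> I" "y = i \<oplus> x" using yx by (auto simp: a_r_coset_def')
    then have "i \<in> carrier R" using ideal_closed(2)[OF assms(1)] by simp
    then have "r \<otimes> y \<ominus> r \<otimes> x = r \<otimes> i"
      using i assms(3,5) by (simp add: r_distr a_minus_def a_assoc r_neg)
    then show ?thesis
      using coset_eq_iff[OF assms(2)] assms(3,4,5) i \<open>i \<in> carrier R\<close> by simp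
  qed
  then show ?thesis using coset_self[OF assms(1,5)] unfolding mult_map_def by blast
qed

lemma mult_map_linear:
  assumes "ideal I R" "ideal J R" "r \<in> carrier R" "\<And>i. i \<in> I \<Longrightarrow> r \<otimes> i \<in> J"
  shows "is_linear R (cyclic_module R I) (cyclic_module R J) (mult_map R J r)"
proof -
  note mc = mult_map_coset[OF assms(1,2,3)] and opsI = cyclic_ops[OF assms(1)]
    and opsJ = cyclic_ops[OF assms(2)]
  show ?thesis
    using assms(3,4) by (intro is_linearI) (auto simp: cyclic_carrier mc opsI opsJ r_distr m_lcomm)
qed

text \<open>\<open>f\<close> is a class on \<open>R/J\<close>, tested on \<open>R/I\<close>. For
  \<open>r = 1\<close> this is restriction along a projection; a general \<open>r\<close> is needed
  where a power of a parameter makes a map factor.\<close>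

definition vanishes ::
    "('a, 'y, 'n) module_scheme \<Rightarrow> nat \<Rightarrow> 'a set \<Rightarrow> 'a set \<Rightarrow> 'a
       \<Rightarrow> ((('a, 'a set) basis_elem \<Rightarrow> 'a) \<Rightarrow> 'y) \<Rightarrow> bool" where
  "vanishes M i I J r f \<longleftrightarrow>
     ext_zero R (cyclic_module R I) (cyclic_module R J) M i (mult_map R J r) f"

abbreviation cyclic_cocycle ::
    "('a, 'y, 'n) module_scheme \<Rightarrow> nat \<Rightarrow> 'a set \<Rightarrow> ((('a, 'a set) basis_elem \<Rightarrow> 'a) \<Rightarrow> 'y) \<Rightarrow> bool" where
  "cyclic_cocycle M i I f \<equiv> cocycle R (std R (cyclic_module R I)) M i f"

abbreviation cyclic_coboundary ::
    "('a, 'y, 'n) module_scheme \<Rightarrow> nat \<Rightarrow> 'a set \<Rightarrow> ((('a, 'a set) basis_elem \<Rightarrow> 'a) \<Rightarrow> 'y) \<Rightarrow> bool" where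
  "cyclic_coboundary M i I f \<equiv> coboundary R (std R (cyclic_module R I)) M i f"

lemma mult_map_comp:
  assumes "ideal I R" "ideal J R" "ideal K R" "r \<in> carrier R" "s \<in> carrier R"
    "\<And>i. i \<in> J \<Longrightarrow> r \<otimes> i \<in> K" "\<And>i. i \<in> I \<Longrightarrow> s \<otimes> i \<in> J" "Y \<in> carrier (cyclic_module R I)"
  shows "mult_map R K (r \<otimes> s) Y = mult_map R K r (mult_map R J s Y)"
proof -
  obtain x where x: "x \<in> carrier R" "Y = I +> x" using assms(8) by (auto simp: cyclic_carrier)
  have "(r \<otimes> s) \<otimes> i \<in> K" if "i \<in> I" for i
    using assms(6)[OF assms(7)[OF that]] ideal_closed(2)[OF assms(1) that] assms(4,5)
    by (simp add: m_assoc)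
  then show ?thesis
    using assms x by (simp add: mult_map_coset[OF assms(1)] mult_map_coset[OF assms(2)] m_assoc)
qed

lemma vanishes_comp:
  assumes "ideal I R" "ideal J R" "ideal K R" "r \<in> carrier R" "s \<in> carrier R"
    "\<And>i. i \<in> J \<Longrightarrow> r \<otimes> i \<in> K" "\<And>i. i \<in> I \<Longrightarrow> s \<otimes> i \<in> J"
    and "vanishes M i J K r f"
  shows "vanishes M i I K (r \<otimes> s) f"
  unfolding vanishes_def
proof (rule ext_zero_cong[OF cyclic_is_module[OF assms(1)]])
  show "ext_zero R (cyclic_module R I) (cyclic_module R K) M i
      (\<lambda>x. mult_map R K r (mult_map R J s x)) f"
    by (rule ext_zero_comp[OF cyclic_is_module[OF assms(1)] cyclic_is_module[OF assms(2)]
        mult_map_linear[OF assms(1,2,5,7)] assms(8)[unfolded vanishes_def]])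
  fix Y assume "Y \<in> carrier (cyclic_module R I)"
  then show "mult_map R K (r \<otimes> s) Y = mult_map R K r (mult_map R J s Y)"
    using mult_map_comp[OF assms(1-7)] by blast
qed

lemma vanishes_self_iff:
  assumes "module R M" "ideal I R" "cyclic_cocycle M i I f"
  shows "vanishes M i I I \<one> f \<longleftrightarrow> cyclic_coboundary M i I f"
proof -
  have "mult_map R I \<one> Y = Y" if "Y \<in> carrier (cyclic_module R I)" for Y
    using that mult_map_coset[OF assms(2,2)] ideal_closed(2)[OF assms(2)]
    by (auto simp: cyclic_carrier)
  then have "vanishes M i I I \<one> f \<longleftrightarrow>
      ext_zero R (cyclic_module R I) (cyclic_module R I) M i (\<lambda>x. x) f"
    unfolding vanishes_def using ext_zero_cong[OF cyclic_is_module[OF assms(2)]] by metis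
  then show ?thesis using ext_zero_id[OF cyclic_is_module[OF assms(2)] assms(1,3)] by simp
qed

text \<open>Provides a cocycle representing the restricted class together with a rule for
  transferring every further vanishing test, so that lifts to resolutions need not be mentioned
  again.\<close>

lemma restrict_exists:
  assumes M: "module R M" and ideals: "ideal I R" "ideal J R"
    and r: "r \<in> carrier R" "\<And>i. i \<in> I \<Longrightarrow> r \<otimes> i \<in> J" and f: "cyclic_cocycle M i J f"
  obtains f' where "cyclic_cocycle M i I f'"
    and "\<And>K s. ideal K R \<Longrightarrow> s \<in> carrier R \<Longrightarrow> (\<And>i. i \<in> K \<Longrightarrow> s \<otimes> i \<in> I) \<Longrightarrow>
      vanishes M i K I s f' \<longleftrightarrow> vanishes M i K J (r \<otimes> s) f"
proof -
  have lin: "is_linear R (cyclic_module R I) (cyclic_module R J) (mult_map R J r)"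
    using mult_map_linear assms by blast
  obtain \<theta> where \<theta>: "chain_map R (std R (cyclic_module R I)) (std R (cyclic_module R J)) (mult_map R J r) \<theta>"
    using std_lift_exists[OF cyclic_is_module cyclic_is_module lin] ideals by blast
  have "vanishes M i K I s (\<lambda>v. f (\<theta> i v)) \<longleftrightarrow> vanishes M i K J (r \<otimes> s) f"
    if K: "ideal K R" "s \<in> carrier R" "\<And>i. i \<in> K \<Longrightarrow> s \<otimes> i \<in> I" for K s
  proof -
    have mK: "module R (cyclic_module R K)" by (rule cyclic_is_module[OF K(1)])
    have linK: "is_linear R (cyclic_module R K) (cyclic_module R I) (mult_map R I s)"
      using mult_map_linear[OF K(1) ideals(1) K(2)] K(3) by blast
    have eq: "mult_map R J (r \<otimes> s) Y = mult_map R J r (mult_map R I s Y)"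
      if "Y \<in> carrier (cyclic_module R K)" for Y
      using mult_map_comp[OF K(1) ideals r(1) K(2) _ _ that] r(2) K(3) by blast
    have "vanishes M i K I s (\<lambda>v. f (\<theta> i v)) \<longleftrightarrow>
      ext_zero R (cyclic_module R K) (cyclic_module R J) M i (\<lambda>Y. mult_map R J r (mult_map R I s Y)) f"
      unfolding vanishes_def
      by (rule ext_zero_pullback[OF mK cyclic_is_module cyclic_is_module M linK lin f \<theta>])
        (use ideals in auto)
    also have "\<dots> \<longleftrightarrow> vanishes M i K J (r \<otimes> s) f"
      unfolding vanishes_def
      by (rule iffI; erule ext_zero_cong[OF mK]) (simp_all add: eq)
    finally show ?thesis .
  qed
  then show ?thesis using that cocycle_pullback[OF \<theta> f] by blast
qed

text \<open>The long exact sequence of \<open>0 \<rightarrow> R/(I : a) \<rightarrow> R/I \<rightarrow> R/(I + (a)) \<rightarrow> 0\<close>, and its naturality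
  with respect to the analogous sequence for \<open>J \<subseteq> I\<close> and \<open>ac\<close>.\<close>

lemma adjoin_connecting:
  assumes M: "module R M" and I: "ideal I R" and a: "a \<in> carrier R"
    and f: "cyclic_cocycle M (Suc k) (adjoin R I a) f"
    and z: "vanishes M (Suc k) I (adjoin R I a) \<one> f"
  obtains e where "cyclic_cocycle M k (colon R I a) e"
    and "\<And>J c. ideal J R \<Longrightarrow> J \<subseteq> I \<Longrightarrow> c \<in> carrier R \<Longrightarrow>
      vanishes M k (colon R J (a \<otimes> c)) (colon R I a) c e \<Longrightarrow>
      vanishes M (Suc k) (adjoin R J (a \<otimes> c)) (adjoin R I a) \<one> f"
proof -
  have col: "mult_map R I b (colon R I b +> x) = I +> (b \<otimes> x)"
      "is_linear R (cyclic_module R (colon R I b)) (cyclic_module R I) (mult_map R I b)"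
    if "ideal I R" "b \<in> carrier R" "x \<in> carrier R" for I b x
  proof -
    have *: "b \<otimes> i \<in> I" if "i \<in> colon R I b" for i
      using that \<open>b \<in> carrier R\<close> by (auto simp: colon_def m_comm)
    show "mult_map R I b (colon R I b +> x) = I +> (b \<otimes> x)"
      using * that colon_ideal by (intro mult_map_coset) auto
    show "is_linear R (cyclic_module R (colon R I b)) (cyclic_module R I) (mult_map R I b)"
      using * that colon_ideal by (intro mult_map_linear) auto
  qed
  have sub: "mult_map R J \<one> (I +> x) = J +> x"
      "is_linear R (cyclic_module R I) (cyclic_module R J) (mult_map R J \<one>)"
    if "ideal I R" "ideal J R" "I \<subseteq> J" "x \<in> carrier R" for I J x
  proof -
    have *: "\<one> \<otimes> i \<in> J" if "i \<in> I" for i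
      using that \<open>I \<subseteq> J\<close> ideal_closed(2)[OF \<open>ideal I R\<close>] by auto
    show "mult_map R J \<one> (I +> x) = J +> x"
      using mult_map_coset[OF that(1,2) one_closed * that(4)] that(4) by simp
    show "is_linear R (cyclic_module R I) (cyclic_module R J) (mult_map R J \<one>)"
      using * that by (intro mult_map_linear) auto
  qed
  note adj = adjoin_ideal adjoin_superset
  have mod: "module R (cyclic_module R (colon R I a))" "module R (cyclic_module R I)"
      "module R (cyclic_module R (adjoin R I a))"
    using cyclic_is_module colon_ideal adjoin_ideal I a by auto
  have lin: "is_linear R (cyclic_module R (colon R I a)) (cyclic_module R I) (mult_map R I a)"
      "is_linear R (cyclic_module R I) (cyclic_module R (adjoin R I a)) (mult_map R (adjoin R I a) \<one>)"
    using col(2)[OF I a zero_closed] sub(2)[OF I adj[OF I a] zero_closed] by auto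
  have comp: "mult_map R (adjoin R I a) \<one> (mult_map R I a Y) = \<zero>\<^bsub>cyclic_module R (adjoin R I a)\<^esub>"
    if Y: "Y \<in> carrier (cyclic_module R (colon R I a))" for Y
  proof -
    obtain x where x: "x \<in> carrier R" "Y = colon R I a +> x" using Y by (auto simp: cyclic_carrier)
    have "a \<otimes> x \<in> adjoin R I a" using ideal_closed(5)[OF adj(1) adjoin_self] I a x by auto
    then show ?thesis
      using x I a col(1) sub(1)[OF I adj[OF I a]] coset_eq_ideal_iff[OF adj(1)]
      by (simp add: cyclic_ops(1)[OF adj(1) a a])
  qed
  obtain e where e: "connecting R (cyclic_module R (colon R I a)) (cyclic_module R I)
      (cyclic_module R (adjoin R I a)) (mult_map R I a) (mult_map R (adjoin R I a) \<one>) M k f e"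
    and ec: "cyclic_cocycle M k (colon R I a) e"
    using connecting_exists[OF mod M lin comp f z[unfolded vanishes_def]] by auto
  have "vanishes M (Suc k) (adjoin R J (a \<otimes> c)) (adjoin R I a) \<one> f"
    if J: "ideal J R" "J \<subseteq> I" and c: "c \<in> carrier R"
      and ze: "vanishes M k (colon R J (a \<otimes> c)) (colon R I a) c e" for J c
  proof -
    let ?b = "a \<otimes> c"
    have b: "?b \<in> carrier R" using a c by simp
    have sup: "adjoin R J ?b \<subseteq> adjoin R I a"
    proof (rule adjoin_least[OF adj(1)[OF I a]])
      show "J \<subseteq> adjoin R I a" using J adj(2)[OF I a] by blast
      show "?b \<in> adjoin R I a" by (rule ideal_closed(5)[OF adj(1)[OF I a] adjoin_self[OF I a] c])
    qed
    have cc: "c \<otimes> i \<in> colon R I a" if "i \<in> colon R J ?b" for i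
      using that J(2) a c by (auto simp: colon_def m_ac)
    have modJ: "module R (cyclic_module R (colon R J ?b))" "module R (cyclic_module R J)"
      "module R (cyclic_module R (adjoin R J ?b))"
      using cyclic_is_module colon_ideal adjoin_ideal J b by auto
    have linJ: "is_linear R (cyclic_module R (colon R J ?b)) (cyclic_module R J) (mult_map R J ?b)"
      "is_linear R (cyclic_module R J) (cyclic_module R (adjoin R J ?b)) (mult_map R (adjoin R J ?b) \<one>)"
      using col(2)[OF J(1) b zero_closed] sub(2)[OF J(1) adj[OF J(1) b] zero_closed] by auto
    \<comment> \<open>The morphism of short exact sequences: multiplication by \<open>c\<close> on
      the left, projections elsewhere. The left square commutes because
      \<open>(ac)x = a(cx)\<close>.\<close>
    have vert: "is_linear R (cyclic_module R (colon R J ?b)) (cyclic_module R (colon R I a))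
          (mult_map R (colon R I a) c)"
        "is_linear R (cyclic_module R J) (cyclic_module R I) (mult_map R I \<one>)"
        "is_linear R (cyclic_module R (adjoin R J ?b)) (cyclic_module R (adjoin R I a))
          (mult_map R (adjoin R I a) \<one>)"
      using mult_map_linear[OF colon_ideal[OF J(1) b] colon_ideal[OF I a] c cc]
        sub(2)[OF J(1) I J(2) zero_closed]
        sub(2)[OF adj(1)[OF J(1) b] adj(1)[OF I a] sup zero_closed] by auto
    show ?thesis unfolding vanishes_def
    proof (rule connecting_natural[OF mod M modJ lin linJ _ _ _ vert _ _ f e ec ze[unfolded vanishes_def]])
      fix Y assume Y: "Y \<in> carrier (cyclic_module R (colon R J ?b))"
      then obtain x where x: "x \<in> carrier R" "Y = colon R J ?b +> x" by (auto simp: cyclic_carrier)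
      \<comment> \<open>Dividing by the colon ideal is exactly what makes multiplication by
        \<open>ac\<close> injective.\<close>
      show "Y = \<zero>\<^bsub>cyclic_module R (colon R J ?b)\<^esub>"
        if "mult_map R J ?b Y = \<zero>\<^bsub>cyclic_module R J\<^esub>"
      proof -
        have "?b \<otimes> x \<in> J"
          using that x col(1)[OF J(1) b x(1)] coset_eq_ideal_iff[OF J(1)] b
          by (simp add: cyclic_ops(1)[OF J(1) a a])
        then have "x \<in> colon R J ?b" using x b by (simp add: colon_def m_comm)
        then show ?thesis
          using x coset_eq_ideal_iff[OF colon_ideal[OF J(1) b] x(1)]
          by (simp add: cyclic_ops(1)[OF colon_ideal[OF J(1) b] a a])
      qed
      show "mult_map R I \<one> (mult_map R J ?b Y) = mult_map R I a (mult_map R (colon R I a) c Y)"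
        using x col(1)[OF J(1) b x(1)] sub(1)[OF J(1) I J(2)] b a c col(1)[OF I a]
          mult_map_coset[OF colon_ideal[OF J(1) b] colon_ideal[OF I a] c cc x(1)]
        by (simp add: m_assoc)
    next
      have s: "mult_map R (adjoin R J ?b) \<one> (J +> x) = adjoin R J ?b +> x" if "x \<in> carrier R" for x
        using sub(1)[OF J(1) adj[OF J(1) b] that] .
      then show "mult_map R (adjoin R J ?b) \<one> ` carrier (cyclic_module R J)
          = carrier (cyclic_module R (adjoin R J ?b))"
        by (auto simp: cyclic_carrier image_image)
      fix Y assume "Y \<in> carrier (cyclic_module R J)"
      then obtain x where x: "x \<in> carrier R" "Y = J +> x" by (auto simp: cyclic_carrier)
      show "mult_map R (adjoin R I a) \<one> (mult_map R (adjoin R J ?b) \<one> Y)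
          = mult_map R (adjoin R I a) \<one> (mult_map R I \<one> Y)"
        using x s sub(1)[OF J(1) I J(2)] sub(1)[OF adj(1)[OF J(1) b] adj(1)[OF I a] sup]
          sub(1)[OF I adj[OF I a]] by simp
      have "mult_map R (adjoin R J ?b) \<one> Y = \<zero>\<^bsub>cyclic_module R (adjoin R J ?b)\<^esub>
          \<longleftrightarrow> x \<in> adjoin R J ?b"
        using x s coset_eq_ideal_iff[OF adj(1)[OF J(1) b] x(1)]
        by (simp add: cyclic_ops(1)[OF adj(1)[OF J(1) b] a a])
      \<comment> \<open>Exactness in the middle: modulo \<open>J\<close>, the elements of
        \<open>J + (ac)\<close> are the multiples of \<open>ac\<close>.\<close>
      also have "\<dots> \<longleftrightarrow> (\<exists>r\<in>carrier R. J +> x = J +> (?b \<otimes> r))"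
      proof
        assume "x \<in> adjoin R J ?b"
        then obtain i r where ir: "i \<in> J" "r \<in> carrier R" "x = i \<oplus> r \<otimes> ?b" by (auto simp: adjoin_def)
        have "x \<ominus> ?b \<otimes> r = i"
          using ir b ideal_closed(2)[OF J(1)] by (simp add: m_comm a_minus_def a_assoc r_neg)
        then show "\<exists>r\<in>carrier R. J +> x = J +> (?b \<otimes> r)"
          using coset_eq_iff[OF J(1) x(1), of "?b \<otimes> r"] ir b by auto
      next
        assume "\<exists>r\<in>carrier R. J +> x = J +> (?b \<otimes> r)"
        then obtain r where r: "r \<in> carrier R" "J +> x = J +> (?b \<otimes> r)" by blast
        have "x \<in> J +> (?b \<otimes> r)" using coset_self[OF J(1) x(1)] r by simp
        then show "x \<in> adjoin R J ?b"
          using r b by (auto simp: a_r_coset_def' adjoin_def m_comm)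
      qed
      also have "\<dots> \<longleftrightarrow> Y \<in> mult_map R J ?b ` carrier (cyclic_module R (colon R J ?b))"
        using x col(1)[OF J(1) b] by (auto simp: cyclic_carrier image_image)
      finally show "mult_map R (adjoin R J ?b) \<one> Y = \<zero>\<^bsub>cyclic_module R (adjoin R J ?b)\<^esub>
          \<longleftrightarrow> Y \<in> mult_map R J ?b ` carrier (cyclic_module R (colon R J ?b))" .
    qed
  qed
  then show ?thesis using that ec by blast
qed

text \<open>\<open>R/0\<close> is free on the class of 1, so sending that class to the basis vector
  over it gives a section of the augmentation.\<close>

lemma free_cyclic_coboundary:
  assumes "module R M" "cyclic_cocycle M (Suc i) {\<zero>} f"
  shows "cyclic_coboundary M (Suc i) {\<zero>} f"
proof -
  let ?N = "cyclic_module R {\<zero>}" and ?u = "basis_vec R (Gen ({\<zero>} +> \<one>))"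
  have id: "ideal {\<zero>} R" by (rule zeroideal)
  have N: "module R ?N" by (rule cyclic_is_module[OF id])
  interpret F: module R "std_res R ?N 0" by (rule std_res_module)
  have cos: "{\<zero>} +> x = {x}" if "x \<in> carrier R" for x
    using that by (auto simp: a_r_coset_def')
  \<comment> \<open>Cosets of the zero ideal are singletons, so \<open>the_elem\<close> recovers the
    ring element.\<close>
  define sec where "sec = (\<lambda>Y. the_elem Y \<odot>\<^bsub>std_res R ?N 0\<^esub> ?u)"
  have u: "?u \<in> carrier (std_res R ?N 0)"
    unfolding std_res_def by (rule basis_vec_closed) (auto simp: cyclic_carrier)
  have sec: "sec ({\<zero>} +> x) = x \<odot>\<^bsub>std_res R ?N 0\<^esub> ?u" if "x \<in> carrier R" for x
    using cos[OF that] by (simp add: sec_def)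
  have "augmentation R ?N ?u = {\<zero>} +> \<one>"
    by (rule augmentation_basis_vec[OF N]) (auto simp: cyclic_carrier)
  then have aug: "augmentation R ?N (sec ({\<zero>} +> x)) = {\<zero>} +> x" if "x \<in> carrier R" for x
    using is_linear_smult[OF augmentation_linear[OF N] that u] that cyclic_ops(3)[OF id that one_closed]
    by (simp add: sec)
  have lin: "is_linear R ?N (std_res R ?N 0) sec"
    using u by (intro is_linearI)
      (auto simp: cyclic_carrier sec cyclic_ops[OF id] F.smult_l_distr F.smult_assoc1)
  show ?thesis
    by (rule coboundary_of_section[OF N assms(1) lin _ assms(2)]) (use aug in \<open>auto simp: cyclic_carrier\<close>)
qed

text \<open>The exponents are independent, because the effacement argument raises the exponent of
  the head while the ideal for the tail shrinks in its own way. The exponent 0 is allowed and gives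
  the whole ring.\<close>

primrec power_ideals :: "'a list \<Rightarrow> 'a set set" where
  "power_ideals [] = {{\<zero>}}"
| "power_ideals (y # ys) = {adjoin R I (y [^] (s::nat)) | I s. I \<in> power_ideals ys}"

lemma power_ideals_ideal:
  "set ys \<subseteq> carrier R \<Longrightarrow> I \<in> power_ideals ys \<Longrightarrow> ideal I R"
  by (induction ys arbitrary: I) (auto intro!: adjoin_ideal simp: zeroideal)

text \<open>A prime containing a power contains the base, so raising exponents adds no new primes
  above the ideal.\<close>

lemma power_ideals_prime:
  "set ys \<subseteq> carrier R \<Longrightarrow> I \<in> power_ideals ys \<Longrightarrow> primeideal Q R \<Longrightarrow> I \<subseteq> Q \<Longrightarrow> set ys \<subseteq> Q"
proof (induction ys arbitrary: I)
  case (Cons y ys)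
  then obtain J s where J: "J \<in> power_ideals ys" "I = adjoin R J (y [^] (s::nat))" by auto
  have JR: "ideal J R" using power_ideals_ideal J Cons.prems by auto
  have "J \<subseteq> Q" "y [^] s \<in> Q"
    using adjoin_superset[OF JR] adjoin_self[OF JR] J Cons.prems by auto
  then show ?case using Cons J prime_pow[of Q y s] by auto
qed simp

lemma power_ideals_nonempty:
  "set ys \<subseteq> carrier R \<Longrightarrow> ideal K R \<Longrightarrow> set ys \<subseteq> K \<Longrightarrow> \<exists>I\<in>power_ideals ys. I \<subseteq> K"
proof (induction ys)
  case Nil
  then show ?case using ideal_closed(1) by auto
next
  case (Cons y ys)
  then obtain I where "I \<in> power_ideals ys" "I \<subseteq> K" by auto
  then have "adjoin R I (y [^] (1::nat)) \<in> power_ideals (y # ys)" "adjoin R I (y [^] (1::nat)) \<subseteq> K"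
    unfolding power_ideals.simps using Cons.prems adjoin_least[of K I y] by (blast, simp)
  then show ?case by blast
qed

end

text \<open>An elementwise form of the vanishing of local cohomology in degrees above the number of
  parameters.\<close>

lemma (in noetherian_cring) power_ideals_effaceable:
  assumes M: "module R M" and "set ys \<subseteq> carrier R" "I \<in> power_ideals ys" "i > length ys"
    and "cyclic_cocycle M i I f"
  shows "\<exists>J\<in>power_ideals ys. J \<subseteq> I \<and> vanishes M i J I \<one> f"
  using assms(2-)
proof (induction ys arbitrary: I i f)
  \<comment> \<open>Without parameters the module is \<open>R/0\<close>, which is free, and the
    degree is positive.\<close>
  case Nil
  then obtain i' where "i = Suc i'" "I = {\<zero>}" by (cases i) auto
  then show ?case
    using Nil vanishes_self_iff[OF M zeroideal] free_cyclic_coboundary[OF M] by auto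
next
  case (Cons y ys)
  then obtain k where i: "i = Suc k" and k: "k > length ys" by (cases i) auto
  from Cons.prems obtain K s where K: "K \<in> power_ideals ys" and I: "I = adjoin R K (y [^] (s::nat))"
    by auto
  define a where "a = y [^] s"
  have ys: "set ys \<subseteq> carrier R" and y: "y \<in> carrier R" and a: "a \<in> carrier R"
    using Cons.prems by (auto simp: a_def)
  note ideal_fam = power_ideals_ideal[OF ys]
  have KR: "ideal K R" and IR: "ideal I R"
    using ideal_fam[OF K] adjoin_ideal a by (auto simp: I a_def)
  have KI: "K \<subseteq> I" and aI: "a \<in> I" using adjoin_superset[OF KR a] adjoin_self[OF KR a] by (auto simp: I a_def)
  \<comment> \<open>\<open>K\<close> omits the head parameter, so the induction hypothesis applies
    to the restriction of \<open>f\<close> to \<open>R/K\<close>.\<close>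
  obtain f0 where f0: "cyclic_cocycle M i K f0"
    and f0': "\<And>L s. ideal L R \<Longrightarrow> s \<in> carrier R \<Longrightarrow> (\<And>x. x \<in> L \<Longrightarrow> s \<otimes> x \<in> K) \<Longrightarrow>
      vanishes M i L K s f0 \<longleftrightarrow> vanishes M i L I (\<one> \<otimes> s) f"
    using restrict_exists[OF M KR IR one_closed one_mult_mem[OF KI KR] Cons.prems(4)] by blast
  obtain J1 where J1: "J1 \<in> power_ideals ys" "J1 \<subseteq> K" "vanishes M i J1 K \<one> f0"
    using Cons.IH[OF ys K _ f0] k i by auto
  have J1R: "ideal J1 R" by (rule ideal_fam[OF J1(1)])
  have z1: "vanishes M i J1 I \<one> f"
    using f0'[OF J1R one_closed one_mult_mem[OF J1(2) J1R]] J1(3) by simp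
  have AR: "ideal (adjoin R J1 a) R" by (rule adjoin_ideal[OF J1R a])
  have AI: "adjoin R J1 a \<subseteq> I" using adjoin_least[OF IR _ aI] J1(2) KI by blast
  \<comment> \<open>The class dies on \<open>J1\<close>, which may be smaller than \<open>K\<close>;
    to use the exact sequence it has to be viewed on \<open>J1 + (a)\<close>.\<close>
  obtain f1 where f1: "cyclic_cocycle M i (adjoin R J1 a) f1"
    and f1': "\<And>L s. ideal L R \<Longrightarrow> s \<in> carrier R \<Longrightarrow> (\<And>x. x \<in> L \<Longrightarrow> s \<otimes> x \<in> adjoin R J1 a) \<Longrightarrow>
      vanishes M i L (adjoin R J1 a) s f1 \<longleftrightarrow> vanishes M i L I (\<one> \<otimes> s) f"
    using restrict_exists[OF M AR IR one_closed one_mult_mem[OF AI AR] Cons.prems(4)] by blast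
  have z1': "vanishes M i J1 (adjoin R J1 a) \<one> f1"
    using f1'[OF J1R one_closed one_mult_mem[OF adjoin_superset[OF J1R a] J1R]] z1 by simp
  obtain e where e: "cyclic_cocycle M k (colon R J1 a) e"
    and e': "\<And>J c. ideal J R \<Longrightarrow> J \<subseteq> J1 \<Longrightarrow> c \<in> carrier R \<Longrightarrow>
      vanishes M k (colon R J (a \<otimes> c)) (colon R J1 a) c e \<Longrightarrow>
      vanishes M (Suc k) (adjoin R J (a \<otimes> c)) (adjoin R J1 a) \<one> f1"
    using adjoin_connecting[OF M J1R a f1[unfolded i] z1'[unfolded i]] by blast
  have CR: "ideal (colon R J1 a) R" by (rule colon_ideal[OF J1R a])
  \<comment> \<open>The ideal \<open>(J1 : a)\<close> need not belong to the family, so the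
    induction hypothesis, in degree one less, is applied on \<open>J1\<close> instead.\<close>
  obtain e0 where e0: "cyclic_cocycle M k J1 e0"
    and e0': "\<And>L s. ideal L R \<Longrightarrow> s \<in> carrier R \<Longrightarrow> (\<And>x. x \<in> L \<Longrightarrow> s \<otimes> x \<in> J1) \<Longrightarrow>
      vanishes M k L J1 s e0 \<longleftrightarrow> vanishes M k L (colon R J1 a) (\<one> \<otimes> s) e"
    using restrict_exists[OF M J1R CR one_closed one_mult_mem[OF colon_superset[OF J1R a] J1R] e] by blast
  obtain J2 where J2: "J2 \<in> power_ideals ys" "J2 \<subseteq> J1" "vanishes M k J2 J1 \<one> e0"
    using Cons.IH[OF ys J1(1) k e0] by blast
  have J2R: "ideal J2 R" by (rule ideal_fam[OF J2(1)])
  have z2: "vanishes M k J2 (colon R J1 a) \<one> e"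
    using e0'[OF J2R one_closed one_mult_mem[OF J2(2) J2R]] J2(3) by simp
  \<comment> \<open>\<open>N\<close> is chosen after \<open>J2\<close>; with \<open>c = y^N\<close>
    the product \<open>ac\<close> is again a power of \<open>y\<close>, so \<open>J2 + (ac)\<close>
    stays in the family.\<close>
  obtain N :: nat where N: "\<And>(s::nat) r. r \<in> carrier R \<Longrightarrow> r \<otimes> y [^] (N + s) \<in> J2 \<Longrightarrow> r \<otimes> y [^] N \<in> J2"
    using colon_power_stable[OF J2R y] by blast
  define c where "c = y [^] N"
  have c: "c \<in> carrier R" using y by (simp add: c_def)
  have ac: "a \<otimes> c = y [^] (N + s)" using y by (simp add: a_def c_def nat_pow_mult add.commute)
  have acR: "a \<otimes> c \<in> carrier R" using a c by simp
  have mult_c: "c \<otimes> x \<in> J2" if "x \<in> colon R J2 (a \<otimes> c)" for x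
    using that N[of x s] c m_comm[of c x] by (auto simp: colon_def ac c_def[symmetric])
  \<comment> \<open>By stability \<open>c\<close> carries \<open>(J2 : ac)\<close> into
    \<open>J2\<close>, so multiplication by \<open>c\<close> passes through \<open>R/J2\<close>,
    where \<open>e\<close> is already zero.\<close>
  have "vanishes M k (colon R J2 (a \<otimes> c)) (colon R J1 a) (\<one> \<otimes> c) e"
    using colon_superset[OF J1R a] J2(2)
    by (intro vanishes_comp[OF colon_ideal[OF J2R acR] J2R CR one_closed c _ mult_c z2] one_mult_mem[OF _ J2R])
      auto
  then have "vanishes M (Suc k) (adjoin R J2 (a \<otimes> c)) (adjoin R J1 a) \<one> f1"
    using e'[OF J2R J2(2) c] c by simp
  moreover have "adjoin R J2 (a \<otimes> c) \<subseteq> adjoin R J1 a"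
    using J2(2) adjoin_superset[OF J1R a] ideal_closed(5)[OF AR adjoin_self[OF J1R a] c]
    by (intro adjoin_least[OF AR]) auto
  moreover have "ideal (adjoin R J2 (a \<otimes> c)) R" by (rule adjoin_ideal[OF J2R acR])
  ultimately have "vanishes M i (adjoin R J2 (a \<otimes> c)) I \<one> f"
    using f1'[OF _ one_closed one_mult_mem] i by simp
  moreover have "adjoin R J2 (a \<otimes> c) \<in> power_ideals (y # ys)" using J2(1) by (auto simp: ac)
  moreover have "adjoin R J2 (a \<otimes> c) \<subseteq> I"
    using \<open>adjoin R J2 (a \<otimes> c) \<subseteq> adjoin R J1 a\<close> AI by blast
  ultimately show ?case by blast
qed

section \<open>The step from degree n to degree n + 1\<close>

context noetherian_local_ring
begin

text \<open>Let \<open>J\<close> be maximal among the ideals between \<open>I\<close> and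
  \<open>m\<close> on which the class dies. If \<open>J\<close> were not \<open>m\<close>, the class
  on \<open>J + (a)\<close> would come from a class on \<open>R/(J : a) = R/m\<close> in degree n,
  which is zero; so it would die on \<open>J + (a)\<close> too.\<close>

lemma coboundary_of_primary_restriction:
  assumes M: "module R M" and van: "\<And>e. cyclic_cocycle M n m e \<Longrightarrow> cyclic_coboundary M n m e"
    and f: "cyclic_cocycle M (Suc n) m f"
    and I: "ideal I R" "I \<subseteq> m" "\<And>Q. primeideal Q R \<Longrightarrow> I \<subseteq> Q \<Longrightarrow> Q = m"
      "vanishes M (Suc n) I m \<one> f"
  shows "cyclic_coboundary M (Suc n) m f"
proof -
  have mR: "ideal m R" by (rule prime_ideal[OF m_prime])
  define Q where "Q = (\<lambda>J. J \<subseteq> m \<and> I \<subseteq> J \<and> vanishes M (Suc n) J m \<one> f)"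
  have "Q I" using I by (simp add: Q_def)
  with I(1) obtain J where J: "ideal J R" "Q J"
    and max: "\<And>J'. ideal J' R \<Longrightarrow> Q J' \<Longrightarrow> J \<subseteq> J' \<Longrightarrow> J' = J"
    by (rule noetherian_max_ideal[where Q = Q]) blast+
  have Jm: "J \<subseteq> m" and IJ: "I \<subseteq> J" and zJ: "vanishes M (Suc n) J m \<one> f" using J(2) by (auto simp: Q_def)
  have "J = m"
  proof (rule ccontr)
    assume "J \<noteq> m"
    have "J \<noteq> carrier R"
      using Jm primeideal.I_notcarr[OF m_prime] ideal_closed(2)[OF mR] by blast
    then obtain a where a: "a \<in> carrier R" "a \<notin> J" "primeideal (colon R J a) R"
      using maximal_colon_prime[OF J(1)] by blast
    have col: "colon R J a = m"
      using I(3)[OF a(3)] IJ colon_superset[OF J(1) a(1)] by blast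
    \<comment> \<open>Otherwise \<open>J + (a)\<close> is the whole ring, and writing 1 as
      \<open>i + ra\<close> with \<open>i\<close> in \<open>J\<close> and \<open>m a\<close> inside
      \<open>J\<close> gives \<open>m\<close> inside \<open>J\<close>.\<close>
    have am: "a \<in> m"
    proof (rule ccontr)
      assume "a \<notin> m"
      then have "adjoin R J a = carrier R"
        using local[OF adjoin_ideal[OF J(1) a(1)]] adjoin_self[OF J(1) a(1)] by blast
      then have "\<one> \<in> adjoin R J a" by simp
      then obtain i r where ir: "i \<in> J" "r \<in> carrier R" "\<one> = i \<oplus> r \<otimes> a"
        by (auto simp: adjoin_def)
      have "m \<subseteq> J"
      proof
        fix x assume x: "x \<in> m"
        then have xR: "x \<in> carrier R" "x \<otimes> a \<in> J" using col by (auto simp: colon_def)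
        have iR: "i \<in> carrier R" using ir(1) ideal_closed(2)[OF J(1)] by blast
        have "x = x \<otimes> (i \<oplus> r \<otimes> a)" using xR by (simp add: ir(3)[symmetric])
        also have "\<dots> = x \<otimes> i \<oplus> r \<otimes> (x \<otimes> a)" using xR iR ir a(1) by (simp add: r_distr m_lcomm)
        also have "\<dots> \<in> J" using xR ir ideal_closed[OF J(1)] by simp
        finally show "x \<in> J" .
      qed
      then show False using Jm \<open>J \<noteq> m\<close> by blast
    qed
    have AR: "ideal (adjoin R J a) R" by (rule adjoin_ideal[OF J(1) a(1)])
    have Am: "adjoin R J a \<subseteq> m" by (rule adjoin_least[OF mR Jm am])
    note JA = adjoin_superset[OF J(1) a(1)]
    obtain f1 where f1: "cyclic_cocycle M (Suc n) (adjoin R J a) f1"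
      and f1': "\<And>L s. ideal L R \<Longrightarrow> s \<in> carrier R \<Longrightarrow> (\<And>x. x \<in> L \<Longrightarrow> s \<otimes> x \<in> adjoin R J a) \<Longrightarrow>
        vanishes M (Suc n) L (adjoin R J a) s f1 \<longleftrightarrow> vanishes M (Suc n) L m (\<one> \<otimes> s) f"
      using restrict_exists[OF M AR mR one_closed one_mult_mem[OF Am AR] f] by blast
    have z1: "vanishes M (Suc n) J (adjoin R J a) \<one> f1"
      using f1'[OF J(1) one_closed one_mult_mem[OF JA J(1)]] zJ by simp
    obtain e where e: "cyclic_cocycle M n (colon R J a) e"
      and e': "\<And>J' c. ideal J' R \<Longrightarrow> J' \<subseteq> J \<Longrightarrow> c \<in> carrier R \<Longrightarrow>
        vanishes M n (colon R J' (a \<otimes> c)) (colon R J a) c e \<Longrightarrow>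
        vanishes M (Suc n) (adjoin R J' (a \<otimes> c)) (adjoin R J a) \<one> f1"
      using adjoin_connecting[OF M J(1) a(1) f1 z1] by blast
    have "vanishes M n m m \<one> e"
      using vanishes_self_iff[OF M mR] van e unfolding col by blast
    \<comment> \<open>Naturality is used here with \<open>J' = J\<close> and \<open>c = 1\<close>,
      where it is exactness of the long sequence.\<close>
    then have "vanishes M (Suc n) (adjoin R J a) (adjoin R J a) \<one> f1"
      using e'[OF J(1) order_refl one_closed] a(1) col by simp
    then have "vanishes M (Suc n) (adjoin R J a) m \<one> f"
      using f1'[OF AR one_closed one_mult_mem[OF order_refl AR]] by simp
    then have "Q (adjoin R J a)" using Am JA IJ by (auto simp: Q_def)
    then have "adjoin R J a = J" using max[OF AR] JA by blast
    then show False using adjoin_self[OF J(1) a(1)] a(2) by blast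
  qed
  then show ?thesis using zJ vanishes_self_iff[OF M mR f] by simp
qed

text \<open>The parameters yield an ideal over which \<open>m\<close> is the only prime and on which
  the class in degree n + 1 dies, as that degree exceeds their number; the climb brings this back up
  to \<open>m\<close>.\<close>

theorem residue_field_rigidity_step:
  assumes M: "module R M" and dim: "krull_dim R \<le> enat n"
    and van: "\<And>e. cyclic_cocycle M n m e \<Longrightarrow> cyclic_coboundary M n m e"
    and f: "cyclic_cocycle M (Suc n) m f"
  shows "cyclic_coboundary M (Suc n) m f"
proof -
  have mR: "ideal m R" by (rule prime_ideal[OF m_prime])
  obtain ys where ys: "length ys = n" "set ys \<subseteq> m" "\<And>Q. primeideal Q R \<Longrightarrow> set ys \<subseteq> Q \<Longrightarrow> Q = m"
    using system_of_parameters[OF dim] by blast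
  have ysR: "set ys \<subseteq> carrier R" using ys(2) ideal_closed(2)[OF mR] by blast
  obtain I where I: "I \<in> power_ideals ys" "I \<subseteq> m" using power_ideals_nonempty[OF ysR mR ys(2)] by blast
  have IR: "ideal I R" by (rule power_ideals_ideal[OF ysR I(1)])
  \<comment> \<open>Effacement starts from a member of the family, so the class on
    \<open>R/m\<close> is moved to one lying inside \<open>m\<close>.\<close>
  obtain f0 where f0: "cyclic_cocycle M (Suc n) I f0"
    and f0': "\<And>L s. ideal L R \<Longrightarrow> s \<in> carrier R \<Longrightarrow> (\<And>x. x \<in> L \<Longrightarrow> s \<otimes> x \<in> I) \<Longrightarrow>
      vanishes M (Suc n) L I s f0 \<longleftrightarrow> vanishes M (Suc n) L m (\<one> \<otimes> s) f"
    using restrict_exists[OF M IR mR one_closed one_mult_mem[OF I(2) IR] f] by blast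
  obtain J where J: "J \<in> power_ideals ys" "J \<subseteq> I" "vanishes M (Suc n) J I \<one> f0"
    using power_ideals_effaceable[OF M ysR I(1) _ f0] ys(1) by auto
  have JR: "ideal J R" by (rule power_ideals_ideal[OF ysR J(1)])
  have "vanishes M (Suc n) J m \<one> f" using f0'[OF JR one_closed one_mult_mem[OF J(2) JR]] J(3) by simp
  moreover have "Q = m" if "primeideal Q R" "J \<subseteq> Q" for Q
    using ys(3)[OF that(1)] power_ideals_prime[OF ysR J(1) that] by blast
  ultimately show ?thesis
    using coboundary_of_primary_restriction[OF M van f JR] J(2) I(2) by blast
qed

end

section \<open>Triviality of Ext\<close>

text \<open>\<open>Ext\<close> is built from extensional functions so that cochains form a group;
  the arguments above use plain functions, which compose without restriction. This and the next
  lemma translate between the two.\<close>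

lemma linear_maps_iff:
  "f \<in> linear_maps A N M \<longleftrightarrow> f \<in> extensional (carrier N) \<and> is_linear A N M f"
  by (auto simp: linear_maps_def is_linear_def PiE_def)

lemma restrict_linear_maps:
  assumes "module A N" "is_linear A N M f"
  shows "restrict f (carrier N) \<in> linear_maps A N M"
proof -
  interpret N: module A N by fact
  show ?thesis using assms(2) by (auto simp: linear_maps_def is_linear_def)
qed

context cring
begin

lemma Ext_cocycles_iff:
  "f \<in> Ext_cocycles R i N M \<longleftrightarrow>
     f \<in> extensional (carrier (std_res R N i)) \<and> cocycle R (std R N) M i f"
  by (auto simp: Ext_cocycles_def linear_maps_iff cocycle_def)

lemma cocycle_restrict:
  assumes N: "module R N" and f: "cocycle R (std R N) M i f"
  shows "restrict f (carrier (std_res R N i)) \<in> Ext_cocycles R i N M"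
proof -
  interpret N: resolution R "std R N" by (rule std_resolution[OF N])
  show ?thesis
    using f restrict_linear_maps[OF std_res_module] N.dif_closed[of _ i]
    by (auto simp: Ext_cocycles_def cocycle_def)
qed

lemma Ext_coboundaries_iff:
  assumes N: "module R N" and M: "module R M"
  shows "f \<in> Ext_coboundaries R i N M \<longleftrightarrow>
     f \<in> extensional (carrier (std_res R N i)) \<and> coboundary R (std R N) M i f"
proof -
  interpret N: resolution R "std R N" by (rule std_resolution[OF N])
  show ?thesis
  proof (cases i)
    case 0
    then show ?thesis by (auto simp: Ext_coboundaries_def intro!: extensionalityI)
  next
    case (Suc k)
    note dc = N.dif_closed[of _ k, simplified]
    show ?thesis
    proof
      assume "f \<in> Ext_coboundaries R i N M"
      then obtain g where "g \<in> linear_maps R (std_res R N k) M"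
        "f = (\<lambda>v\<in>carrier (std_res R N (Suc k)). g (differential R v))"
        by (auto simp: Ext_coboundaries_def Suc)
      then show "f \<in> extensional (carrier (std_res R N i)) \<and> coboundary R (std R N) M i f"
        by (auto simp: Suc coboundary_Suc linear_maps_iff)
    next
      assume f: "f \<in> extensional (carrier (std_res R N i)) \<and> coboundary R (std R N) M i f"
      then obtain g where g: "is_linear R (std_res R N k) M g"
        "\<And>v. v\<in>carrier (std_res R N (Suc k)) \<Longrightarrow> f v = g (differential R v)"
        by (auto simp: Suc coboundary_Suc)
      define g' where "g' = restrict g (carrier (std_res R N k))"
      have "g' \<in> linear_maps R (std_res R N k) M"
        unfolding g'_def by (rule restrict_linear_maps[OF std_res_module g(1)])
      moreover have "f = (\<lambda>v\<in>carrier (std_res R N (Suc k)). g' (differential R v))"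
        using f g(2) dc by (intro extensionalityI[of _ "carrier (std_res R N (Suc k))"])
          (auto simp: Suc g'_def)
      ultimately show "f \<in> Ext_coboundaries R i N M"
        by (auto simp: Ext_coboundaries_def Suc)
    qed
  qed
qed

lemma coboundary_is_cocycle:
  assumes N: "module R N" and M: "module R M" and f: "coboundary R (std R N) M i f"
  shows "cocycle R (std R N) M i f"
proof -
  interpret N: resolution R "std R N" by (rule std_resolution[OF N])
  show ?thesis
  proof (cases i)
    case 0
    then have f0: "f v = \<zero>\<^bsub>M\<^esub>" if "v \<in> carrier (std_res R N 0)" for v using f that by simp
    have "is_linear R (std_res R N 0) M f"
      by (rule is_linear_cong[OF is_linear_zero_map[OF M] std_res_module f0])
    then show ?thesis using f0 N.dif_closed[of _ 0] by (simp add: cocycle_def 0)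
  next
    case (Suc k)
    obtain g where g: "is_linear R (std_res R N k) M g"
      "\<And>v. v\<in>carrier (std_res R N (Suc k)) \<Longrightarrow> f v = g (differential R v)"
      using f by (auto simp: Suc coboundary_Suc)
    have "is_linear R (std_res R N (Suc k)) M f"
      by (rule is_linear_cong[OF is_linear_comp[OF differential_linear g(1)] std_res_module g(2)])
    moreover have "f (differential R v) = \<zero>\<^bsub>M\<^esub>" if "v \<in> carrier (std_res R N (Suc (Suc k)))" for v
      using g N.dif_closed[of v "Suc k"] N.dif_dif[of v k] that
        is_linear_zero[OF std_res_module M g(1)] by simp
    ultimately show ?thesis by (simp add: cocycle_def Suc)
  qed
qed

lemma cocycle_group:
  fixes N :: "('a, 'x) module"
  assumes N: "module R N" and M: "module R M"
  shows "group ((hom_group R (std_res R N i) M)\<lparr>carrier := Ext_cocycles R i N M\<rparr>)" (is "group ?H")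
proof -
  interpret M: module R M by fact
  interpret N: resolution R "std R N" by (rule std_resolution[OF N])
  interpret F: module R "std_res R N i" by (rule std_res_module)
  let ?F = "carrier (std_res R N i)"
  note dc = N.dif_closed[of _ i, simplified]
  have lin: "is_linear R (std_res R N i) M f" if "f \<in> Ext_cocycles R i N M" for f
    using that by (simp add: Ext_cocycles_iff cocycle_def)
  note cl = is_linear_closed[OF lin]
  have ext: "f \<in> extensional ?F" if "f \<in> Ext_cocycles R i N M" for f
    using that by (simp add: Ext_cocycles_iff)
  have zero: "f (differential R v) = \<zero>\<^bsub>M\<^esub>"
    if "f \<in> Ext_cocycles R i N M" "v \<in> carrier (std_res R N (Suc i))" for f v
    using that by (simp add: Ext_cocycles_iff cocycle_def)
  have mem: "restrict f ?F \<in> Ext_cocycles R i N M"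
    if "is_linear R (std_res R N i) M f"
      "\<And>v. v\<in>carrier (std_res R N (Suc i)) \<Longrightarrow> f (differential R v) = \<zero>\<^bsub>M\<^esub>" for f
    using that cocycle_restrict[OF N, of M i f] by (simp add: cocycle_def)
  show ?thesis
  proof (rule groupI)
    show "\<one>\<^bsub>?H\<^esub> \<in> carrier ?H"
      using mem[OF is_linear_zero_map[OF M]] by (simp add: hom_group_def)
    fix f assume f: "f \<in> carrier ?H"
    then have f': "f \<in> Ext_cocycles R i N M" by simp
    show "\<one>\<^bsub>?H\<^esub> \<otimes>\<^bsub>?H\<^esub> f = f"
      using cl[OF f'] ext[OF f'] by (auto simp: hom_group_def extensional_def fun_eq_iff)
    have "restrict (\<lambda>v. \<ominus>\<^bsub>M\<^esub> f v) ?F \<in> Ext_cocycles R i N M"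
      using is_linear_neg[OF M lin[OF f']] zero[OF f'] by (intro mem) auto
    then show "\<exists>g\<in>carrier ?H. g \<otimes>\<^bsub>?H\<^esub> f = \<one>\<^bsub>?H\<^esub>"
      using cl[OF f'] by (intro bexI[of _ "restrict (\<lambda>v. \<ominus>\<^bsub>M\<^esub> f v) ?F"])
        (auto simp: hom_group_def M.M.l_neg intro!: restrict_ext)
    fix g assume g: "g \<in> carrier ?H"
    then have g': "g \<in> Ext_cocycles R i N M" by simp
    show "f \<otimes>\<^bsub>?H\<^esub> g \<in> carrier ?H"
      using mem[OF is_linear_sum[OF M lin[OF f'] lin[OF g']]] zero[OF f'] zero[OF g']
      by (simp add: hom_group_def)
    fix h assume h: "h \<in> carrier ?H"
    then have h': "h \<in> Ext_cocycles R i N M" by simp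
    show "f \<otimes>\<^bsub>?H\<^esub> g \<otimes>\<^bsub>?H\<^esub> h = f \<otimes>\<^bsub>?H\<^esub> (g \<otimes>\<^bsub>?H\<^esub> h)"
      using cl[OF f'] cl[OF g'] cl[OF h'] by (auto simp: hom_group_def M.M.a_assoc intro!: restrict_ext)
  qed
qed

text \<open>The unit of the factor group is the set of coboundaries, so triviality leaves it as the
  only coset, and a cocycle lies in its own coset. Conversely \<open>trivial_group\<close> includes
  being a group, which holds because the coboundaries then are the whole group and hence
  normal.\<close>

lemma trivial_Ext_iff:
  assumes N: "module R N" and M: "module R M"
  shows "trivial_group (Ext R i N M) \<longleftrightarrow>
    (\<forall>f. cocycle R (std R N) M i f \<longrightarrow> coboundary R (std R N) M i f)"
proof -
  let ?H = "(hom_group R (std_res R N i) M)\<lparr>carrier := Ext_cocycles R i N M\<rparr>"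
  let ?B = "Ext_coboundaries R i N M"
  interpret H: group ?H by (rule cocycle_group[OF N M])
  have B_sub: "?B \<subseteq> carrier ?H"
    using coboundary_is_cocycle[OF N M] by (auto simp: Ext_coboundaries_iff[OF N M] Ext_cocycles_iff)
  show ?thesis
  proof
    assume "trivial_group (Ext R i N M)"
    then have car: "rcosets\<^bsub>?H\<^esub> ?B = {?B}" by (simp add: Ext_def trivial_group_def FactGroup_def)
    show "\<forall>f. cocycle R (std R N) M i f \<longrightarrow> coboundary R (std R N) M i f"
    proof (intro allI impI)
      fix f assume "cocycle R (std R N) M i f"
      then have f: "restrict f (carrier (std_res R N i)) \<in> carrier ?H" (is "?f \<in> _")
        using cocycle_restrict[OF N] by simp
      have "\<one>\<^bsub>?H\<^esub> \<in> ?B"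
        unfolding Ext_coboundaries_iff[OF N M] using is_linear_zero_map[OF M]
        by (cases i) (auto simp: hom_group_def coboundary_Suc)
      then have "\<one>\<^bsub>?H\<^esub> \<otimes>\<^bsub>?H\<^esub> ?f \<in> ?B #>\<^bsub>?H\<^esub> ?f" unfolding r_coset_def by blast
      moreover have "?B #>\<^bsub>?H\<^esub> ?f = ?B" using car f by (auto simp: RCOSETS_def)
      ultimately have "?f \<in> ?B" using H.l_one[OF f] by simp
      then have "coboundary R (std R N) M i ?f" by (simp add: Ext_coboundaries_iff[OF N M])
      then show "coboundary R (std R N) M i f" by (rule coboundary_cong) simp
    qed
  next
    assume "\<forall>f. cocycle R (std R N) M i f \<longrightarrow> coboundary R (std R N) M i f"
    then have B: "?B = carrier ?H"
      using B_sub by (auto simp: Ext_coboundaries_iff[OF N M] Ext_cocycles_iff)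
    have "?B \<lhd> ?H" unfolding B by (rule H.normal_self)
    then have "group (?H Mod ?B)" by (rule normal.factorgroup_is_group)
    moreover have "rcosets\<^bsub>?H\<^esub> ?B = {?B}"
    proof -
      have "?B #>\<^bsub>?H\<^esub> f = ?B" if "f \<in> carrier ?H" for f
        unfolding B using H.coset_join2[OF that H.subgroup_self that] .
      then show ?thesis using H.one_closed unfolding RCOSETS_def by blast
    qed
    ultimately show "trivial_group (Ext R i N M)"
      by (simp add: Ext_def trivial_group_def FactGroup_def)
  qed
qed

end

section \<open>Localization\<close>

text \<open>A ring, the same ring as a module, and the corresponding localizations are records of
  different types with the same addition.\<close>

lemma abelian_group_transfer:
  fixes G :: "('a, 'g) ring_scheme" and H :: "('a, 'h) ring_scheme"
  assumes "abelian_group G" "carrier H = carrier G" "\<And>x y. x \<oplus>\<^bsub>H\<^esub> y = x \<oplus>\<^bsub>G\<^esub> y" "\<zero>\<^bsub>H\<^esub> = \<zero>\<^bsub>G\<^esub>"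
  shows "abelian_group H"
proof -
  interpret G: abelian_group G by fact
  show ?thesis
    by (rule abelian_groupI) (auto simp: assms(2-) G.a_ac intro: bexI[of _ "\<ominus>\<^bsub>G\<^esub> _"] G.l_neg)
qed

section \<open>Fractions with respect to a multiplicative set\<close>

locale mult_closed_set = cring R for R (structure) +
  fixes S
  assumes S_sub: "S \<subseteq> carrier R" and one_S: "\<one> \<in> S"
    and S_mult: "s \<in> S \<Longrightarrow> t \<in> S \<Longrightarrow> s \<otimes> t \<in> S"
begin

lemma S_carrier: "s \<in> S \<Longrightarrow> s \<in> carrier R"
  using S_sub by blast

lemma fraction_relI:
  assumes "m \<in> carrier M" "m' \<in> carrier M" "s \<in> S" "s' \<in> S" "u \<in> S"
    "u \<odot>\<^bsub>M\<^esub> (s' \<odot>\<^bsub>M\<^esub> m) = u \<odot>\<^bsub>M\<^esub> (s \<odot>\<^bsub>M\<^esub> m')"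
  shows "((m, s), (m', s')) \<in> fraction_rel S M"
  using assms unfolding fraction_rel_def by blast

lemma fraction_relE:
  assumes "((m, s), (m', s')) \<in> fraction_rel S M"
  obtains u where "m \<in> carrier M" "m' \<in> carrier M" "s \<in> S" "s' \<in> S" "u \<in> S"
    "u \<odot>\<^bsub>M\<^esub> (s' \<odot>\<^bsub>M\<^esub> m) = u \<odot>\<^bsub>M\<^esub> (s \<odot>\<^bsub>M\<^esub> m')"
  using assms unfolding fraction_rel_def by blast

lemma fraction_rel_equiv:
  assumes "module R M"
  shows "equiv (carrier M \<times> S) (fraction_rel S M)"
proof -
  interpret M: module R M by fact
  show ?thesis
  proof (rule equivI)
    show "fraction_rel S M \<subseteq> (carrier M \<times> S) \<times> (carrier M \<times> S)"
      by (auto simp: fraction_rel_def)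
    show "refl_on (carrier M \<times> S) (fraction_rel S M)"
      using one_S by (auto simp: refl_on_def fraction_rel_def)
    show "sym (fraction_rel S M)"
    proof (rule symI, clarify)
      fix m s m' s' assume "((m, s), (m', s')) \<in> fraction_rel S M"
      then show "((m', s'), (m, s)) \<in> fraction_rel S M"
      proof (rule fraction_relE)
        fix u assume "m \<in> carrier M" "m' \<in> carrier M" "s \<in> S" "s' \<in> S" "u \<in> S"
          "u \<odot>\<^bsub>M\<^esub> (s' \<odot>\<^bsub>M\<^esub> m) = u \<odot>\<^bsub>M\<^esub> (s \<odot>\<^bsub>M\<^esub> m')"
        then show ?thesis by (intro fraction_relI[where u = u]) simp_all
      qed
    qed
    show "trans (fraction_rel S M)"
    proof (rule transI, clarify)
      fix m s m' s' m'' s''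
      assume "((m, s), (m', s')) \<in> fraction_rel S M" "((m', s'), (m'', s'')) \<in> fraction_rel S M"
      then obtain u v where m: "m \<in> carrier M" "m' \<in> carrier M" "m'' \<in> carrier M"
        and s: "s \<in> S" "s' \<in> S" "s'' \<in> S" "u \<in> S" "v \<in> S"
        and u: "u \<odot>\<^bsub>M\<^esub> (s' \<odot>\<^bsub>M\<^esub> m) = u \<odot>\<^bsub>M\<^esub> (s \<odot>\<^bsub>M\<^esub> m')"
        and v: "v \<odot>\<^bsub>M\<^esub> (s'' \<odot>\<^bsub>M\<^esub> m') = v \<odot>\<^bsub>M\<^esub> (s' \<odot>\<^bsub>M\<^esub> m'')"
        by (auto elim!: fraction_relE)
      note c = s[THEN S_carrier]
      \<comment> \<open>The multiplier needs the middle denominator \<open>s'\<close> besides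
        \<open>u\<close> and \<open>v\<close>, since \<open>s'\<close> cannot be cancelled.\<close>
      have "(u \<otimes> v \<otimes> s') \<odot>\<^bsub>M\<^esub> (s'' \<odot>\<^bsub>M\<^esub> m) = (v \<otimes> s'') \<odot>\<^bsub>M\<^esub> (u \<odot>\<^bsub>M\<^esub> (s' \<odot>\<^bsub>M\<^esub> m))"
        using m c by (simp add: M.smult_assoc1[symmetric] m_ac)
      also have "\<dots> = (u \<otimes> s) \<odot>\<^bsub>M\<^esub> (v \<odot>\<^bsub>M\<^esub> (s'' \<odot>\<^bsub>M\<^esub> m'))"
        unfolding u using m c by (simp add: M.smult_assoc1[symmetric] m_ac)
      also have "\<dots> = (u \<otimes> v \<otimes> s') \<odot>\<^bsub>M\<^esub> (s \<odot>\<^bsub>M\<^esub> m'')"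
        unfolding v using m c by (simp add: M.smult_assoc1[symmetric] m_ac)
      finally show "((m, s), (m'', s'')) \<in> fraction_rel S M"
        using m s S_mult by (intro fraction_relI[where u = "u \<otimes> v \<otimes> s'"]) auto
    qed
  qed
qed

lemma fraction_eq_iff:
  assumes "module R M" "m \<in> carrier M" "m' \<in> carrier M" "s \<in> S" "s' \<in> S"
  shows "fraction S M m s = fraction S M m' s' \<longleftrightarrow>
    (\<exists>u\<in>S. u \<odot>\<^bsub>M\<^esub> (s' \<odot>\<^bsub>M\<^esub> m) = u \<odot>\<^bsub>M\<^esub> (s \<odot>\<^bsub>M\<^esub> m'))"
proof -
  have "fraction S M m s = fraction S M m' s' \<longleftrightarrow> ((m, s), (m', s')) \<in> fraction_rel S M"
    unfolding fraction_def
    using eq_equiv_class_iff[OF fraction_rel_equiv[OF assms(1)], of "(m, s)" "(m', s')"] assms by simp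
  then show ?thesis using assms by (auto simp: fraction_rel_def)
qed

lemma fraction_eqI:
  assumes "module R M" "m \<in> carrier M" "m' \<in> carrier M" "s \<in> S" "s' \<in> S"
    "s' \<odot>\<^bsub>M\<^esub> m = s \<odot>\<^bsub>M\<^esub> m'"
  shows "fraction S M m s = fraction S M m' s'"
  using fraction_eq_iff[OF assms(1-5)] assms(6) one_S by auto

lemma mem_fraction:
  assumes "module R M" "(n, t) \<in> fraction S M m s"
  shows "n \<in> carrier M" "t \<in> S" "fraction S M n t = fraction S M m s"
proof -
  have r: "((m, s), (n, t)) \<in> fraction_rel S M" using assms(2) by (auto simp: fraction_def)
  then show "n \<in> carrier M" "t \<in> S" by (auto elim: fraction_relE)
  show "fraction S M n t = fraction S M m s"
    unfolding fraction_def using equiv_class_eq[OF fraction_rel_equiv[OF assms(1)] r] by simp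
qed

lemma fraction_self:
  assumes "module R M" "m \<in> carrier M" "s \<in> S"
  shows "(m, s) \<in> fraction S M m s"
  unfolding fraction_def
  by (rule equiv_class_self[OF fraction_rel_equiv[OF assms(1)]]) (use assms in auto)

text \<open>Evaluates the operations on classes, which are unions over all representatives: if the
  value does not depend on them, the union of a nonempty constant family is that value.\<close>

lemma UN_fractions:
  assumes "module R M" "module R N" "m \<in> carrier M" "s \<in> S" "n \<in> carrier N" "t \<in> S"
    and "\<And>m' s' n' t'. m' \<in> carrier M \<Longrightarrow> s' \<in> S \<Longrightarrow> n' \<in> carrier N \<Longrightarrow> t' \<in> S \<Longrightarrow>
      fraction S M m' s' = fraction S M m s \<Longrightarrow> fraction S N n' t' = fraction S N n t \<Longrightarrow>
      F m' s' n' t' = F m s n t"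
  shows "(\<Union>(m', s')\<in>fraction S M m s. \<Union>(n', t')\<in>fraction S N n t. F m' s' n' t') = F m s n t"
proof -
  have "F m' s' n' t' = F m s n t"
    if "(m', s') \<in> fraction S M m s" "(n', t') \<in> fraction S N n t" for m' s' n' t'
    using assms(7) mem_fraction[OF assms(1) that(1)] mem_fraction[OF assms(2) that(2)] by blast
  then have "(\<Union>(m', s')\<in>fraction S M m s. \<Union>(n', t')\<in>fraction S N n t. F m' s' n' t')
      = (\<Union>_\<in>fraction S M m s. \<Union>_\<in>fraction S N n t. F m s n t)"
    by (intro SUP_cong refl) (auto simp: case_prod_beta)
  moreover have "fraction S M m s \<noteq> {}" "fraction S N n t \<noteq> {}"
    using fraction_self[OF assms(1,3,4)] fraction_self[OF assms(2,5,6)] by auto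
  ultimately show ?thesis by simp
qed

text \<open>With the ring viewed as a module over itself, the ring localization becomes a case of
  the module localization.\<close>

abbreviation "RM \<equiv> module_via id R"

lemma RM_module: "module R RM"
proof (rule moduleI[OF is_cring])
  show "abelian_group RM"
    by (rule abelian_group_transfer[OF is_abelian_group]) (auto simp: module_via_def)
qed (auto simp: module_via_def l_distr r_distr m_assoc)

lemma RM_simps [simp]:
  "carrier RM = carrier R" "a \<odot>\<^bsub>RM\<^esub> b = a \<otimes> b" "a \<oplus>\<^bsub>RM\<^esub> b = a \<oplus> b" "\<zero>\<^bsub>RM\<^esub> = \<zero>"
  by (auto simp: module_via_def)

abbreviation "Lring \<equiv> localize_ring R S"
abbreviation "Lmod \<equiv> localize_module R S"

lemma localize_carrier:
  "carrier (Lmod M) = {fraction S M m s | m s. m \<in> carrier M \<and> s \<in> S}"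
  by (auto simp: localize_module_def quotient_def fraction_def)

lemma fraction_closed:
  "m \<in> carrier M \<Longrightarrow> s \<in> S \<Longrightarrow> fraction S M m s \<in> carrier (Lmod M)"
  unfolding localize_carrier by blast

lemma localize_zero: "\<zero>\<^bsub>Lmod M\<^esub> = fraction S M \<zero>\<^bsub>M\<^esub> \<one>"
  by (simp add: localize_module_def)

lemma localize_add:
  assumes M: "module R M" and mn: "m \<in> carrier M" "s \<in> S" "n \<in> carrier M" "t \<in> S"
  shows "fraction S M m s \<oplus>\<^bsub>Lmod M\<^esub> fraction S M n t
    = fraction S M (t \<odot>\<^bsub>M\<^esub> m \<oplus>\<^bsub>M\<^esub> s \<odot>\<^bsub>M\<^esub> n) (s \<otimes> t)"
proof -
  interpret M: module R M by fact
  have "fraction S M m s \<oplus>\<^bsub>Lmod M\<^esub> fraction S M n t =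
     (\<Union>(m', s')\<in>fraction S M m s. \<Union>(n', t')\<in>fraction S M n t.
        fraction S M (t' \<odot>\<^bsub>M\<^esub> m' \<oplus>\<^bsub>M\<^esub> s' \<odot>\<^bsub>M\<^esub> n') (s' \<otimes> t'))"
    by (simp add: localize_module_def)
  also have "\<dots> = fraction S M (t \<odot>\<^bsub>M\<^esub> m \<oplus>\<^bsub>M\<^esub> s \<odot>\<^bsub>M\<^esub> n) (s \<otimes> t)"
  proof (rule UN_fractions[OF M M mn])
    fix m' s' n' t'
    assume mn': "m' \<in> carrier M" "s' \<in> S" "n' \<in> carrier M" "t' \<in> S"
      and "fraction S M m' s' = fraction S M m s" "fraction S M n' t' = fraction S M n t"
    then obtain u v where uv: "u \<in> S" "v \<in> S"
      and u: "u \<odot>\<^bsub>M\<^esub> (s \<odot>\<^bsub>M\<^esub> m') = u \<odot>\<^bsub>M\<^esub> (s' \<odot>\<^bsub>M\<^esub> m)"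
      and v: "v \<odot>\<^bsub>M\<^esub> (t \<odot>\<^bsub>M\<^esub> n') = v \<odot>\<^bsub>M\<^esub> (t' \<odot>\<^bsub>M\<^esub> n)"
      using fraction_eq_iff[OF M] mn by metis
    note c = S_carrier[OF mn(2)] S_carrier[OF mn(4)] S_carrier[OF mn'(2)] S_carrier[OF mn'(4)]
      uv[THEN S_carrier]
    have "(u \<otimes> v) \<odot>\<^bsub>M\<^esub> ((s \<otimes> t) \<odot>\<^bsub>M\<^esub> (t' \<odot>\<^bsub>M\<^esub> m' \<oplus>\<^bsub>M\<^esub> s' \<odot>\<^bsub>M\<^esub> n'))
        = (v \<otimes> t \<otimes> t') \<odot>\<^bsub>M\<^esub> (u \<odot>\<^bsub>M\<^esub> (s \<odot>\<^bsub>M\<^esub> m')) \<oplus>\<^bsub>M\<^esub> (u \<otimes> s \<otimes> s') \<odot>\<^bsub>M\<^esub> (v \<odot>\<^bsub>M\<^esub> (t \<odot>\<^bsub>M\<^esub> n'))"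
      using mn' mn c by (simp add: M.smult_assoc1[symmetric] M.smult_r_distr m_ac)
    also have "\<dots> = (u \<otimes> v) \<odot>\<^bsub>M\<^esub> ((s' \<otimes> t') \<odot>\<^bsub>M\<^esub> (t \<odot>\<^bsub>M\<^esub> m \<oplus>\<^bsub>M\<^esub> s \<odot>\<^bsub>M\<^esub> n))"
      unfolding u v using mn' mn c by (simp add: M.smult_assoc1[symmetric] M.smult_r_distr m_ac)
    finally show "fraction S M (t' \<odot>\<^bsub>M\<^esub> m' \<oplus>\<^bsub>M\<^esub> s' \<odot>\<^bsub>M\<^esub> n') (s' \<otimes> t')
        = fraction S M (t \<odot>\<^bsub>M\<^esub> m \<oplus>\<^bsub>M\<^esub> s \<odot>\<^bsub>M\<^esub> n) (s \<otimes> t)"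
      using fraction_eq_iff[OF M] mn mn' c uv S_mult by (metis M.M.a_closed M.smult_closed)
  qed
  finally show ?thesis .
qed

lemma localize_smult:
  assumes M: "module R M" and mn: "a \<in> carrier R" "s \<in> S" "n \<in> carrier M" "t \<in> S"
  shows "ring_fraction S R a s \<odot>\<^bsub>Lmod M\<^esub> fraction S M n t
    = fraction S M (a \<odot>\<^bsub>M\<^esub> n) (s \<otimes> t)"
proof -
  interpret M: module R M by fact
  have "ring_fraction S R a s \<odot>\<^bsub>Lmod M\<^esub> fraction S M n t =
     (\<Union>(a', s')\<in>fraction S RM a s. \<Union>(n', t')\<in>fraction S M n t.
        fraction S M (a' \<odot>\<^bsub>M\<^esub> n') (s' \<otimes> t'))"
    by (simp add: localize_module_def)
  also have "\<dots> = fraction S M (a \<odot>\<^bsub>M\<^esub> n) (s \<otimes> t)"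
  proof (rule UN_fractions[OF RM_module M])
    show "a \<in> carrier RM" "s \<in> S" "n \<in> carrier M" "t \<in> S" using mn by auto
    fix a' s' n' t'
    assume "a' \<in> carrier RM" and mn': "s' \<in> S" "n' \<in> carrier M" "t' \<in> S"
      and eq: "fraction S RM a' s' = fraction S RM a s" "fraction S M n' t' = fraction S M n t"
    then have a': "a' \<in> carrier R" by simp
    obtain u where u': "u \<in> S" "u \<otimes> (s \<otimes> a') = u \<otimes> (s' \<otimes> a)"
      using fraction_eq_iff[OF RM_module, of a' a s' s] eq(1) mn mn' a' by auto
    obtain v where v': "v \<in> S" "v \<odot>\<^bsub>M\<^esub> (t \<odot>\<^bsub>M\<^esub> n') = v \<odot>\<^bsub>M\<^esub> (t' \<odot>\<^bsub>M\<^esub> n)"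
      using fraction_eq_iff[OF M, of n' n t' t] eq(2) mn mn' by auto
    note c = S_carrier[OF mn(2)] S_carrier[OF mn(4)] S_carrier[OF mn'(1)] S_carrier[OF mn'(3)]
      S_carrier[OF u'(1)] S_carrier[OF v'(1)]
    have "(u \<otimes> v) \<odot>\<^bsub>M\<^esub> ((s \<otimes> t) \<odot>\<^bsub>M\<^esub> (a' \<odot>\<^bsub>M\<^esub> n')) = (u \<otimes> (s \<otimes> a')) \<odot>\<^bsub>M\<^esub> (v \<odot>\<^bsub>M\<^esub> (t \<odot>\<^bsub>M\<^esub> n'))"
      using mn mn' a' c by (simp add: M.smult_assoc1[symmetric] m_ac)
    also have "\<dots> = (u \<otimes> v) \<odot>\<^bsub>M\<^esub> ((s' \<otimes> t') \<odot>\<^bsub>M\<^esub> (a \<odot>\<^bsub>M\<^esub> n))"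
      unfolding u'(2) v'(2) using mn mn' a' c by (simp add: M.smult_assoc1[symmetric] m_ac)
    finally show "fraction S M (a' \<odot>\<^bsub>M\<^esub> n') (s' \<otimes> t') = fraction S M (a \<odot>\<^bsub>M\<^esub> n) (s \<otimes> t)"
      using fraction_eq_iff[OF M] mn mn' a' u'(1) v'(1) S_mult by (metis M.smult_closed)
  qed
  finally show ?thesis .
qed

lemma localize_abelian_group:
  assumes M: "module R M"
  shows "abelian_group (Lmod M)"
proof (rule abelian_groupI)
  interpret M: module R M by fact
  note add = localize_add[OF M]
  fix x assume "x \<in> carrier (Lmod M)"
  then obtain m s where x: "x = fraction S M m s" "m \<in> carrier M" "s \<in> S"
    by (auto simp: localize_carrier)
  note sc = S_carrier[OF x(3)]
  show "\<zero>\<^bsub>Lmod M\<^esub> \<oplus>\<^bsub>Lmod M\<^esub> x = x"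
    using x sc one_S by (simp add: localize_zero add)
  have "fraction S M (\<ominus>\<^bsub>M\<^esub> m) s \<oplus>\<^bsub>Lmod M\<^esub> x = fraction S M \<zero>\<^bsub>M\<^esub> (s \<otimes> s)"
    using x sc by (simp add: add M.smult_r_minus M.M.l_neg)
  also have "\<dots> = \<zero>\<^bsub>Lmod M\<^esub>"
    unfolding localize_zero using x sc one_S S_mult by (intro fraction_eqI M) auto
  finally show "\<exists>y\<in>carrier (Lmod M). y \<oplus>\<^bsub>Lmod M\<^esub> x = \<zero>\<^bsub>Lmod M\<^esub>"
    using fraction_closed[OF M.M.a_inv_closed[OF x(2)] x(3)] by blast
  fix y assume "y \<in> carrier (Lmod M)"
  then obtain n t where y: "y = fraction S M n t" "n \<in> carrier M" "t \<in> S"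
    by (auto simp: localize_carrier)
  note tc = S_carrier[OF y(3)]
  have "t \<odot>\<^bsub>M\<^esub> m \<oplus>\<^bsub>M\<^esub> s \<odot>\<^bsub>M\<^esub> n \<in> carrier M" "s \<otimes> t \<in> S"
    using x y sc tc S_mult by auto
  then show "x \<oplus>\<^bsub>Lmod M\<^esub> y \<in> carrier (Lmod M)"
    using x y by (simp add: add fraction_closed)
  show "x \<oplus>\<^bsub>Lmod M\<^esub> y = y \<oplus>\<^bsub>Lmod M\<^esub> x"
    using x y sc tc by (simp add: add m_comm M.M.a_comm)
  fix z assume "z \<in> carrier (Lmod M)"
  then obtain l r where z: "z = fraction S M l r" "l \<in> carrier M" "r \<in> S"
    by (auto simp: localize_carrier)
  note rc = S_carrier[OF z(3)]
  show "x \<oplus>\<^bsub>Lmod M\<^esub> y \<oplus>\<^bsub>Lmod M\<^esub> z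
      = x \<oplus>\<^bsub>Lmod M\<^esub> (y \<oplus>\<^bsub>Lmod M\<^esub> z)"
    using x y z sc tc rc S_mult
    by (simp add: add M.smult_r_distr M.smult_assoc1[symmetric] m_ac M.M.a_ac)
next
  show "\<zero>\<^bsub>Lmod M\<^esub> \<in> carrier (Lmod M)"
    unfolding localize_zero
    by (intro fraction_closed one_S abelian_monoid.zero_closed abelian_group.axioms(1) module.axioms(2)[OF M])
qed

text \<open>Multiplication of fractions is the action on the localized module of \<open>R\<close>
  itself, so the computations for modules can be reused for the ring.\<close>

lemma localize_ring_simps:
  "carrier (Lring) = {ring_fraction S R a s | a s. a \<in> carrier R \<and> s \<in> S}"
  "x \<oplus>\<^bsub>Lring\<^esub> y = x \<oplus>\<^bsub>Lmod RM\<^esub> y"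
  "x \<otimes>\<^bsub>Lring\<^esub> y = x \<odot>\<^bsub>Lmod RM\<^esub> y"
  "\<zero>\<^bsub>Lring\<^esub> = \<zero>\<^bsub>Lmod RM\<^esub>"
  "\<one>\<^bsub>Lring\<^esub> = ring_fraction S R \<one> \<one>"
  using localize_carrier[of RM] by (auto simp: localize_ring_def localize_module_def)

lemma ring_fraction_closed:
  "a \<in> carrier R \<Longrightarrow> s \<in> S \<Longrightarrow> ring_fraction S R a s \<in> carrier (Lring)"
  unfolding localize_ring_simps by blast

lemma ring_fraction_add:
  assumes "a \<in> carrier R" "s \<in> S" "b \<in> carrier R" "t \<in> S"
  shows "ring_fraction S R a s \<oplus>\<^bsub>Lring\<^esub> ring_fraction S R b t
    = ring_fraction S R (t \<otimes> a \<oplus> s \<otimes> b) (s \<otimes> t)"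
  using localize_add[OF RM_module, of a s b t] assms by (simp add: localize_ring_simps)

lemma ring_fraction_mult:
  assumes "a \<in> carrier R" "s \<in> S" "b \<in> carrier R" "t \<in> S"
  shows "ring_fraction S R a s \<otimes>\<^bsub>Lring\<^esub> ring_fraction S R b t
    = ring_fraction S R (a \<otimes> b) (s \<otimes> t)"
  using localize_smult[OF RM_module, of a s b t] assms by (simp add: localize_ring_simps)

text \<open>The two sides have different denominators and agree only as fractions. The first
  identity also supplies the distributive law of the localized ring.\<close>

lemma localize_smult_distribs:
  assumes M: "module R M" and ab: "a \<in> carrier R" "s \<in> S" "b \<in> carrier R" "t \<in> S"
    and mn: "m \<in> carrier M" "r \<in> S" "n \<in> carrier M" "q \<in> S"
  shows "(ring_fraction S R a s \<oplus>\<^bsub>Lring\<^esub> ring_fraction S R b t)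
      \<odot>\<^bsub>Lmod M\<^esub> fraction S M m r
    = ring_fraction S R a s \<odot>\<^bsub>Lmod M\<^esub> fraction S M m r
      \<oplus>\<^bsub>Lmod M\<^esub> ring_fraction S R b t \<odot>\<^bsub>Lmod M\<^esub> fraction S M m r"
    and "ring_fraction S R a s \<odot>\<^bsub>Lmod M\<^esub>
      (fraction S M m r \<oplus>\<^bsub>Lmod M\<^esub> fraction S M n q)
    = ring_fraction S R a s \<odot>\<^bsub>Lmod M\<^esub> fraction S M m r
      \<oplus>\<^bsub>Lmod M\<^esub> ring_fraction S R a s \<odot>\<^bsub>Lmod M\<^esub> fraction S M n q"
proof -
  interpret M: module R M by fact
  note c = ab(2,4)[THEN S_carrier] mn(2,4)[THEN S_carrier]
  show "(ring_fraction S R a s \<oplus>\<^bsub>Lring\<^esub> ring_fraction S R b t)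
      \<odot>\<^bsub>Lmod M\<^esub> fraction S M m r
    = ring_fraction S R a s \<odot>\<^bsub>Lmod M\<^esub> fraction S M m r
      \<oplus>\<^bsub>Lmod M\<^esub> ring_fraction S R b t \<odot>\<^bsub>Lmod M\<^esub> fraction S M m r"
    using ab mn c S_mult
    by (simp add: ring_fraction_add localize_smult[OF M] localize_add[OF M], intro fraction_eqI M)
      (simp_all add: M.smult_r_distr M.smult_l_distr M.smult_assoc1[symmetric] m_ac l_distr r_distr)
  show "ring_fraction S R a s \<odot>\<^bsub>Lmod M\<^esub>
      (fraction S M m r \<oplus>\<^bsub>Lmod M\<^esub> fraction S M n q)
    = ring_fraction S R a s \<odot>\<^bsub>Lmod M\<^esub> fraction S M m r
      \<oplus>\<^bsub>Lmod M\<^esub> ring_fraction S R a s \<odot>\<^bsub>Lmod M\<^esub> fraction S M n q"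
    using ab mn c S_mult
    by (simp add: localize_smult[OF M] localize_add[OF M], intro fraction_eqI M)
      (simp_all add: M.smult_r_distr M.smult_l_distr M.smult_assoc1[symmetric] m_ac l_distr r_distr)
qed

lemma localize_cring: "cring (Lring)"
proof (rule cringI)
  show "abelian_group (Lring)"
    by (rule abelian_group_transfer[OF localize_abelian_group[OF RM_module]])
      (auto simp: localize_ring_def localize_module_def)
  show "comm_monoid (Lring)"
  proof (rule comm_monoidI)
    fix x y z
    assume "x \<in> carrier (Lring)" "y \<in> carrier (Lring)"
      "z \<in> carrier (Lring)"
    then obtain a s b t c r where
      x: "x = ring_fraction S R a s" "a \<in> carrier R" "s \<in> S"
      and y: "y = ring_fraction S R b t" "b \<in> carrier R" "t \<in> S"
      and z: "z = ring_fraction S R c r" "c \<in> carrier R" "r \<in> S"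
      by (auto simp: localize_ring_simps)
    note cS = x(3)[THEN S_carrier] y(3)[THEN S_carrier] z(3)[THEN S_carrier]
    show "x \<otimes>\<^bsub>Lring\<^esub> y \<otimes>\<^bsub>Lring\<^esub> z
        = x \<otimes>\<^bsub>Lring\<^esub> (y \<otimes>\<^bsub>Lring\<^esub> z)"
      using x y z cS S_mult by (simp add: ring_fraction_mult m_assoc)
  next
    fix x y
    assume "x \<in> carrier (Lring)" "y \<in> carrier (Lring)"
    then obtain a s b t where
      x: "x = ring_fraction S R a s" "a \<in> carrier R" "s \<in> S"
      and y: "y = ring_fraction S R b t" "b \<in> carrier R" "t \<in> S"
      by (auto simp: localize_ring_simps)
    note cS = x(3)[THEN S_carrier] y(3)[THEN S_carrier]
    show "x \<otimes>\<^bsub>Lring\<^esub> y \<in> carrier (Lring)"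
      using x y S_mult by (simp add: ring_fraction_mult ring_fraction_closed)
    show "x \<otimes>\<^bsub>Lring\<^esub> y = y \<otimes>\<^bsub>Lring\<^esub> x"
      using x y cS by (simp add: ring_fraction_mult m_comm)
  next
    show "\<one>\<^bsub>Lring\<^esub> \<in> carrier (Lring)"
      using one_S by (simp add: localize_ring_simps(5) ring_fraction_closed)
    fix x assume "x \<in> carrier (Lring)"
    then obtain a s where x: "x = ring_fraction S R a s" "a \<in> carrier R" "s \<in> S"
      by (auto simp: localize_ring_simps)
    then show "\<one>\<^bsub>Lring\<^esub> \<otimes>\<^bsub>Lring\<^esub> x = x"
      using S_carrier[OF x(3)] one_S by (simp add: localize_ring_simps(5) ring_fraction_mult)
  qed
  fix x y z
  assume "x \<in> carrier (Lring)" "y \<in> carrier (Lring)"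
    "z \<in> carrier (Lring)"
  then show "(x \<oplus>\<^bsub>Lring\<^esub> y) \<otimes>\<^bsub>Lring\<^esub> z
      = x \<otimes>\<^bsub>Lring\<^esub> z \<oplus>\<^bsub>Lring\<^esub> y \<otimes>\<^bsub>Lring\<^esub> z"
    using localize_smult_distribs(1)[OF RM_module, simplified]
    by (auto simp: localize_ring_simps)
qed

lemma localize_module_is_module:
  assumes M: "module R M"
  shows "module (Lring) (Lmod M)"
proof (rule moduleI[OF localize_cring localize_abelian_group[OF M]])
  interpret M: module R M by fact
  fix x y a b
  assume "x \<in> carrier (Lmod M)" "a \<in> carrier (Lring)"
  then obtain m r a' s where x: "x = fraction S M m r" "m \<in> carrier M" "r \<in> S"
    and a: "a = ring_fraction S R a' s" "a' \<in> carrier R" "s \<in> S"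
    by (auto simp: localize_ring_simps localize_carrier)
  note c = S_carrier[OF x(3)] S_carrier[OF a(3)]
  have "a' \<odot>\<^bsub>M\<^esub> m \<in> carrier M" "s \<otimes> r \<in> S" using x a S_mult by auto
  then show "a \<odot>\<^bsub>Lmod M\<^esub> x \<in> carrier (Lmod M)"
    using x a by (simp add: localize_smult[OF M] fraction_closed)
  show "a \<odot>\<^bsub>Lmod M\<^esub> (x \<oplus>\<^bsub>Lmod M\<^esub> y) = a \<odot>\<^bsub>Lmod M\<^esub> x
      \<oplus>\<^bsub>Lmod M\<^esub> a \<odot>\<^bsub>Lmod M\<^esub> y"
    if "y \<in> carrier (Lmod M)"
    using x a that localize_smult_distribs(2)[OF M] by (auto simp: localize_carrier)
  assume "b \<in> carrier (Lring)"
  then obtain b' t where b: "b = ring_fraction S R b' t" "b' \<in> carrier R" "t \<in> S"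
    by (auto simp: localize_ring_simps)
  show "(a \<oplus>\<^bsub>Lring\<^esub> b) \<odot>\<^bsub>Lmod M\<^esub> x = a \<odot>\<^bsub>Lmod M\<^esub> x
      \<oplus>\<^bsub>Lmod M\<^esub> b \<odot>\<^bsub>Lmod M\<^esub> x"
    using x a b localize_smult_distribs(1)[OF M] by blast
  show "(a \<otimes>\<^bsub>Lring\<^esub> b) \<odot>\<^bsub>Lmod M\<^esub> x
      = a \<odot>\<^bsub>Lmod M\<^esub> (b \<odot>\<^bsub>Lmod M\<^esub> x)"
    using x a b c S_carrier[OF b(3)] S_mult
    by (simp add: ring_fraction_mult localize_smult[OF M] M.smult_assoc1 m_assoc)
next
  interpret M: module R M by fact
  fix x assume "x \<in> carrier (Lmod M)"
  then obtain m r where "x = fraction S M m r" "m \<in> carrier M" "r \<in> S"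
    by (auto simp: localize_carrier)
  then show "\<one>\<^bsub>Lring\<^esub> \<odot>\<^bsub>Lmod M\<^esub> x = x"
    using S_carrier[of r] one_S by (simp add: localize_ring_simps localize_smult[OF M])
qed

end

section \<open>The local ring at a prime\<close>

locale prime_localization = cring R for R (structure) +
  fixes p
  assumes prime: "primeideal p R"
begin

sublocale mult_closed_set R "carrier R - p"
proof
  show "\<one> \<in> carrier R - p"
    using ideal.one_imp_carrier[OF prime_ideal[OF prime]] primeideal.I_notcarr[OF prime] by auto
qed (use prime_mult_iff[OF prime] in auto)

abbreviation "S \<equiv> carrier R - p"
abbreviation "Rp \<equiv> ring_at_prime R p"
abbreviation "frac_at \<equiv> ring_fraction S R"

lemma Rp_eq: "Rp = localize_ring R S"
  by (simp add: ring_at_prime_def)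

lemma frac_closed: "a \<in> carrier R \<Longrightarrow> s \<in> S \<Longrightarrow> frac_at a s \<in> carrier Rp"
  unfolding Rp_eq by (rule ring_fraction_closed)

lemma Rp_cases:
  assumes "x \<in> carrier Rp"
  obtains a s where "a \<in> carrier R" "s \<in> S" "x = frac_at a s"
  using assms by (auto simp: Rp_eq localize_ring_simps)

lemmas Rp_add = ring_fraction_add[folded Rp_eq]
  and Rp_mult = ring_fraction_mult[folded Rp_eq]

lemma Rp_one: "\<one>\<^bsub>Rp\<^esub> = frac_at \<one> \<one>"
  and Rp_zero: "\<zero>\<^bsub>Rp\<^esub> = frac_at \<zero> \<one>"
  by (auto simp: Rp_eq localize_ring_simps localize_zero)

lemma Rp_cring: "cring Rp"
  unfolding Rp_eq by (rule localize_cring)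

lemma frac_eqI:
  assumes "a \<in> carrier R" "s \<in> S" "b \<in> carrier R" "t \<in> S" "t \<otimes> a = s \<otimes> b"
  shows "frac_at a s = frac_at b t"
  using assms by (intro fraction_eqI RM_module) auto

lemma frac_decomp:
  assumes "a \<in> carrier R" "s \<in> S"
  shows "frac_at a s = frac_at \<one> s \<otimes>\<^bsub>Rp\<^esub> frac_at a \<one>"
  using assms one_S by (simp add: Rp_mult)

lemma frac_numerator:
  assumes "a \<in> carrier R" "s \<in> S"
  shows "frac_at a \<one> = frac_at s \<one> \<otimes>\<^bsub>Rp\<^esub> frac_at a s"
  using assms one_S by (simp add: Rp_mult) (intro frac_eqI, auto)

text \<open>The fractions with numerator in \<open>p\<close> already form an ideal, and
  \<open>a/s = (1/s)(a/1)\<close> shows that the generators reach all of them.\<close>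

lemma extended_prime_eq: "extended_prime R p = {frac_at a s | a s. a \<in> p \<and> s \<in> S}"
  and frac_mem_extended_prime:
    "a \<in> carrier R \<Longrightarrow> s \<in> S \<Longrightarrow> frac_at a s \<in> extended_prime R p \<longleftrightarrow> a \<in> p"
  and extended_prime_ideal: "ideal (extended_prime R p) Rp"
proof -
  interpret Rp: cring Rp by (rule Rp_cring)
  let ?P = "{frac_at a s | a s. a \<in> p \<and> s \<in> S}" and ?G = "(\<lambda>a. frac_at a \<one>) ` p"
  note pD = ideal_closed[OF prime_ideal[OF prime]]
  have P: "ideal ?P Rp"
  proof (rule Rp.ideal_by_closure)
    show "?P \<subseteq> carrier Rp" using pD frac_closed by auto
    show "\<zero>\<^bsub>Rp\<^esub> \<in> ?P" using pD one_S by (auto simp: Rp_zero)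
    fix x assume "x \<in> ?P"
    then obtain a s where x: "x = frac_at a s" "a \<in> p" "s \<in> S" by auto
    have a: "a \<in> carrier R" using pD x by auto
    show "x \<oplus>\<^bsub>Rp\<^esub> y \<in> ?P" if y: "y \<in> ?P" for y
    proof -
      obtain b t where y: "y = frac_at b t" "b \<in> p" "t \<in> S" using y by auto
      have "x \<oplus>\<^bsub>Rp\<^esub> y = frac_at (t \<otimes> a \<oplus> s \<otimes> b) (s \<otimes> t)"
        using x y a pD(2) by (simp add: Rp_add)
      moreover have "t \<otimes> a \<oplus> s \<otimes> b \<in> p" "s \<otimes> t \<in> S" using x y pD(3,4) S_mult by auto
      ultimately show ?thesis by blast
    qed
    show "r \<otimes>\<^bsub>Rp\<^esub> x \<in> ?P" if r: "r \<in> carrier Rp" for r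
    proof -
      obtain b t where b: "b \<in> carrier R" "t \<in> S" "r = frac_at b t" using r by (rule Rp_cases)
      have "r \<otimes>\<^bsub>Rp\<^esub> x = frac_at (b \<otimes> a) (t \<otimes> s)" using x b a by (simp add: Rp_mult)
      moreover have "b \<otimes> a \<in> p" "t \<otimes> s \<in> S" using x b pD(4) S_mult by auto
      ultimately show ?thesis by blast
    qed
  qed
  have G: "?G \<subseteq> ?P" using one_S by auto
  have PG: "?P \<subseteq> genideal Rp ?G"
  proof clarify
    fix a s assume a: "a \<in> p" "s \<in> carrier R" "s \<notin> p"
    have GR: "?G \<subseteq> carrier Rp" using pD one_S by (auto intro: frac_closed)
    have "frac_at a \<one> \<in> genideal Rp ?G" using Rp.genideal_self[OF GR] a by blast
    then show "frac_at a s \<in> genideal Rp ?G"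
      using frac_decomp[of a s] a pD(2) Rp.ideal_closed(4)[OF Rp.genideal_ideal[OF GR]]
        frac_closed[OF one_closed, of s] by simp
  qed
  show eq: "extended_prime R p = ?P"
    unfolding extended_prime_def using Rp.genideal_minimal[OF P G] PG
    by (intro subset_antisym) auto
  show "ideal (extended_prime R p) Rp" using P eq by simp
  show "frac_at a s \<in> extended_prime R p \<longleftrightarrow> a \<in> p" if a: "a \<in> carrier R" "s \<in> S" for a s
  proof
    assume "frac_at a s \<in> extended_prime R p"
    then obtain b t where b: "frac_at a s = frac_at b t" "b \<in> p" "t \<in> S" by (auto simp: eq)
    obtain u where u: "u \<in> S" "u \<otimes> (t \<otimes> a) = u \<otimes> (s \<otimes> b)"
      using fraction_eq_iff[OF RM_module, of a b s t] b a pD(2) by auto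
    \<comment> \<open>Membership does not depend on the representative: \<open>u\<close> and
      \<open>t\<close> lie outside the prime and can be cancelled.\<close>
    have "u \<otimes> (t \<otimes> a) \<in> p" unfolding u(2) using u a b pD(4) by auto
    then have "t \<otimes> a \<in> p" using u(1) a b prime_mult_iff[OF prime, of u "t \<otimes> a"] by auto
    then show "a \<in> p" using a b prime_mult_iff[OF prime, of t a] by auto
  qed (use a eq in auto)
qed

lemma extended_prime_prime: "primeideal (extended_prime R p) Rp"
proof (rule primeidealI[OF extended_prime_ideal Rp_cring])
  show "carrier Rp \<noteq> extended_prime R p"
    using frac_mem_extended_prime[OF one_closed one_S] one_S frac_closed[OF one_closed one_S] by auto
  fix x y assume "x \<in> carrier Rp" "y \<in> carrier Rp"
  then obtain a s b t where xy: "a \<in> carrier R" "s \<in> S" "x = frac_at a s"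
    "b \<in> carrier R" "t \<in> S" "y = frac_at b t"
    using Rp_cases by metis
  assume "x \<otimes>\<^bsub>Rp\<^esub> y \<in> extended_prime R p"
  then have "frac_at (a \<otimes> b) (s \<otimes> t) \<in> extended_prime R p" using xy by (simp add: Rp_mult)
  then have "a \<otimes> b \<in> p" using xy S_mult frac_mem_extended_prime[of "a \<otimes> b" "s \<otimes> t"] by blast
  then have "a \<in> p \<or> b \<in> p" using prime_mult_iff[OF prime] xy by blast
  then show "x \<in> extended_prime R p \<or> y \<in> extended_prime R p"
    using frac_mem_extended_prime xy by simp
qed

text \<open>A fraction outside the extended prime has its numerator in \<open>S\<close>, so it is a
  unit and lies in no proper ideal.\<close>

lemma extended_prime_maximal:
  assumes "ideal I Rp" "I \<noteq> carrier Rp"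
  shows "I \<subseteq> extended_prime R p"
proof
  interpret Rp: cring Rp by (rule Rp_cring)
  fix x assume x: "x \<in> I"
  then obtain a s where a: "a \<in> carrier R" "s \<in> S" "x = frac_at a s"
    using Rp.ideal_closed(2)[OF assms(1)] Rp_cases by metis
  show "x \<in> extended_prime R p"
  proof (rule ccontr)
    assume "x \<notin> extended_prime R p"
    then have aS: "a \<in> S" using frac_mem_extended_prime a by auto
    have "frac_at s a \<otimes>\<^bsub>Rp\<^esub> x = frac_at (s \<otimes> a) (a \<otimes> s)" using a aS by (simp add: Rp_mult)
    also have "\<dots> = \<one>\<^bsub>Rp\<^esub>"
      unfolding Rp_one using a aS S_mult one_S by (intro frac_eqI) (auto simp: m_comm)
    finally have "\<one>\<^bsub>Rp\<^esub> \<in> I"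
      using Rp.ideal_closed(4)[OF assms(1) x, of "frac_at s a"] frac_closed[of s a] a aS by simp
    then show False using ideal.one_imp_carrier[OF assms(1)] assms(2) by blast
  qed
qed

text \<open>An ideal of the localization is generated by the images of the elements \<open>a\<close>
  with \<open>a/1\<close> in it, and these form an ideal of \<open>R\<close>, which is finitely
  generated.\<close>

lemma Rp_noetherian:
  assumes "noetherian_ring R"
  shows "noetherian_ring Rp"
proof -
  interpret Rp: cring Rp by (rule Rp_cring)
  show ?thesis
  proof (rule Rp.noetherian_ringI)
    fix J assume J: "ideal J Rp"
    note JD = Rp.ideal_closed[OF J]
    have contract: "ideal {a \<in> carrier R. frac_at a \<one> \<in> K} R" if K: "ideal K Rp" for K
    proof (rule ideal_by_closure)
      note KD = Rp.ideal_closed[OF K]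
      show "\<zero> \<in> {a \<in> carrier R. frac_at a \<one> \<in> K}" using KD(1) by (simp add: Rp_zero)
      fix x assume x: "x \<in> {a \<in> carrier R. frac_at a \<one> \<in> K}"
      show "x \<oplus> y \<in> {a \<in> carrier R. frac_at a \<one> \<in> K}" if "y \<in> {a \<in> carrier R. frac_at a \<one> \<in> K}" for y
        using KD(3)[of "frac_at x \<one>" "frac_at y \<one>"] x that one_S by (simp add: Rp_add)
      show "r \<otimes> x \<in> {a \<in> carrier R. frac_at a \<one> \<in> K}" if "r \<in> carrier R" for r
        using KD(4)[of "frac_at x \<one>" "frac_at r \<one>"] x that one_S frac_closed by (simp add: Rp_mult)
    qed auto
    obtain F where F: "F \<subseteq> carrier R" "finite F" "{a \<in> carrier R. frac_at a \<one> \<in> J} = Idl F"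
      using noetherian_ring.finetely_gen[OF assms contract[OF J]] by blast
    let ?G = "(\<lambda>a. frac_at a \<one>) ` F"
    have GR: "?G \<subseteq> carrier Rp" using F one_S by (auto intro!: frac_closed)
    note GI = Rp.genideal_ideal[OF GR]
    have "F \<subseteq> {a \<in> carrier R. frac_at a \<one> \<in> genideal Rp ?G}"
      using F(1) Rp.genideal_self[OF GR] by auto
    then have sub: "Idl F \<subseteq> {a \<in> carrier R. frac_at a \<one> \<in> genideal Rp ?G}"
      by (rule genideal_minimal[OF contract[OF GI]])
    have "?G \<subseteq> J" using F genideal_self[OF F(1)] by auto
    then have "genideal Rp ?G \<subseteq> J" by (rule Rp.genideal_minimal[OF J])
    moreover have "J \<subseteq> genideal Rp ?G"
    proof
      fix x assume x: "x \<in> J"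
      then obtain a s where a: "a \<in> carrier R" "s \<in> S" "x = frac_at a s"
        using JD(2) Rp_cases by metis
      have "frac_at a \<one> \<in> J"
        using JD(4)[OF x, of "frac_at s \<one>"] frac_numerator[OF a(1,2)] a frac_closed one_S by simp
      then have "frac_at a \<one> \<in> genideal Rp ?G" using F(3) sub a(1) by blast
      then show "x \<in> genideal Rp ?G"
        using frac_decomp[OF a(1,2)] a Rp.ideal_closed(4)[OF GI] frac_closed[OF one_closed a(2)] by simp
    qed
    ultimately have "J = genideal Rp ?G" by blast
    then show "\<exists>A\<subseteq>carrier Rp. finite A \<and> J = genideal Rp A" using GR F(2) by blast
  qed
qed

lemma Rp_local:
  assumes "noetherian_ring R"
  shows "noetherian_local_ring Rp (extended_prime R p)"
  by (intro noetherian_local_ring.intro noetherian_cring.intro noetherian_local_ring_axioms.intro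
      Rp_cring Rp_noetherian assms extended_prime_prime extended_prime_maximal)

lemma Mp_module: "module R M \<Longrightarrow> module Rp (module_at_prime R p M)"
  unfolding Rp_eq module_at_prime_def by (rule localize_module_is_module)

end

text \<open>The residue field is \<open>A/m\<close> in the notation of the overview, which makes the
  rigidity step applicable.\<close>

lemma residue_module_cyclic: "residue_module R p = cyclic_module (ring_at_prime R p) (extended_prime R p)"
  by (simp add: residue_module_def cyclic_module_def residue_field_def)

theorem theorem1p2:
  fixes R :: "('a, 'r) ring_scheme"
    and M :: "('a, 'b, 'm) module_scheme"
    and p :: "'a set"
    and n :: nat
  assumes "cring R" and "noetherian_ring R"
    and "primeideal p R"
    and "module R M"
    and "krull_dim (ring_at_prime R p) \<le> enat n"
    and "trivial_group
           (Ext (ring_at_prime R p) n (residue_module R p) (module_at_prime R p M))"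
  shows "\<forall>i\<ge>n. trivial_group
           (Ext (ring_at_prime R p) i (residue_module R p) (module_at_prime R p M))"
proof (intro allI impI)
  interpret prime_localization R p
    by (intro prime_localization.intro prime_localization_axioms.intro assms)
  interpret L: noetherian_local_ring Rp "extended_prime R p" by (rule Rp_local[OF assms(2)])
  have Mp: "module Rp (module_at_prime R p M)" by (rule Mp_module[OF assms(4)])
  note k = L.cyclic_is_module[OF extended_prime_ideal]
  fix i assume "n \<le> i"
  then show "trivial_group (Ext Rp i (residue_module R p) (module_at_prime R p M))"
  proof (induction i rule: dec_induct)
    case base
    show ?case by (rule assms(6))
  next
    case (step i)
    \<comment> \<open>The bound on the dimension is inherited by every larger degree, so the step
      applies at \<open>i\<close> in place of \<open>n\<close>.\<close>
    have "krull_dim Rp \<le> enat i" using assms(5) step.hyps(1) by (meson enat_ord_simps(1) order_trans)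
    then show ?case
      using L.residue_field_rigidity_step[OF Mp] step.IH
      unfolding residue_module_cyclic L.trivial_Ext_iff[OF k Mp] by blast
  qed
qed

end
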